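(* Let $p,q,r\in[1,\infty)$, and let $I=(0,T)$ with $T\in(0,\infty)$ or $I=\mathbb R_+$. Let $A$ be the diagonal operator on $X_{q,r}=\ell^q(\ell^r)$ given by $(Ax)_{m,n}=2^n x_{m,n}$ with its natural maximal domain. Then $A$ has maximal $L^p$-regularity on $I$ if and only if one of the following conditions holds: (i) $p>1$ and either $q>1$ or $r=1$; (ii) $p=q=r=1$.
   Context: All Banach spaces are complex; $\mathbb R_+=(0,\infty)$. For $q,r\in[1,\infty)$, $X_{q,r}=\ell^q(\ell^r)$ is the space of scalar double sequences $x=(x_{m,n})_{m,n\ge1}$ with $\|x\|=\bigl(\sum_{m\ge1}(\sum_{n\ge1}|x_{m,n}|^r)^{q/r}\bigr)^{1/q}<\infty$. The operator $A$ is $(Ax)_{m,n}:=2^nx_{m,n}$ with domain $\{x\in X_{q,r}:(2^nx_{m,n})_{m,n}\in X_{q,r}\}$; $-A$ generates the analytic $C_0$-semigroup $(S(t)x)_{m,n}=e^{-2^nt}x_{m,n}$. Maximal $L^p$-regularity: let $A$ be a densely defined sectorial operator on a Banach space $X$ such that $-A$ generates an analytic $C_0$-semigroup $(S(t))_{t\ge0}$. For $f\in L^1_{\rm loc}(\overline I;X)$ put $u_f(t):=\int_0^tS(t-s)f(s)\,ds$, $t\in I$. For $p\in[1,\infty]$, $A$ has maximal $L^p$-regularity on $I$ if there is a constant $C$ such that for all $f\in L^p(I;X)$ one has $u_f(t)\in \mathsf D(A)$ for almost all $t\in I$ and $\|Au_f\|_{L^p(I;X)}\le C\|f\|_{L^p(I;X)}$.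 *)

theory Defs
  imports "HOL-Analysis.Analysis" "HOL-Library.Function_Algebras"
begin

text \<open>
  The exponents of \<open>\<ell>\<^sup>q(\<ell>\<^sup>r)\<close> are variables of the theorem, so the spaces cannot be types. A complex
  Banach space is therefore given by a carrier \<open>V\<close> of families \<open>'i \<Rightarrow> complex\<close> with the pointwise
  vector operations, together with a norm \<open>N\<close> that is meaningful on \<open>V\<close> only. The pointwise real
  vector space structure on functions makes \<^const>\<open>Bochner_Integration.simple_bochner_integral\<close> available.
\<close>

instantiation "fun" :: (type, real_vector) real_vector
begin

definition scaleR_fun :: "real \<Rightarrow> ('a \<Rightarrow> 'b) \<Rightarrow> 'a \<Rightarrow> 'b" where
  "scaleR_fun c x = (\<lambda>i. c *\<^sub>R x i)"

instance
  by standard (auto simp: scaleR_fun_def fun_eq_iff scaleR_add_right scaleR_add_left)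

end

definition cscale :: "complex \<Rightarrow> ('i \<Rightarrow> complex) \<Rightarrow> ('i \<Rightarrow> complex)" where
  "cscale c x = (\<lambda>i. c * x i)"

definition complex_subspace :: "('i \<Rightarrow> complex) set \<Rightarrow> bool" where
  "complex_subspace V \<longleftrightarrow>
     0 \<in> V \<and> (\<forall>x\<in>V. \<forall>y\<in>V. x + y \<in> V) \<and> (\<forall>c. \<forall>x\<in>V. cscale c x \<in> V)"

definition complex_banach :: "('i \<Rightarrow> complex) set \<Rightarrow> (('i \<Rightarrow> complex) \<Rightarrow> real) \<Rightarrow> bool" where
  "complex_banach V N \<longleftrightarrow>
     complex_subspace V \<and>
     (\<forall>x\<in>V. N x \<ge> 0 \<and> (N x = 0 \<longleftrightarrow> x = 0)) \<and>
     (\<forall>c. \<forall>x\<in>V. N (cscale c x) = cmod c * N x) \<and>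
     (\<forall>x\<in>V. \<forall>y\<in>V. N (x + y) \<le> N x + N y) \<and>
     (\<forall>s. (\<forall>k::nat. s k \<in> V) \<and> (\<forall>e>0. \<exists>K. \<forall>i\<ge>K. \<forall>j\<ge>K. N (s i - s j) < e) \<longrightarrow>
        (\<exists>x\<in>V. (\<lambda>k. N (s k - x)) \<longlonglongrightarrow> 0))"


section \<open>Vector-valued measurability, integration and \<open>L\<^sup>p\<close>-spaces\<close>

definition strongly_measurable ::
  "('i \<Rightarrow> complex) set \<Rightarrow> (('i \<Rightarrow> complex) \<Rightarrow> real) \<Rightarrow> 'a measure \<Rightarrow> ('a \<Rightarrow> 'i \<Rightarrow> complex) \<Rightarrow> bool" where
  "strongly_measurable V N M f \<longleftrightarrow>
     (AE t in M. f t \<in> V) \<and>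
     (\<exists>g :: nat \<Rightarrow> 'a \<Rightarrow> 'i \<Rightarrow> complex.
        (\<forall>k. simple_function M (g k) \<and> g k ` space M \<subseteq> V) \<and>
        (AE t in M. (\<lambda>k. N (f t - g k t)) \<longlonglongrightarrow> 0))"

text \<open>The carrier version of \<^const>\<open>has_bochner_integral\<close>.\<close>

definition has_bochner_integral_in ::
  "('i \<Rightarrow> complex) set \<Rightarrow> (('i \<Rightarrow> complex) \<Rightarrow> real) \<Rightarrow> 'a measure \<Rightarrow> ('a \<Rightarrow> 'i \<Rightarrow> complex)
     \<Rightarrow> ('i \<Rightarrow> complex) \<Rightarrow> bool" where
  "has_bochner_integral_in V N M f x \<longleftrightarrow>
     strongly_measurable V N M f \<and> x \<in> V \<and>
     (\<exists>g :: nat \<Rightarrow> 'a \<Rightarrow> 'i \<Rightarrow> complex.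
        (\<forall>k. Bochner_Integration.simple_bochner_integrable M (g k) \<and> g k ` space M \<subseteq> V) \<and>
        (\<lambda>k. \<integral>\<^sup>+t. ennreal (N (f t - g k t)) \<partial>M) \<longlonglongrightarrow> 0 \<and>
        (\<lambda>k. N (x - Bochner_Integration.simple_bochner_integral M (g k))) \<longlonglongrightarrow> 0)"

definition bochner_integral_in ::
  "('i \<Rightarrow> complex) set \<Rightarrow> (('i \<Rightarrow> complex) \<Rightarrow> real) \<Rightarrow> 'a measure \<Rightarrow> ('a \<Rightarrow> 'i \<Rightarrow> complex)
     \<Rightarrow> ('i \<Rightarrow> complex)" where
  "bochner_integral_in V N M f = (THE x. has_bochner_integral_in V N M f x)"

definition Lp_space ::
  "('i \<Rightarrow> complex) set \<Rightarrow> (('i \<Rightarrow> complex) \<Rightarrow> real) \<Rightarrow> real \<Rightarrow> 'a measure \<Rightarrow> ('a \<Rightarrow> 'i \<Rightarrow> complex) set" where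
  "Lp_space V N p M =
     {f. strongly_measurable V N M f \<and> (\<integral>\<^sup>+t. ennreal (N (f t) powr p) \<partial>M) < \<infinity>}"

definition Lp_norm ::
  "(('i \<Rightarrow> complex) \<Rightarrow> real) \<Rightarrow> real \<Rightarrow> 'a measure \<Rightarrow> ('a \<Rightarrow> 'i \<Rightarrow> complex) \<Rightarrow> real" where
  "Lp_norm N p M f = (enn2real (\<integral>\<^sup>+t. ennreal (N (f t) powr p) \<partial>M)) powr (1 / p)"


section \<open>Sectorial operators and analytic semigroups\<close>

text \<open>An operator with domain \<open>D\<close> is represented by a function of which only the values on \<open>D\<close> matter.\<close>

definition linear_operator ::
  "('i \<Rightarrow> complex) set \<Rightarrow> ('i \<Rightarrow> complex) set \<Rightarrow> (('i \<Rightarrow> complex) \<Rightarrow> 'i \<Rightarrow> complex) \<Rightarrow> bool" where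
  "linear_operator V D A \<longleftrightarrow>
     D \<subseteq> V \<and> complex_subspace D \<and> (\<forall>x\<in>D. A x \<in> V) \<and>
     (\<forall>x\<in>D. \<forall>y\<in>D. A (x + y) = A x + A y) \<and> (\<forall>c. \<forall>x\<in>D. A (cscale c x) = cscale c (A x))"

definition bounded_operator ::
  "('i \<Rightarrow> complex) set \<Rightarrow> (('i \<Rightarrow> complex) \<Rightarrow> real) \<Rightarrow> (('i \<Rightarrow> complex) \<Rightarrow> 'i \<Rightarrow> complex) \<Rightarrow> bool" where
  "bounded_operator V N B \<longleftrightarrow> linear_operator V V B \<and> (\<exists>K. \<forall>x\<in>V. N (B x) \<le> K * N x)"

definition densely_defined ::
  "('i \<Rightarrow> complex) set \<Rightarrow> (('i \<Rightarrow> complex) \<Rightarrow> real) \<Rightarrow> ('i \<Rightarrow> complex) set \<Rightarrow> bool" where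
  "densely_defined V N D \<longleftrightarrow> (\<forall>x\<in>V. \<forall>e>0. \<exists>y\<in>D. N (x - y) < e)"

definition sector :: "real \<Rightarrow> complex set" where
  "sector \<omega> = {z. z \<noteq> 0 \<and> \<bar>Arg z\<bar> < \<omega>}"

text \<open>
  The spectrum lies in the closed sector of some angle \<open>\<omega> < \<pi>\<close>, and \<open>\<lambda> (\<lambda> - A)\<^sup>-\<^sup>1\<close> is bounded
  uniformly for \<open>\<lambda>\<close> outside that closed sector.
\<close>

definition sectorial ::
  "('i \<Rightarrow> complex) set \<Rightarrow> (('i \<Rightarrow> complex) \<Rightarrow> real) \<Rightarrow> ('i \<Rightarrow> complex) set
     \<Rightarrow> (('i \<Rightarrow> complex) \<Rightarrow> 'i \<Rightarrow> complex) \<Rightarrow> bool" where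
  "sectorial V N D A \<longleftrightarrow>
     linear_operator V D A \<and>
     (\<exists>\<omega>. 0 < \<omega> \<and> \<omega> < pi \<and>
       (\<exists>K. \<forall>\<mu>. \<mu> \<notin> closure (sector \<omega>) \<longrightarrow>
         (\<exists>R. bounded_operator V N R \<and>
           (\<forall>x\<in>V. R x \<in> D \<and> cscale \<mu> (R x) - A (R x) = x) \<and>
           (\<forall>x\<in>D. R (cscale \<mu> x - A x) = x) \<and>
           (\<forall>x\<in>V. cmod \<mu> * N (R x) \<le> K * N x))))"

definition C0_semigroup ::
  "('i \<Rightarrow> complex) set \<Rightarrow> (('i \<Rightarrow> complex) \<Rightarrow> real) \<Rightarrow> (real \<Rightarrow> ('i \<Rightarrow> complex) \<Rightarrow> 'i \<Rightarrow> complex) \<Rightarrow> bool" where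
  "C0_semigroup V N S \<longleftrightarrow>
     (\<forall>t\<ge>0. bounded_operator V N (S t)) \<and>
     (\<forall>x\<in>V. S 0 x = x) \<and>
     (\<forall>s\<ge>0. \<forall>t\<ge>0. \<forall>x\<in>V. S (s + t) x = S s (S t x)) \<and>
     (\<forall>x\<in>V. ((\<lambda>t. N (S t x - x)) \<longlongrightarrow> 0) (at_right 0))"

text \<open>\<open>-A\<close>, with domain \<open>D\<close>, is the infinitesimal generator of \<open>S\<close>.\<close>

definition neg_generates ::
  "('i \<Rightarrow> complex) set \<Rightarrow> (('i \<Rightarrow> complex) \<Rightarrow> real) \<Rightarrow> ('i \<Rightarrow> complex) set
     \<Rightarrow> (('i \<Rightarrow> complex) \<Rightarrow> 'i \<Rightarrow> complex) \<Rightarrow> (real \<Rightarrow> ('i \<Rightarrow> complex) \<Rightarrow> 'i \<Rightarrow> complex) \<Rightarrow> bool" where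
  "neg_generates V N D A S \<longleftrightarrow>
     C0_semigroup V N S \<and>
     D = {x \<in> V. \<exists>y\<in>V. ((\<lambda>h. N ((1 / h) *\<^sub>R (S h x - x) - y)) \<longlongrightarrow> 0) (at_right 0)} \<and>
     (\<forall>x\<in>D. ((\<lambda>h. N ((1 / h) *\<^sub>R (S h x - x) + A x)) \<longlongrightarrow> 0) (at_right 0))"

text \<open>All orbits extend holomorphically to an open sector and are continuous at \<open>0\<close> in that sector.\<close>

definition analytic_semigroup ::
  "('i \<Rightarrow> complex) set \<Rightarrow> (('i \<Rightarrow> complex) \<Rightarrow> real) \<Rightarrow> (real \<Rightarrow> ('i \<Rightarrow> complex) \<Rightarrow> 'i \<Rightarrow> complex) \<Rightarrow> bool" where
  "analytic_semigroup V N S \<longleftrightarrow>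
     C0_semigroup V N S \<and>
     (\<exists>\<eta>. 0 < \<eta> \<and> \<eta> < pi / 2 \<and>
       (\<forall>x\<in>V. \<exists>F :: complex \<Rightarrow> 'i \<Rightarrow> complex.
         (\<forall>t>0. F (complex_of_real t) = S t x) \<and>
         (\<forall>z\<in>sector \<eta>. F z \<in> V \<and>
           (\<exists>y\<in>V. ((\<lambda>h. N (cscale (1 / h) (F (z + h) - F z) - y)) \<longlongrightarrow> 0) (at 0))) \<and>
         ((\<lambda>z. N (F z - x)) \<longlongrightarrow> 0) (at 0 within sector \<eta>)))"


section \<open>Maximal \<open>L\<^sup>p\<close>-regularity\<close>

definition mild_solution ::
  "('i \<Rightarrow> complex) set \<Rightarrow> (('i \<Rightarrow> complex) \<Rightarrow> real) \<Rightarrow> (real \<Rightarrow> ('i \<Rightarrow> complex) \<Rightarrow> 'i \<Rightarrow> complex)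
     \<Rightarrow> (real \<Rightarrow> 'i \<Rightarrow> complex) \<Rightarrow> real \<Rightarrow> ('i \<Rightarrow> complex)" where
  "mild_solution V N S f t =
     bochner_integral_in V N (lebesgue_on {0<..<t}) (\<lambda>s. S (t - s) (f s))"

text \<open>
  The standing assumptions on \<open>A\<close> are part of the definition. The semigroup \<open>S\<close> is listed as a
  parameter, but \<^const>\<open>neg_generates\<close> determines \<open>S t\<close> on \<open>V\<close>, for \<open>t \<ge> 0\<close>, from \<open>A\<close>.
\<close>

definition maximal_Lp_regularity ::
  "('i \<Rightarrow> complex) set \<Rightarrow> (('i \<Rightarrow> complex) \<Rightarrow> real) \<Rightarrow> ('i \<Rightarrow> complex) set
     \<Rightarrow> (('i \<Rightarrow> complex) \<Rightarrow> 'i \<Rightarrow> complex) \<Rightarrow> (real \<Rightarrow> ('i \<Rightarrow> complex) \<Rightarrow> 'i \<Rightarrow> complex)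
     \<Rightarrow> real \<Rightarrow> real set \<Rightarrow> bool" where
  "maximal_Lp_regularity V N D A S p I \<longleftrightarrow>
     complex_banach V N \<and> densely_defined V N D \<and> sectorial V N D A \<and>
     neg_generates V N D A S \<and> analytic_semigroup V N S \<and>
     (\<exists>C. \<forall>f \<in> Lp_space V N p (lebesgue_on I).
        (AE t in lebesgue_on I. mild_solution V N S f t \<in> D) \<and>
        (\<lambda>t. A (mild_solution V N S f t)) \<in> Lp_space V N p (lebesgue_on I) \<and>
        Lp_norm N p (lebesgue_on I) (\<lambda>t. A (mild_solution V N S f t))
          \<le> C * Lp_norm N p (lebesgue_on I) f)"


section \<open>The space \<open>\<ell>\<^sup>q(\<ell>\<^sup>r)\<close> and the diagonal operator\<close>

text \<open>
  Double sequences indexed by \<open>m, n \<ge> 1\<close> are represented with indices starting at \<open>0\<close>: the value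
  at \<open>(m, n)\<close> stands for the entry with index \<open>(m + 1, n + 1)\<close>. Hence the factor \<open>2 ^ Suc n\<close> below.
\<close>

type_synonym dseq = "nat \<times> nat \<Rightarrow> complex"

definition lqr_space :: "real \<Rightarrow> real \<Rightarrow> dseq set" where
  "lqr_space q r =
     {x. (\<forall>m. summable (\<lambda>n. cmod (x (m, n)) powr r)) \<and>
         summable (\<lambda>m. (\<Sum>n. cmod (x (m, n)) powr r) powr (q / r))}"

definition lqr_norm :: "real \<Rightarrow> real \<Rightarrow> dseq \<Rightarrow> real" where
  "lqr_norm q r x = (\<Sum>m. (\<Sum>n. cmod (x (m, n)) powr r) powr (q / r)) powr (1 / q)"

definition diag_op :: "dseq \<Rightarrow> dseq" where
  "diag_op x = (\<lambda>(m, n). 2 ^ Suc n * x (m, n))"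

definition diag_dom :: "real \<Rightarrow> real \<Rightarrow> dseq set" where
  "diag_dom q r = {x \<in> lqr_space q r. diag_op x \<in> lqr_space q r}"

definition diag_semigroup :: "real \<Rightarrow> dseq \<Rightarrow> dseq" where
  "diag_semigroup t x = (\<lambda>(m, n). complex_of_real (exp (- (2 ^ Suc n * t))) * x (m, n))"

end

theory Submission
  imports Defs
begin

text \<open>
  On the coordinate \<open>(m, n)\<close> the operator \<open>A\<close> is multiplication by \<open>\<lambda> n = 2 ^ Suc n\<close>, so \<open>A u\<close> is there the
  convolution of the data with \<open>\<lambda> n * exp (- \<lambda> n * t)\<close>, a positive kernel of mass one. Bochner
  integrals in \<open>\<ell>\<^sup>q(\<ell>\<^sup>r)\<close> are computed coordinatewise (\<open>mild_solution_coordinates\<close>), and the semigroup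
  is analytic for all exponents. The theorem therefore asks when this diagonal family of positive
  convolutions is bounded on \<open>L\<^sup>p(I; \<ell>\<^sup>q(\<ell>\<^sup>r))\<close>.

  Sufficiency. After a discretisation of time the kernels become kernels on integers, and each of
  them is dominated by a mean, over translates of the dyadic grid and over coarser scales with
  summable weights, of the kernels of averaging operators \<open>E n\<close> onto dyadic blocks
  (\<open>exponential_le_block_averages\<close>). It remains to bound \<open>(f m n) \<mapsto> (E n (f m n))\<close> for averages over
  nested partitions of a finite set (\<open>mixed_norm_Stein\<close>), where everything is a finite sum.

  \<^item> For \<open>r = 1\<close> and \<open>q \<le> p\<close> this is the dual Doob inequality (\<open>dual_Doob\<close>): the \<open>p\<close>-th power of the norm
    of \<open>\<Sum>n. E n (f m n)\<close> is telescoped in \<open>n\<close>. The \<open>n\<close>-th increment is at most a sum over \<open>m\<close> of \<open>E n (f m n)\<close>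
    times factors that are constant on the cells of level \<open>n\<close>, so \<open>E n\<close> may be dropped under the sum
    over the space.
  \<^item> Duality turns this into maximal inequalities (\<open>Fefferman_Stein_of_Stein\<close>, \<open>Doob_maximal\<close>), and
    the iteration of Rubio de Francia then produces weights \<open>u\<close> with \<open>E n u \<le> C * u\<close>. For \<open>p < q\<close> one
    writes \<open>f = h * u\<close>; averages of \<open>f\<close> are bounded by \<open>u\<close> times averages of \<open>h\<close> with respect to the
    weight \<open>u\<close>, to which the dual Doob inequality applies with \<open>p = q\<close> (\<open>Stein_lt\<close>).
  \<^item> For \<open>r > 1\<close>, Hoelder's inequality interpolates between the case \<open>r = 1\<close> and the maximal function.

  Necessity. For \<open>p = 1 < q\<close> one short pulse is placed in the entries \<open>(n, n)\<close>, \<open>n < k\<close>. The solution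
  spends a comparable amount of \<open>L\<^sup>1\<close>-norm on each of \<open>k\<close> dyadic time scales, while the norm of the pulse
  only grows like \<open>k powr (1 / q)\<close>. For \<open>q = 1 < r\<close> the pulse is repeated in consecutive time cells,
  in a new row \<open>m\<close> each time. The \<open>\<ell>\<^sup>1\<close>-sum over the rows acts as an integral over time, and the same
  count gives \<open>k \<le> C * k powr (1 / r)\<close> whatever \<open>p\<close> is.
\<close>

section \<open>Inequalities for finite sums of powers\<close>

text \<open>
  All families to which \<open>pnorm\<close> is applied are nonnegative, so no absolute values occur. As
  \<open>0 powr 0 = 0\<close>, a factor \<open>v powr (q - 1)\<close> with \<open>q = 1\<close> is the indicator of \<open>v \<noteq> 0\<close>.
\<close>

definition pnorm :: "real \<Rightarrow> 'a set \<Rightarrow> ('a \<Rightarrow> real) \<Rightarrow> real" where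
  "pnorm q A y = (\<Sum>i\<in>A. y i powr q) powr (1 / q)"

text \<open>
  The convex function \<open>t powr s\<close> lies above its tangent at \<open>b\<close>.
\<close>

lemma powr_tangent_le:
  fixes a b s :: real
  assumes "0 \<le> a" "0 \<le> b" "1 \<le> s"
  shows "b powr s - a powr s \<le> s * b powr (s - 1) * (b - a)"
proof (cases "s = 1")
  case True
  then show ?thesis using assms by (cases "b = 0") auto
next
  case False
  then have s: "s > 1" using assms by simp
  have "a * b powr (s - 1) \<le> a powr s / s + (b powr (s - 1)) powr (s / (s - 1)) / (s / (s - 1))"
    using s assms by (intro Youngs_inequality) (auto simp: field_simps)
  also have "(b powr (s - 1)) powr (s / (s - 1)) = b powr s"
    using s by (simp add: powr_powr)
  finally have "s * (a * b powr (s - 1)) \<le> a powr s + (s - 1) * b powr s"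
    using s by (simp add: field_simps)
  moreover have "b powr (s - 1) * b = b powr s"
    using s assms by (cases "b = 0") (auto simp: powr_diff)
  ultimately show ?thesis by (simp add: algebra_simps)
qed

text \<open>
  Hoelder's inequality in logarithmically convex form. In this form weights can be absorbed into
  \<open>a\<close> and \<open>b\<close>, and every version used later is a substitution instance.
\<close>

lemma sum_geometric_mean_le:
  fixes a b :: "'a \<Rightarrow> real"
  assumes nn: "\<And>i. i \<in> A \<Longrightarrow> 0 \<le> a i" "\<And>i. i \<in> A \<Longrightarrow> 0 \<le> b i"
    and \<theta>: "0 < \<theta>" "0 < \<eta>" "\<theta> + \<eta> = 1"
  shows "(\<Sum>i\<in>A. a i powr \<theta> * b i powr \<eta>) \<le> (\<Sum>i\<in>A. a i) powr \<theta> * (\<Sum>i\<in>A. b i) powr \<eta>"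
proof (cases "finite A \<and> (\<Sum>i\<in>A. a i) > 0 \<and> (\<Sum>i\<in>A. b i) > 0")
  case True
  define a' where "a' = (\<Sum>i\<in>A. a i)"
  define b' where "b' = (\<Sum>i\<in>A. b i)"
  have pos: "a' > 0" "b' > 0" using True by (auto simp: a'_def b'_def)
  have "(\<Sum>i\<in>A. (a i / a') powr \<theta> * (b i / b') powr \<eta>) \<le> (\<Sum>i\<in>A. \<theta> * (a i / a') + \<eta> * (b i / b'))"
  proof (rule sum_mono)
    fix i assume i: "i \<in> A"
    show "(a i / a') powr \<theta> * (b i / b') powr \<eta> \<le> \<theta> * (a i / a') + \<eta> * (b i / b')"
    proof (cases "a i = 0 \<or> b i = 0")
      case True
      then show ?thesis using nn[OF i] pos \<theta> by auto
    next
      case False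
      then show ?thesis using nn[OF i] pos \<theta> by (intro Youngs_inequality_0) auto
    qed
  qed
  also have "\<dots> = \<theta> * ((\<Sum>i\<in>A. a i) / a') + \<eta> * ((\<Sum>i\<in>A. b i) / b')"
    by (simp add: sum.distrib sum_distrib_left sum_divide_distrib)
  also have "\<dots> = 1" using pos \<theta> by (simp add: a'_def b'_def)
  finally have le: "(\<Sum>i\<in>A. (a i / a') powr \<theta> * (b i / b') powr \<eta>) \<le> 1" .
  have "(\<Sum>i\<in>A. (a i / a') powr \<theta> * (b i / b') powr \<eta>)
      = (\<Sum>i\<in>A. a i powr \<theta> * b i powr \<eta>) / (a' powr \<theta> * b' powr \<eta>)"
    unfolding sum_divide_distrib
    by (rule sum.cong) (use nn pos in \<open>auto simp: powr_divide\<close>)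
  with le have "(\<Sum>i\<in>A. a i powr \<theta> * b i powr \<eta>) / (a' powr \<theta> * b' powr \<eta>) \<le> 1" by simp
  with pos have "(\<Sum>i\<in>A. a i powr \<theta> * b i powr \<eta>) \<le> a' powr \<theta> * b' powr \<eta>"
    by (subst (asm) divide_le_eq_1_pos) auto
  then show ?thesis by (simp add: a'_def b'_def)
next
  case False
  have "(\<Sum>i\<in>A. a i powr \<theta> * b i powr \<eta>) = 0"
  proof (cases "finite A")
    case fin: True
    have "(\<Sum>i\<in>A. a i) = 0 \<or> (\<Sum>i\<in>A. b i) = 0"
      using False fin sum_nonneg[of A a] sum_nonneg[of A b] nn by force
    then have "(\<forall>i\<in>A. a i = 0) \<or> (\<forall>i\<in>A. b i = 0)"
      using fin nn by (metis sum_nonneg_eq_0_iff)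
    then show ?thesis by (auto intro!: sum.neutral)
  qed auto
  then show ?thesis by simp
qed

text \<open>
  The form of Hoelder's inequality that closes estimates of a sum of \<open>p\<close>-th powers of \<open>v\<close>: after the
  power is differentiated, \<open>v\<close> enters with exponent \<open>p - 1\<close>.
\<close>

lemma sum_weighted_Holder:
  fixes f v \<mu> :: "'a \<Rightarrow> real"
  assumes nn: "\<And>i. i \<in> A \<Longrightarrow> 0 \<le> f i" "\<And>i. i \<in> A \<Longrightarrow> 0 \<le> v i" "\<And>i. i \<in> A \<Longrightarrow> 0 \<le> \<mu> i"
    and p: "1 \<le> p" and fin: "finite A"
  shows "(\<Sum>i\<in>A. \<mu> i * (f i * v i powr (p - 1)))
    \<le> (\<Sum>i\<in>A. \<mu> i * f i powr p) powr (1 / p) * (\<Sum>i\<in>A. \<mu> i * v i powr p) powr (1 - 1 / p)"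
proof (cases "p = 1")
  case True
  show ?thesis
  proof (cases "(\<Sum>i\<in>A. \<mu> i * v i) = 0")
    case z: True
    then have "\<forall>i\<in>A. \<mu> i * v i = 0" using nn fin by (subst (asm) sum_nonneg_eq_0_iff) auto
    then have "(\<Sum>i\<in>A. \<mu> i * (f i * v i powr (p - 1))) = 0"
      by (intro sum.neutral) auto
    then show ?thesis by simp
  next
    case nz: False
    have "(\<Sum>i\<in>A. \<mu> i * (f i * v i powr 0)) \<le> (\<Sum>i\<in>A. \<mu> i * f i)"
      using nn by (intro sum_mono) (auto simp: mult_left_mono)
    moreover have "(\<Sum>i\<in>A. \<mu> i * v i powr 1) = (\<Sum>i\<in>A. \<mu> i * v i)"
      "(\<Sum>i\<in>A. \<mu> i * f i powr 1) = (\<Sum>i\<in>A. \<mu> i * f i)"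
      using nn by (auto intro!: sum.cong)
    moreover have "0 \<le> (\<Sum>i\<in>A. \<mu> i * f i)" using nn by (auto intro!: sum_nonneg)
    ultimately show ?thesis using True nz by simp
  qed
next
  case False
  with p have p: "p > 1" by simp
  have "(\<Sum>i\<in>A. \<mu> i * (f i * v i powr (p - 1)))
     = (\<Sum>i\<in>A. (\<mu> i * f i powr p) powr (1/p) * (\<mu> i * v i powr p) powr (1 - 1/p))"
  proof (rule sum.cong[OF refl])
    fix i assume i: "i \<in> A"
    have "(\<mu> i * f i powr p) powr (1/p) * (\<mu> i * v i powr p) powr (1 - 1/p)
       = (\<mu> i powr (1/p) * \<mu> i powr (1 - 1/p)) * f i powr (p * (1/p)) * v i powr (p * (1 - 1/p))"
      using nn[OF i] by (simp add: powr_mult powr_powr)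
    also have "\<mu> i powr (1/p) * \<mu> i powr (1 - 1/p) = \<mu> i"
      using nn[OF i] by (simp flip: powr_add)
    also have "f i powr (p * (1/p)) = f i" using p nn[OF i] by simp
    also have "p * (1 - 1/p) = p - 1" using p by (simp add: field_simps)
    finally show "\<mu> i * (f i * v i powr (p - 1)) = (\<mu> i * f i powr p) powr (1/p) * (\<mu> i * v i powr p) powr (1 - 1/p)"
      by simp
  qed
  also have "\<dots> \<le> (\<Sum>i\<in>A. \<mu> i * f i powr p) powr (1 / p) * (\<Sum>i\<in>A. \<mu> i * v i powr p) powr (1 - 1 / p)"
    using p nn by (intro sum_geometric_mean_le) (auto simp: field_simps)
  finally show ?thesis .
qed

lemma pnorm_nonneg [simp]: "0 \<le> pnorm q A y"
  by (simp add: pnorm_def)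

lemma pnorm_powr: "q \<noteq> 0 \<Longrightarrow> pnorm q A y powr q = (\<Sum>i\<in>A. y i powr q)"
  by (simp add: pnorm_def powr_powr sum_nonneg)

lemma pnorm_zero [simp]: "pnorm q A (\<lambda>i. 0) = 0"
  by (simp add: pnorm_def)

lemma pnorm_cong: "(\<And>i. i \<in> A \<Longrightarrow> x i = y i) \<Longrightarrow> pnorm q A x = pnorm q A y"
  by (simp add: pnorm_def cong: sum.cong)

lemma pnorm_mono:
  assumes "\<And>i. i \<in> A \<Longrightarrow> 0 \<le> x i" "\<And>i. i \<in> A \<Longrightarrow> x i \<le> y i" "1 \<le> q"
  shows "pnorm q A x \<le> pnorm q A y"
  unfolding pnorm_def using assms by (intro powr_mono2 sum_mono sum_nonneg) auto

lemma pnorm_mono_set: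
  assumes "A \<subseteq> B" "finite B" "1 \<le> q"
  shows "pnorm q A x \<le> pnorm q B x"
  unfolding pnorm_def using assms by (intro powr_mono2 sum_mono2 sum_nonneg) auto

lemma pnorm_scale:
  assumes "0 \<le> c" "\<And>i. i \<in> A \<Longrightarrow> 0 \<le> x i" "1 \<le> q"
  shows "pnorm q A (\<lambda>i. c * x i) = c * pnorm q A x"
proof -
  have "(\<Sum>i\<in>A. (c * x i) powr q) = c powr q * (\<Sum>i\<in>A. x i powr q)"
    using assms by (auto simp: powr_mult sum_distrib_left intro!: sum.cong)
  then show ?thesis using assms by (simp add: pnorm_def powr_mult powr_powr sum_nonneg)
qed

lemma pnorm_component_le:
  assumes "finite A" "i \<in> A" "0 \<le> x i" "1 \<le> q"
  shows "x i \<le> pnorm q A x"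
proof -
  have "x i = (x i powr q) powr (1/q)" using assms by (simp add: powr_powr)
  also have "\<dots> \<le> pnorm q A x"
    unfolding pnorm_def using assms member_le_sum[of i A "\<lambda>i. x i powr q"] by (intro powr_mono2) auto
  finally show ?thesis .
qed

lemma pnorm_1: "(\<And>i. i \<in> A \<Longrightarrow> 0 \<le> x i) \<Longrightarrow> pnorm 1 A x = (\<Sum>i\<in>A. x i)"
  by (simp add: pnorm_def sum_nonneg cong: sum.cong)

lemma pnorm_Holder:
  assumes "\<And>i. i \<in> A \<Longrightarrow> 0 \<le> f i" "\<And>i. i \<in> A \<Longrightarrow> 0 \<le> v i" "1 \<le> q" "finite A"
  shows "(\<Sum>i\<in>A. f i * v i powr (q - 1)) \<le> pnorm q A f * pnorm q A v powr (q - 1)"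
proof -
  have "pnorm q A v powr (q - 1) = (\<Sum>i\<in>A. v i powr q) powr (1 - 1/q)"
    using assms by (simp add: pnorm_def powr_powr field_simps)
  then show ?thesis
    using sum_weighted_Holder[of A f v "\<lambda>_. 1" q] assms by (simp add: pnorm_def)
qed

lemma pnorm_geometric_mean_le:
  assumes nn: "\<And>i. i \<in> A \<Longrightarrow> 0 \<le> a i" "\<And>i. i \<in> A \<Longrightarrow> 0 \<le> b i"
    and \<theta>: "0 < \<theta>" "0 < \<eta>" "\<theta> + \<eta> = 1" and q: "1 \<le> q"
  shows "pnorm q A (\<lambda>i. a i powr \<theta> * b i powr \<eta>) \<le> pnorm q A a powr \<theta> * pnorm q A b powr \<eta>"
proof -
  have "(\<Sum>i\<in>A. (a i powr \<theta> * b i powr \<eta>) powr q) = (\<Sum>i\<in>A. (a i powr q) powr \<theta> * (b i powr q) powr \<eta>)"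
    using nn by (intro sum.cong) (auto simp: powr_mult powr_powr mult.commute)
  also have "\<dots> \<le> (\<Sum>i\<in>A. a i powr q) powr \<theta> * (\<Sum>i\<in>A. b i powr q) powr \<eta>"
    using \<theta> by (intro sum_geometric_mean_le) auto
  finally have "pnorm q A (\<lambda>i. a i powr \<theta> * b i powr \<eta>)
      \<le> ((\<Sum>i\<in>A. a i powr q) powr \<theta> * (\<Sum>i\<in>A. b i powr q) powr \<eta>) powr (1/q)"
    unfolding pnorm_def using q by (intro powr_mono2 sum_nonneg) auto
  also have "\<dots> = pnorm q A a powr \<theta> * pnorm q A b powr \<eta>"
    by (simp add: pnorm_def powr_mult powr_powr mult.commute)
  finally show ?thesis .
qed

lemma powr_eq_mult_powr:
  fixes x q :: real assumes "0 \<le> x" "q \<noteq> 0" shows "x powr q = x * x powr (q - 1)"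
  using assms by (cases "x = 0") (auto simp: powr_diff)

text \<open>
  Minkowski's inequality: test \<open>x + y\<close> against its own power \<open>q - 1\<close>, then divide.
\<close>

lemma pnorm_add_le:
  assumes nn: "\<And>i. i \<in> A \<Longrightarrow> 0 \<le> x i" "\<And>i. i \<in> A \<Longrightarrow> 0 \<le> y i" and q: "1 \<le> q" and fin: "finite A"
  shows "pnorm q A (\<lambda>i. x i + y i) \<le> pnorm q A x + pnorm q A y"
proof -
  let ?s = "\<lambda>i. x i + y i"
  define z where "z = pnorm q A ?s"
  have "z powr q = (\<Sum>i\<in>A. x i * ?s i powr (q - 1)) + (\<Sum>i\<in>A. y i * ?s i powr (q - 1))"
    unfolding z_def using q nn
    by (subst pnorm_powr) (auto simp: sum.distrib[symmetric] powr_eq_mult_powr[of "x _ + y _" q] algebra_simps intro!: sum.cong)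
  also have "\<dots> \<le> pnorm q A x * z powr (q - 1) + pnorm q A y * z powr (q - 1)"
    unfolding z_def using q nn fin by (intro add_mono pnorm_Holder) auto
  finally have *: "z * z powr (q - 1) \<le> (pnorm q A x + pnorm q A y) * z powr (q - 1)"
    using powr_eq_mult_powr[of z q] q by (simp add: z_def algebra_simps)
  show ?thesis
  proof (cases "z = 0")
    case True then show ?thesis by (simp add: z_def)
  next
    case False
    then have "z powr (q - 1) > 0" by simp
    with * show ?thesis by (simp add: z_def)
  qed
qed

lemma pnorm_sum_le:
  assumes nn: "\<And>i j. i \<in> A \<Longrightarrow> j \<in> J \<Longrightarrow> 0 \<le> x j i" and q: "1 \<le> q" and fin: "finite A" "finite J"
  shows "pnorm q A (\<lambda>i. \<Sum>j\<in>J. x j i) \<le> (\<Sum>j\<in>J. pnorm q A (x j))"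
  using fin(2) nn
proof (induction J rule: finite_induct)
  case (insert j J)
  have "pnorm q A (\<lambda>i. \<Sum>j\<in>insert j J. x j i) = pnorm q A (\<lambda>i. x j i + (\<Sum>j\<in>J. x j i))"
    using insert by simp
  also have "\<dots> \<le> pnorm q A (x j) + pnorm q A (\<lambda>i. \<Sum>j\<in>J. x j i)"
    using insert q fin by (intro pnorm_add_le) (auto intro!: sum_nonneg)
  also have "\<dots> \<le> pnorm q A (x j) + (\<Sum>j\<in>J. pnorm q A (x j))" using insert by auto
  finally show ?case using insert by simp
qed auto

text \<open>
  This absorbs the unknown quantity \<open>Z\<close>, which is a finite number in all applications, into the
  left-hand side.
\<close>

lemma le_of_le_geometric_mean:
  fixes Y Z K p :: real
  assumes "0 \<le> Y" "0 \<le> Z" "0 \<le> K" "1 \<le> p" and le: "Z \<le> K * (Y powr (1 / p) * Z powr (1 - 1 / p))"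
  shows "Z \<le> K powr p * Y"
proof (cases "Z = 0")
  case False
  then have Z: "Z > 0" using assms by simp
  have "Z = Z powr (1/p) * Z powr (1 - 1/p)" using Z by (simp flip: powr_add)
  with le have "Z powr (1/p) * Z powr (1 - 1/p) \<le> (K * Y powr (1 / p)) * Z powr (1 - 1 / p)"
    by (simp add: mult.assoc)
  then have "Z powr (1/p) \<le> K * Y powr (1/p)" using Z by simp
  then have "(Z powr (1/p)) powr p \<le> (K * Y powr (1/p)) powr p" using assms by (intro powr_mono2) auto
  then show ?thesis using assms Z by (simp add: powr_mult powr_powr)
qed (use assms in auto)

section \<open>Averages over nested partitions\<close>

text \<open>
  The cell of level \<open>n\<close> around \<open>x\<close> consists of the points that share the label of \<open>x\<close>; larger levels are
  finer.
\<close>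

locale nested_cells =
  fixes \<Omega> :: "'x set" and label :: "nat \<Rightarrow> 'x \<Rightarrow> 'l"
  assumes finite_space: "finite \<Omega>"
    and nested: "n \<le> k \<Longrightarrow> label k x = label k y \<Longrightarrow> label n x = label n y"
begin

definition cell :: "nat \<Rightarrow> 'x \<Rightarrow> 'x set" where
  "cell n x = {y \<in> \<Omega>. label n y = label n x}"

text \<open>
  On a cell of weight zero the quotient is \<open>0\<close>, a value with which \<open>avg_selfadjoint\<close> and \<open>sum_avg_mult\<close>
  hold there as well. This matters in \<open>Stein_lt\<close>, where the weight may vanish together with the data.
\<close>

definition avg :: "('x \<Rightarrow> real) \<Rightarrow> nat \<Rightarrow> ('x \<Rightarrow> real) \<Rightarrow> 'x \<Rightarrow> real" where
  "avg \<mu> n f x = (\<Sum>y\<in>cell n x. \<mu> y * f y) / (\<Sum>y\<in>cell n x. \<mu> y)"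

abbreviation E where "E \<equiv> avg (\<lambda>_. 1)"

lemma cell_subset: "cell n x \<subseteq> \<Omega>" by (auto simp: cell_def)

lemma finite_cell [simp]: "finite (cell n x)"
  using finite_space cell_subset by (rule finite_subset[rotated])

lemma self_in_cell: "x \<in> \<Omega> \<Longrightarrow> x \<in> cell n x" by (auto simp: cell_def)

lemma cell_eq: "label n x = label n y \<Longrightarrow> cell n x = cell n y" by (auto simp: cell_def)

lemma avg_const_on_cells: "n \<le> k \<Longrightarrow> label k x = label k y \<Longrightarrow> avg \<mu> n f x = avg \<mu> n f y"
  using cell_eq[OF nested, of n k x y] by (simp add: avg_def)

lemma avg_nonneg:
  assumes "\<And>y. y \<in> \<Omega> \<Longrightarrow> 0 \<le> \<mu> y" "\<And>y. y \<in> \<Omega> \<Longrightarrow> 0 \<le> f y"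
  shows "0 \<le> avg \<mu> n f x"
  unfolding avg_def using assms by (intro divide_nonneg_nonneg sum_nonneg) (auto simp: cell_def)

lemma avg_mono:
  assumes "\<And>y. y \<in> \<Omega> \<Longrightarrow> 0 \<le> \<mu> y" "\<And>y. y \<in> \<Omega> \<Longrightarrow> f y \<le> g y"
  shows "avg \<mu> n f x \<le> avg \<mu> n g x"
  unfolding avg_def using assms
  by (intro divide_right_mono sum_mono sum_nonneg mult_left_mono) (auto simp: cell_def)

lemma avg_selfadjoint:
  "(\<Sum>x\<in>\<Omega>. \<mu> x * (avg \<mu> n f x * g x)) = (\<Sum>x\<in>\<Omega>. \<mu> x * (f x * avg \<mu> n g x))"
proof -
  let ?m = "\<lambda>x. \<Sum>y\<in>cell n x. \<mu> y"
  have eq: "\<mu> x * (avg \<mu> n h x * k x)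
      = (\<Sum>y\<in>\<Omega>. if label n y = label n x then \<mu> x * \<mu> y * h y * k x / ?m x else 0)" for h k :: "'x \<Rightarrow> real" and x
  proof -
    have "\<mu> x * (avg \<mu> n h x * k x) = (\<Sum>y\<in>cell n x. \<mu> x * \<mu> y * h y * k x / ?m x)"
      by (simp add: avg_def sum_distrib_left sum_distrib_right sum_divide_distrib algebra_simps)
    also have "\<dots> = (\<Sum>y\<in>\<Omega>. if label n y = label n x then \<mu> x * \<mu> y * h y * k x / ?m x else 0)"
      unfolding cell_def by (rule sum.inter_filter[OF finite_space])
    finally show ?thesis .
  qed
  have "(\<Sum>x\<in>\<Omega>. \<mu> x * (avg \<mu> n f x * g x))
      = (\<Sum>y\<in>\<Omega>. \<Sum>x\<in>\<Omega>. if label n y = label n x then \<mu> x * \<mu> y * f y * g x / ?m x else 0)"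
    unfolding eq by (rule sum.swap)
  also have "\<dots> = (\<Sum>y\<in>\<Omega>. \<Sum>x\<in>\<Omega>. if label n x = label n y then \<mu> y * \<mu> x * g x * f y / ?m y else 0)"
  proof (intro sum.cong refl)
    fix x y
    show "(if label n y = label n x then \<mu> x * \<mu> y * f y * g x / ?m x else 0)
        = (if label n x = label n y then \<mu> y * \<mu> x * g x * f y / ?m y else 0)"
    proof (cases "label n x = label n y")
      case True
      then show ?thesis using cell_eq[OF True] by (simp add: mult_ac)
    qed auto
  qed
  also have "\<dots> = (\<Sum>y\<in>\<Omega>. \<mu> y * (avg \<mu> n g y * f y))"
    unfolding eq ..
  finally show ?thesis by (simp add: mult.commute)
qed

text \<open>
  A function that is constant on the cells of level \<open>n\<close> equals its own average wherever the weight is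
  nonzero, and averaging is selfadjoint.
\<close>

lemma sum_avg_mult:
  assumes \<mu>: "\<And>y. y \<in> \<Omega> \<Longrightarrow> 0 \<le> \<mu> y"
    and g: "\<And>x y. x \<in> \<Omega> \<Longrightarrow> y \<in> \<Omega> \<Longrightarrow> label n x = label n y \<Longrightarrow> g x = g y"
  shows "(\<Sum>x\<in>\<Omega>. \<mu> x * (avg \<mu> n f x * g x)) = (\<Sum>x\<in>\<Omega>. \<mu> x * (f x * g x))"
  unfolding avg_selfadjoint
proof (rule sum.cong[OF refl])
  fix x assume x: "x \<in> \<Omega>"
  show "\<mu> x * (f x * avg \<mu> n g x) = \<mu> x * (f x * g x)"
  proof (cases "\<mu> x = 0")
    case False
    then have "\<mu> x > 0" using \<mu> x by force
    then have pos: "(\<Sum>y\<in>cell n x. \<mu> y) > 0"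
      using self_in_cell[OF x] by (intro sum_pos2[of _ x]) (auto simp: cell_def finite_space intro: \<mu>)
    have "(\<Sum>y\<in>cell n x. \<mu> y * g y) = (\<Sum>y\<in>cell n x. \<mu> y * g x)"
      using x by (intro sum.cong refl) (auto simp: cell_def intro: g)
    also have "\<dots> = g x * (\<Sum>y\<in>cell n x. \<mu> y)" by (simp add: sum_distrib_left mult.commute)
    finally show ?thesis using pos by (simp add: avg_def)
  qed auto
qed

end

text \<open>
  The tangent inequality is used for the power \<open>p / q\<close> and for each power \<open>q\<close>. The condition \<open>q \<le> p\<close> makes
  the factor after \<open>y m - x m\<close> increasing in \<open>y\<close>, which is what \<open>dual_Doob\<close> relies on.
\<close>

lemma pnorm_powr_diff_le:
  assumes "\<And>m. m \<in> F \<Longrightarrow> 0 \<le> x m" "\<And>m. m \<in> F \<Longrightarrow> x m \<le> y m" and pq: "1 \<le> q" "q \<le> p"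
  shows "pnorm q F y powr p - pnorm q F x powr p
    \<le> p * (\<Sum>m\<in>F. (y m - x m) * (y m powr (q - 1) * pnorm q F y powr (p - q)))"
proof -
  have y: "0 \<le> y m" if "m \<in> F" for m using assms that by force
  define b where "b = (\<Sum>m\<in>F. y m powr q)"
  define a where "a = (\<Sum>m\<in>F. x m powr q)"
  have ab: "0 \<le> a" "0 \<le> b" by (auto simp: a_def b_def sum_nonneg)
  have e: "pnorm q F y powr p = b powr (p / q)" "pnorm q F x powr p = a powr (p / q)"
    "pnorm q F y powr (p - q) = b powr (p / q - 1)"
    using pq by (simp_all add: pnorm_def a_def b_def powr_powr diff_divide_distrib)
  have "b - a \<le> (\<Sum>m\<in>F. q * y m powr (q - 1) * (y m - x m))"
    unfolding a_def b_def sum_subtractf[symmetric] using assms y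
    by (intro sum_mono powr_tangent_le) auto
  then have ba: "b - a \<le> q * (\<Sum>m\<in>F. (y m - x m) * y m powr (q - 1))"
    by (simp add: sum_distrib_left algebra_simps)
  have "b powr (p / q) - a powr (p / q) \<le> (p / q) * b powr (p / q - 1) * (b - a)"
    using ab pq by (intro powr_tangent_le) auto
  also have "\<dots> \<le> (p / q) * b powr (p / q - 1) * (q * (\<Sum>m\<in>F. (y m - x m) * y m powr (q - 1)))"
    using pq by (intro mult_left_mono ba) auto
  also have "\<dots> = p * (\<Sum>m\<in>F. (y m - x m) * (y m powr (q - 1) * b powr (p / q - 1)))"
    using pq by (simp add: sum_distrib_left sum_distrib_right mult_ac)
  finally show ?thesis by (simp add: e)
qed

context nested_cells
begin

text \<open>
  Let \<open>S k\<close> be the partial sums of the averages. The increment of \<open>pnorm q F (S k) powr p\<close> is at most the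
  sum over \<open>m\<close> of the new average times a weight \<open>w\<close>. The average of level \<open>n\<close> meets the weight built from
  the levels up to \<open>n\<close>, which is constant on cells of level \<open>n\<close>; so the average can be replaced by \<open>f m n\<close>
  itself. Afterwards \<open>w\<close> is increased to its final value and Hoelder's inequality is applied twice.
\<close>

lemma dual_Doob:
  assumes \<mu>: "\<And>x. x \<in> \<Omega> \<Longrightarrow> 0 \<le> \<mu> x"
    and f: "\<And>m n x. m \<in> F \<Longrightarrow> x \<in> \<Omega> \<Longrightarrow> 0 \<le> f m n x"
    and pq: "1 \<le> q" "q \<le> p" and F: "finite F"
  shows "(\<Sum>x\<in>\<Omega>. \<mu> x * pnorm q F (\<lambda>m. \<Sum>n<N. avg \<mu> n (f m n) x) powr p)
    \<le> p powr p * (\<Sum>x\<in>\<Omega>. \<mu> x * pnorm q F (\<lambda>m. \<Sum>n<N. f m n x) powr p)"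
proof -
  define S where "S = (\<lambda>k x m. \<Sum>n<k. avg \<mu> n (f m n) x)"
  define w where "w = (\<lambda>k x m. S k x m powr (q - 1) * pnorm q F (S k x) powr (p - q))"
  define Z where "Z = (\<Sum>x\<in>\<Omega>. \<mu> x * pnorm q F (S N x) powr p)"
  define Y where "Y = (\<Sum>x\<in>\<Omega>. \<mu> x * pnorm q F (\<lambda>m. \<Sum>n<N. f m n x) powr p)"
  have avg0: "0 \<le> avg \<mu> n (f m n) x" if "m \<in> F" for m n x
    using \<mu> f[OF that] by (intro avg_nonneg)
  have S0: "0 \<le> S k x m" if "m \<in> F" for k x m unfolding S_def using avg0[OF that] by (simp add: sum_nonneg)
  have S_mono: "S k x m \<le> S l x m" if "m \<in> F" "k \<le> l" for k l x m
    unfolding S_def using avg0[OF that(1)] that by (intro sum_mono2) auto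
  have w_mono: "w k x m \<le> w N x m" if "m \<in> F" "k \<le> N" for k x m
    unfolding w_def using pq that S0 S_mono
    by (intro mult_mono powr_mono2 pnorm_mono) auto
  have w_cell: "w (Suc n) x m = w (Suc n) y m" if "label n x = label n y" for n x y m
  proof -
    have "S (Suc n) x = S (Suc n) y"
      unfolding S_def using that by (intro ext sum.cong refl avg_const_on_cells[of _ n]) auto
    then show ?thesis by (simp add: w_def)
  qed
  have step: "pnorm q F (S (Suc n) x) powr p - pnorm q F (S n x) powr p
      \<le> p * (\<Sum>m\<in>F. avg \<mu> n (f m n) x * w (Suc n) x m)" for n x
  proof -
    have "pnorm q F (S (Suc n) x) powr p - pnorm q F (S n x) powr p
       \<le> p * (\<Sum>m\<in>F. (S (Suc n) x m - S n x m) * (S (Suc n) x m powr (q - 1) * pnorm q F (S (Suc n) x) powr (p - q)))"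
      using pq S0 S_mono by (intro pnorm_powr_diff_le) auto
    then show ?thesis by (simp add: S_def w_def)
  qed
  have "pnorm q F (S N x) powr p = (\<Sum>n<N. pnorm q F (S (Suc n) x) powr p - pnorm q F (S n x) powr p)" for x
    by (subst sum_lessThan_telescope) (simp add: S_def pnorm_def)
  then have "Z = (\<Sum>x\<in>\<Omega>. \<mu> x * (\<Sum>n<N. pnorm q F (S (Suc n) x) powr p - pnorm q F (S n x) powr p))"
    by (simp add: Z_def)
  also have "\<dots> \<le> (\<Sum>x\<in>\<Omega>. \<mu> x * (\<Sum>n<N. p * (\<Sum>m\<in>F. avg \<mu> n (f m n) x * w (Suc n) x m)))"
    using \<mu> step by (intro sum_mono mult_left_mono) auto
  also have "\<dots> = p * (\<Sum>x\<in>\<Omega>. \<Sum>n<N. \<Sum>m\<in>F. \<mu> x * (avg \<mu> n (f m n) x * w (Suc n) x m))"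
    by (simp add: sum_distrib_left mult_ac)
  also have "(\<Sum>x\<in>\<Omega>. \<Sum>n<N. \<Sum>m\<in>F. \<mu> x * (avg \<mu> n (f m n) x * w (Suc n) x m))
      = (\<Sum>n<N. \<Sum>m\<in>F. \<Sum>x\<in>\<Omega>. \<mu> x * (avg \<mu> n (f m n) x * w (Suc n) x m))"
    by (subst sum.swap, rule sum.cong[OF refl], subst sum.swap) simp
  also have "\<dots> = (\<Sum>n<N. \<Sum>m\<in>F. \<Sum>x\<in>\<Omega>. \<mu> x * (f m n x * w (Suc n) x m))"
    by (intro sum.cong refl sum_avg_mult \<mu> w_cell)
  also have "\<dots> \<le> (\<Sum>n<N. \<Sum>m\<in>F. \<Sum>x\<in>\<Omega>. \<mu> x * (f m n x * w N x m))"
    using w_mono \<mu> f by (intro sum_mono mult_left_mono) auto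
  also have "\<dots> = (\<Sum>x\<in>\<Omega>. \<Sum>n<N. \<Sum>m\<in>F. \<mu> x * (f m n x * w N x m))"
    by (subst sum.swap[of _ _ \<Omega>], rule sum.cong[OF refl], subst sum.swap) simp
  also have "\<dots> = (\<Sum>x\<in>\<Omega>. \<mu> x * (pnorm q F (S N x) powr (p - q) * (\<Sum>m\<in>F. (\<Sum>n<N. f m n x) * S N x m powr (q - 1))))"
  proof (rule sum.cong[OF refl])
    fix x
    show "(\<Sum>n<N. \<Sum>m\<in>F. \<mu> x * (f m n x * w N x m))
      = \<mu> x * (pnorm q F (S N x) powr (p - q) * (\<Sum>m\<in>F. (\<Sum>n<N. f m n x) * S N x m powr (q - 1)))"
      by (subst sum.swap) (simp add: sum_distrib_left sum_distrib_right w_def mult_ac)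
  qed
  also have "\<dots> \<le> (\<Sum>x\<in>\<Omega>. \<mu> x * (pnorm q F (S N x) powr (p - q) *
       (pnorm q F (\<lambda>m. \<Sum>n<N. f m n x) * pnorm q F (S N x) powr (q - 1))))"
    using \<mu> f S0 pq F by (intro sum_mono mult_left_mono pnorm_Holder) (auto intro!: sum_nonneg)
  also have "\<dots> = (\<Sum>x\<in>\<Omega>. \<mu> x * (pnorm q F (\<lambda>m. \<Sum>n<N. f m n x) * pnorm q F (S N x) powr (p - 1)))"
  proof -
    have "a powr (p - q) * (b * a powr (q - 1)) = b * a powr (p - 1)" for a b :: real
      using powr_add[of a "p - q" "q - 1"] by (simp add: mult_ac)
    then show ?thesis by (simp only:)
  qed
  also have "\<dots> \<le> Y powr (1/p) * Z powr (1 - 1/p)"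
    unfolding Y_def Z_def using \<mu> pq finite_space
    by (intro sum_weighted_Holder[of \<Omega> "\<lambda>x. pnorm q F (\<lambda>m. \<Sum>n<N. f m n x)" "\<lambda>x. pnorm q F (S N x)" \<mu> p]) auto
  finally have "Z \<le> p * (Y powr (1/p) * Z powr (1 - 1/p))" using pq by simp
  moreover have "0 \<le> Y" "0 \<le> Z" using \<mu> by (auto simp: Y_def Z_def intro!: sum_nonneg)
  ultimately have "Z \<le> p powr p * Y"
    using pq le_of_le_geometric_mean[of Y Z p p] by simp
  then show ?thesis by (simp add: Z_def Y_def S_def)
qed

end

section \<open>Maximal averages, weights and the mixed-norm Stein inequality\<close>

lemma pnorm_Holder_conj:
  assumes nn: "\<And>i. i \<in> A \<Longrightarrow> 0 \<le> f i" "\<And>i. i \<in> A \<Longrightarrow> 0 \<le> g i" and q: "1 < q"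
  shows "(\<Sum>i\<in>A. f i * g i) \<le> pnorm q A f * pnorm (q / (q - 1)) A g"
proof -
  have e: "1 / (q / (q - 1)) = 1 - 1/q" using q by (simp add: field_simps)
  have "(\<Sum>i\<in>A. f i * g i) = (\<Sum>i\<in>A. (f i powr q) powr (1/q) * (g i powr (q / (q - 1))) powr (1 - 1/q))"
    using nn q by (intro sum.cong refl) (auto simp: powr_powr field_simps)
  also have "\<dots> \<le> (\<Sum>i\<in>A. f i powr q) powr (1/q) * (\<Sum>i\<in>A. g i powr (q / (q - 1))) powr (1 - 1/q)"
    using q by (intro sum_geometric_mean_le) auto
  finally show ?thesis unfolding pnorm_def e .
qed

context nested_cells
begin

text \<open>
  The element \<open>0\<close> gives the empty maximum a value and is harmless for nonnegative functions.
\<close>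

definition maxavg :: "nat \<Rightarrow> ('x \<Rightarrow> real) \<Rightarrow> 'x \<Rightarrow> real" where
  "maxavg N f x = Max (insert 0 ((\<lambda>n. E n f x) ` {..<N}))"

lemma maxavg_nonneg: "0 \<le> maxavg N f x"
  by (simp add: maxavg_def)

lemma avg_le_maxavg: "n < N \<Longrightarrow> E n f x \<le> maxavg N f x"
  by (simp add: maxavg_def)

lemma maxavg_mono:
  assumes "\<And>y. y \<in> \<Omega> \<Longrightarrow> f y \<le> g y"
  shows "maxavg N f x \<le> maxavg N g x"
proof -
  have "E n f x \<le> maxavg N g x" if "n < N" for n
    using avg_mono[of "\<lambda>_. 1" f g n x] assms avg_le_maxavg[OF that, of g x] by force
  then show ?thesis unfolding maxavg_def[of N f] by (auto simp: maxavg_nonneg)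
qed

text \<open>
  Choosing at every point a level that attains the maximum turns the maximal function into a sum of
  averages with coefficients; this is the linearisation needed for duality.
\<close>

lemma maxavg_linearize:
  "\<exists>a. (\<forall>n<N. 0 \<le> a n) \<and> (\<Sum>n<N. a n) \<le> 1 \<and> maxavg N f x = (\<Sum>n<N. a n * E n f x)"
proof -
  have "maxavg N f x \<in> insert 0 ((\<lambda>n. E n f x) ` {..<N})"
    unfolding maxavg_def by (rule Max_in) auto
  then consider "maxavg N f x = 0" | k where "k < N" "maxavg N f x = E k f x" by auto
  then show ?thesis
  proof cases
    case 1
    then show ?thesis by (intro exI[of _ "\<lambda>_. 0"]) auto
  next
    case 2
    have "(\<Sum>n<N. (if n = k then 1 else 0) * h n) = h k" for h :: "nat \<Rightarrow> real"
      using 2 by (simp add: if_distrib[of "\<lambda>c. c * _"] cong: if_cong)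
    note this[of "\<lambda>n. E n f x"] this[of "\<lambda>_. 1"]
    then show ?thesis using 2 by (intro exI[of _ "\<lambda>n. if n = k then 1 else 0"]) auto
  qed
qed

text \<open>
  The bound for \<open>\<Sum>n. E n (f m n)\<close> with the conjugate exponents implies the vector-valued maximal
  inequality. The function \<open>\<gamma>\<close> is the extremal element that norms the maximal function in the duality of
  the mixed-norm spaces. After linearisation all averages are moved onto the coefficients times \<open>\<gamma>\<close>, and
  these sum to at most \<open>\<gamma>\<close>.
\<close>

lemma Fefferman_Stein_of_Stein:
  assumes Stein: "\<And>f. (\<And>m n x. m \<in> F \<Longrightarrow> x \<in> \<Omega> \<Longrightarrow> 0 \<le> f m n x) \<Longrightarrow>
      (\<Sum>x\<in>\<Omega>. pnorm (q / (q - 1)) F (\<lambda>m. \<Sum>n<N. E n (f m n) x) powr (p / (p - 1)))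
      \<le> K * (\<Sum>x\<in>\<Omega>. pnorm (q / (q - 1)) F (\<lambda>m. \<Sum>n<N. f m n x) powr (p / (p - 1)))"
    and \<phi>: "\<And>m x. m \<in> F \<Longrightarrow> x \<in> \<Omega> \<Longrightarrow> 0 \<le> \<phi> m x"
    and pq: "1 < p" "1 < q" and K: "0 \<le> K"
  shows "(\<Sum>x\<in>\<Omega>. pnorm q F (\<lambda>m. maxavg N (\<phi> m) x) powr p)
    \<le> K powr (p - 1) * (\<Sum>x\<in>\<Omega>. pnorm q F (\<lambda>m. \<phi> m x) powr p)"
proof -
  define q' where "q' = q / (q - 1)"
  define p' where "p' = p / (p - 1)"
  have pq': "1 < p'" "1 < q'" using pq by (auto simp: p'_def q'_def field_simps)
  have inv_p': "1 / p' = 1 - 1/p" using pq by (simp add: p'_def field_simps)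
  define M where "M = (\<lambda>x m. maxavg N (\<phi> m) x)"
  define \<gamma> where "\<gamma> = (\<lambda>m x. M x m powr (q - 1) * pnorm q F (M x) powr (p - q))"
  define Z where "Z = (\<Sum>x\<in>\<Omega>. pnorm q F (M x) powr p)"
  define Y where "Y = (\<Sum>x\<in>\<Omega>. pnorm q F (\<lambda>m. \<phi> m x) powr p)"
  have M0: "0 \<le> M x m" for x m by (simp add: M_def maxavg_nonneg)
  have \<gamma>0: "0 \<le> \<gamma> m x" for x m by (simp add: \<gamma>_def)
  (* The coefficients depend on the point x; they multiply the averages from outside. *)
  have "\<forall>x m. \<exists>a. (\<forall>n<N. 0 \<le> a n) \<and> (\<Sum>n<N. a n) \<le> 1 \<and> M x m = (\<Sum>n<N. a n * E n (\<phi> m) x)"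
    unfolding M_def using maxavg_linearize by blast
  then obtain a where a0: "\<And>x m n. n < N \<Longrightarrow> 0 \<le> a x m n" and a1: "\<And>x m. (\<Sum>n<N. a x m n) \<le> 1"
    and Ma: "\<And>x m. M x m = (\<Sum>n<N. a x m n * E n (\<phi> m) x)"
    by metis
  define f where "f = (\<lambda>m n x. if n < N then a x m n * \<gamma> m x else 0)"
  have f0: "0 \<le> f m n x" for m n x using a0 \<gamma>0 by (simp add: f_def)
  define G where "G = (\<lambda>x m. \<Sum>n<N. E n (f m n) x)"
  have G0: "0 \<le> G x m" for x m unfolding G_def using f0 by (intro sum_nonneg avg_nonneg) auto
  have \<gamma>_norm: "pnorm q' F (\<lambda>m. \<gamma> m x) powr p' = pnorm q F (M x) powr p" for x
  proof -
    define b where "b = pnorm q F (M x)"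
    have "(\<Sum>m\<in>F. \<gamma> m x powr q') = (\<Sum>m\<in>F. M x m powr q * b powr ((p - q) * q'))"
      using M0 pq by (intro sum.cong refl) (auto simp: \<gamma>_def b_def powr_mult powr_powr q'_def)
    also have "\<dots> = b powr q * b powr ((p - q) * q')"
      using pq by (simp add: b_def pnorm_powr sum_distrib_right)
    also have "\<dots> = b powr ((p - 1) * q')"
      unfolding powr_add[symmetric] using pq by (intro arg_cong[where f="\<lambda>t. b powr t"]) (simp add: q'_def field_simps)
    finally have "pnorm q' F (\<lambda>m. \<gamma> m x) = b powr (p - 1)"
      using pq' by (simp add: pnorm_def powr_powr)
    then show ?thesis using pq by (simp add: powr_powr b_def p'_def)
  qed
  have "Z = (\<Sum>x\<in>\<Omega>. \<Sum>m\<in>F. M x m * \<gamma> m x)"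
    unfolding Z_def
  proof (rule sum.cong[OF refl])
    fix x
    have "(\<Sum>m\<in>F. M x m * \<gamma> m x) = (\<Sum>m\<in>F. M x m powr q) * pnorm q F (M x) powr (p - q)"
      unfolding sum_distrib_right \<gamma>_def using M0 pq powr_eq_mult_powr[of "M x _" q]
      by (intro sum.cong refl) (auto simp: mult_ac)
    also have "\<dots> = pnorm q F (M x) powr q * pnorm q F (M x) powr (p - q)"
      using pq by (simp add: pnorm_powr)
    finally show "pnorm q F (M x) powr p = (\<Sum>m\<in>F. M x m * \<gamma> m x)" by (simp flip: powr_add)
  qed
  also have "\<dots> = (\<Sum>x\<in>\<Omega>. \<Sum>m\<in>F. \<Sum>n<N. 1 * (E n (\<phi> m) x * f m n x))"
    by (intro sum.cong refl) (simp add: Ma f_def sum_distrib_left sum_distrib_right mult_ac)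
  also have "\<dots> = (\<Sum>m\<in>F. \<Sum>n<N. \<Sum>x\<in>\<Omega>. 1 * (E n (\<phi> m) x * f m n x))"
    by (subst sum.swap, rule sum.cong[OF refl], subst sum.swap) simp
  also have "\<dots> = (\<Sum>m\<in>F. \<Sum>n<N. \<Sum>x\<in>\<Omega>. 1 * (\<phi> m x * E n (f m n) x))"
    by (intro sum.cong refl avg_selfadjoint)
  also have "\<dots> = (\<Sum>x\<in>\<Omega>. \<Sum>m\<in>F. \<Sum>n<N. 1 * (\<phi> m x * E n (f m n) x))"
    by (subst sum.swap[of _ _ \<Omega>], rule sum.cong[OF refl], subst sum.swap) simp
  also have "\<dots> = (\<Sum>x\<in>\<Omega>. \<Sum>m\<in>F. \<phi> m x * G x m)"
    by (simp add: G_def sum_distrib_left)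
  also have "\<dots> \<le> (\<Sum>x\<in>\<Omega>. pnorm q F (\<lambda>m. \<phi> m x) * pnorm q' F (G x))"
    unfolding q'_def using \<phi> G0 pq by (intro sum_mono pnorm_Holder_conj) auto
  also have "\<dots> \<le> pnorm p \<Omega> (\<lambda>x. pnorm q F (\<lambda>m. \<phi> m x)) * pnorm p' \<Omega> (\<lambda>x. pnorm q' F (G x))"
    unfolding p'_def using pq by (intro pnorm_Holder_conj) auto
  also have "pnorm p' \<Omega> (\<lambda>x. pnorm q' F (G x)) \<le> (K * Z) powr (1 - 1/p)"
  proof -
    have "(\<Sum>x\<in>\<Omega>. pnorm q' F (G x) powr p') \<le> K * (\<Sum>x\<in>\<Omega>. pnorm q' F (\<lambda>m. \<Sum>n<N. f m n x) powr p')"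
      unfolding G_def q'_def p'_def by (rule Stein) (rule f0)
    also have "\<dots> \<le> K * (\<Sum>x\<in>\<Omega>. pnorm q' F (\<lambda>m. \<gamma> m x) powr p')"
    proof (intro mult_left_mono sum_mono powr_mono2 pnorm_mono)
      fix x m
      have "(\<Sum>n<N. f m n x) = (\<Sum>n<N. a x m n) * \<gamma> m x" by (simp add: f_def sum_distrib_right)
      then show "(\<Sum>n<N. f m n x) \<le> \<gamma> m x"
        using mult_right_mono[OF a1[of x m] \<gamma>0[of m x]] by simp
    qed (use pq' K f0 in \<open>auto intro!: sum_nonneg\<close>)
    also have "\<dots> = K * Z" by (simp add: \<gamma>_norm Z_def)
    finally show ?thesis unfolding pnorm_def[of p'] inv_p' using pq
      by (intro powr_mono2) (auto intro!: sum_nonneg)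
  qed
  also have "pnorm p \<Omega> (\<lambda>x. pnorm q F (\<lambda>m. \<phi> m x)) = Y powr (1/p)"
    by (simp add: pnorm_def[of p] Y_def)
  finally have "Z \<le> Y powr (1/p) * (K * Z) powr (1 - 1/p)" by (simp add: mult_left_mono)
  moreover have YZ: "0 \<le> Y" "0 \<le> Z" by (auto simp: Y_def Z_def intro!: sum_nonneg)
  ultimately have "Z \<le> K powr (1 - 1/p) * (Y powr (1/p) * Z powr (1 - 1/p))"
    using K by (simp add: powr_mult mult_ac)
  then have "Z \<le> (K powr (1 - 1/p)) powr p * Y"
    using YZ pq le_of_le_geometric_mean[of Y Z "K powr (1 - 1/p)" p] by simp
  also have "(K powr (1 - 1/p)) powr p = K powr (p - 1)"
  proof -
    have "(1 - 1/p) * p = p - 1" using pq by (simp add: field_simps)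
    then show ?thesis by (simp add: powr_powr)
  qed
  finally show ?thesis by (simp add: Z_def Y_def M_def)
qed

text \<open>
  The scalar case, with one index \<open>m\<close>. The constant comes out as \<open>s / (s - 1)\<close> because the conjugate
  exponent \<open>s'\<close> satisfies \<open>s' * (s - 1) = s\<close>.
\<close>

lemma Doob_maximal:
  assumes s: "1 < s" and f: "\<And>x. x \<in> \<Omega> \<Longrightarrow> 0 \<le> f x"
  shows "pnorm s \<Omega> (maxavg N f) \<le> s / (s - 1) * pnorm s \<Omega> f"
proof -
  define s' where "s' = s / (s - 1)"
  have s': "1 < s'" "s' * (s - 1) = s" using s by (auto simp: s'_def field_simps)
  have one: "pnorm t {()} h = h ()" if "0 \<le> h ()" "t \<noteq> 0" for t and h :: "unit \<Rightarrow> real"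
    using that by (simp add: pnorm_def powr_powr)
  have "(\<Sum>x\<in>\<Omega>. pnorm s {()} (\<lambda>m. maxavg N f x) powr s)
    \<le> (s' powr s') powr (s - 1) * (\<Sum>x\<in>\<Omega>. pnorm s {()} (\<lambda>m. f x) powr s)"
  proof (rule Fefferman_Stein_of_Stein)
    fix g :: "unit \<Rightarrow> nat \<Rightarrow> 'x \<Rightarrow> real"
    assume g: "\<And>m n x. m \<in> {()} \<Longrightarrow> x \<in> \<Omega> \<Longrightarrow> 0 \<le> g m n x"
    show "(\<Sum>x\<in>\<Omega>. pnorm (s / (s - 1)) {()} (\<lambda>m. \<Sum>n<N. E n (g m n) x) powr (s / (s - 1)))
      \<le> s' powr s' * (\<Sum>x\<in>\<Omega>. pnorm (s / (s - 1)) {()} (\<lambda>m. \<Sum>n<N. g m n x) powr (s / (s - 1)))"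
      using dual_Doob[of "\<lambda>_. 1" "{()}" g s' s' N] g s' by (simp add: s'_def)
  qed (use s s' f in auto)
  moreover have "(s' powr s') powr (s - 1) = s' powr s" using s' by (simp add: powr_powr)
  ultimately have "(\<Sum>x\<in>\<Omega>. maxavg N f x powr s) \<le> s' powr s * (\<Sum>x\<in>\<Omega>. f x powr s)"
    using s f by (simp add: one maxavg_nonneg)
  then have "pnorm s \<Omega> (maxavg N f) \<le> (s' powr s * (\<Sum>x\<in>\<Omega>. f x powr s)) powr (1/s)"
    unfolding pnorm_def using s by (intro powr_mono2) (auto intro!: sum_nonneg)
  also have "\<dots> = s' * pnorm s \<Omega> f" using s s' by (simp add: pnorm_def powr_mult powr_powr)
  finally show ?thesis by (simp add: s'_def)
qed

text \<open>
  With the constant \<open>c\<close> of Doob's inequality, \<open>u\<close> solves \<open>u = u0 + maxavg N u / (2 * c)\<close>. The iterates of the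
  right-hand side increase and their norms stay below \<open>2 * pnorm s \<Omega> u0\<close>, since the second term at most
  halves the norm.
\<close>

lemma Rubio_de_Francia:
  assumes s: "1 < s" and u0: "\<And>x. x \<in> \<Omega> \<Longrightarrow> 0 \<le> u0 x"
  obtains u where "\<And>x. x \<in> \<Omega> \<Longrightarrow> u0 x \<le> u x" "pnorm s \<Omega> u \<le> 2 * pnorm s \<Omega> u0"
    "\<And>n x. n < N \<Longrightarrow> x \<in> \<Omega> \<Longrightarrow> E n u x \<le> 2 * (s / (s - 1)) * u x"
proof -
  define c where "c = s / (s - 1)"
  have c: "0 < c" using s by (simp add: c_def)
  define v where "v = rec_nat u0 (\<lambda>_ w x. u0 x + maxavg N w x / (2 * c))"
  have v_0: "v 0 = u0" and v_Suc: "v (Suc k) = (\<lambda>x. u0 x + 1 / (2 * c) * maxavg N (v k) x)" for k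
    by (simp_all add: v_def)
  have v_ge: "u0 x \<le> v k x" if "x \<in> \<Omega>" for k x
    using c maxavg_nonneg by (cases k) (auto simp: v_0 v_Suc)
  have v_nn: "0 \<le> v k x" if "x \<in> \<Omega>" for k x using v_ge[OF that, of k] u0[OF that] by linarith
  have v_mono: "v k x \<le> v (Suc k) x" if "x \<in> \<Omega>" for k x
    using that
  proof (induction k arbitrary: x)
    case 0
    then show ?case using v_ge[of x "Suc 0"] by (simp add: v_0)
  next
    case (Suc k)
    then have "maxavg N (v k) x \<le> maxavg N (v (Suc k)) x" by (intro maxavg_mono) auto
    then show ?case unfolding v_Suc[of k] v_Suc[of "Suc k"] using c by (simp add: divide_right_mono)
  qed
  have v_norm: "pnorm s \<Omega> (v k) \<le> 2 * pnorm s \<Omega> u0" for k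
  proof (induction k)
    case (Suc k)
    have "pnorm s \<Omega> (v (Suc k)) \<le> pnorm s \<Omega> u0 + pnorm s \<Omega> (\<lambda>x. 1 / (2 * c) * maxavg N (v k) x)"
      unfolding v_Suc using s u0 c maxavg_nonneg finite_space by (intro pnorm_add_le) auto
    also have "pnorm s \<Omega> (\<lambda>x. 1 / (2 * c) * maxavg N (v k) x) = 1 / (2 * c) * pnorm s \<Omega> (maxavg N (v k))"
      using s c maxavg_nonneg by (intro pnorm_scale) auto
    also have "\<dots> \<le> 1 / (2 * c) * (c * pnorm s \<Omega> (v k))"
      unfolding c_def using Doob_maximal[OF s v_nn] s by (intro mult_left_mono) auto
    also have "\<dots> = pnorm s \<Omega> (v k) / 2" using c by simp
    finally show ?case using Suc.IH by simp
  qed (simp add: v_0)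
  have v_bound: "v k x \<le> 2 * pnorm s \<Omega> u0" if "x \<in> \<Omega>" for k x
    using pnorm_component_le[OF finite_space that, of "v k" s] v_nn[OF that, of k] v_norm[of k] s by linarith
  define u where "u = (\<lambda>x. lim (\<lambda>k. v k x))"
  have conv: "(\<lambda>k. v k x) \<longlonglongrightarrow> u x" if "x \<in> \<Omega>" for x
  proof -
    have "incseq (\<lambda>k. v k x)" using v_mono[OF that] by (intro incseq_SucI)
    moreover have "Bseq (\<lambda>k. v k x)"
      using v_nn[OF that] v_bound[OF that] by (intro BseqI'[of _ "2 * pnorm s \<Omega> u0"]) auto
    ultimately have "convergent (\<lambda>k. v k x)" by (intro Bseq_mono_convergent) (auto simp: incseq_def)
    then show ?thesis by (simp add: u_def convergent_LIMSEQ_iff)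
  qed
  have avg_conv: "(\<lambda>k. E n (v k) x) \<longlonglongrightarrow> E n u x" if "x \<in> \<Omega>" for n x
  proof -
    have "cell n x \<noteq> {}" using self_in_cell[OF that] by blast
    then show ?thesis unfolding avg_def
      by (intro tendsto_divide tendsto_sum tendsto_mult tendsto_const conv subsetD[OF cell_subset]) auto
  qed
  show thesis
  proof
    show "u0 x \<le> u x" if "x \<in> \<Omega>" for x
      using conv[OF that] v_ge[OF that] by (intro LIMSEQ_le_const) auto
    have "(\<lambda>k. pnorm s \<Omega> (v k)) \<longlonglongrightarrow> pnorm s \<Omega> u"
      unfolding pnorm_def using s conv v_nn
      by (intro tendsto_powr2 tendsto_sum tendsto_const) (auto intro!: always_eventually sum_nonneg)
    then show "pnorm s \<Omega> u \<le> 2 * pnorm s \<Omega> u0"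
      using v_norm by (intro LIMSEQ_le_const2) auto
    show "E n u x \<le> 2 * (s / (s - 1)) * u x" if "n < N" "x \<in> \<Omega>" for n x
    proof -
      have "E n (v k) x \<le> 2 * c * v (Suc k) x" for k
      proof -
        have "E n (v k) x \<le> maxavg N (v k) x" using that by (intro avg_le_maxavg)
        also have "\<dots> \<le> 2 * c * v (Suc k) x" using u0[OF that(2)] c by (simp add: v_Suc distrib_left)
        finally show ?thesis .
      qed
      moreover have "(\<lambda>k. 2 * c * v (Suc k) x) \<longlonglongrightarrow> 2 * c * u x"
        using conv[OF that(2)] by (intro tendsto_mult tendsto_const LIMSEQ_Suc)
      ultimately have "E n u x \<le> 2 * c * u x"
        by (intro LIMSEQ_le[OF avg_conv[OF that(2)]]) auto
      then show ?thesis by (simp add: c_def)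
    qed
  qed
qed


text \<open>
  Here the increments in \<open>dual_Doob\<close> are not monotone. Instead the norm with exponent \<open>p\<close> is written as a
  weighted norm with exponent \<open>q\<close> and weight \<open>u powr (1 - q)\<close>, where \<open>u\<close> is essentially the power
  \<open>(q - p) / (q - 1)\<close> of the pointwise norm \<open>g\<close> of the data, corrected such that \<open>E n u \<le> K * u\<close>. The
  exponent \<open>s\<close> is chosen such that \<open>u0 powr s = g powr p\<close>; it exceeds \<open>1\<close> exactly because \<open>p > 1\<close>. With
  \<open>f = u * h\<close>, averages of \<open>f\<close> become \<open>u\<close>-weighted averages of \<open>h\<close>, up to the factor \<open>K * u\<close>.
\<close>

lemma Stein_lt:
  assumes pq: "1 < p" "p < q" and F: "finite F"
    and f: "\<And>m n x. m \<in> F \<Longrightarrow> x \<in> \<Omega> \<Longrightarrow> 0 \<le> f m n x"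
  defines "s \<equiv> p * (q - 1) / (q - p)"
  shows "(\<Sum>x\<in>\<Omega>. pnorm q F (\<lambda>m. \<Sum>n<N. E n (f m n) x) powr p)
    \<le> (2 * (s / (s - 1))) powr p * (q powr p * 2 powr (s * (1 - p / q)))
        * (\<Sum>x\<in>\<Omega>. pnorm q F (\<lambda>m. \<Sum>n<N. f m n x) powr p)"
proof -
  define g where "g = (\<lambda>x. pnorm q F (\<lambda>m. \<Sum>n<N. f m n x))"
  define Y where "Y = (\<Sum>x\<in>\<Omega>. g x powr p)"
  define u0 where "u0 = (\<lambda>x. g x powr ((q - p) / (q - 1)))"
  define K where "K = 2 * (s / (s - 1))"
  have "q - p < p * (q - 1)"
  proof -
    have "p * (q - 1) - (q - p) = q * (p - 1)" by (simp add: algebra_simps)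
    also have "\<dots> > 0" using pq by simp
    finally show ?thesis by simp
  qed
  then have s: "1 < s" using pq by (simp add: s_def field_simps)
  then have K: "0 \<le> K" by (simp add: K_def)
  have Y: "0 \<le> Y" by (simp add: Y_def sum_nonneg)
  have g0: "0 \<le> g x" for x by (simp add: g_def)
  have u0_nn: "0 \<le> u0 x" for x by (simp add: u0_def)
  obtain u where u_ge: "\<And>x. x \<in> \<Omega> \<Longrightarrow> u0 x \<le> u x" and u_norm: "pnorm s \<Omega> u \<le> 2 * pnorm s \<Omega> u0"
    and u_avg: "\<And>n x. n < N \<Longrightarrow> x \<in> \<Omega> \<Longrightarrow> E n u x \<le> K * u x"
    using Rubio_de_Francia[OF s, of u0 N] u0_nn unfolding K_def by metis
  have u_nn: "0 \<le> u x" if "x \<in> \<Omega>" for x using u_ge[OF that] u0_nn[of x] by linarith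
  (* Division by u loses nothing: where u vanishes, so do u0, g and all entries of f. *)
  have f_zero: "f m n x = 0" if "u x = 0" "x \<in> \<Omega>" "m \<in> F" "n < N" for m n x
  proof -
    have "u0 x = 0" using u_ge[OF that(2)] u0_nn[of x] that by simp
    then have "g x = 0" by (simp add: u0_def)
    then have "(\<Sum>n<N. f m n x) \<le> 0"
      using pnorm_component_le[OF F that(3), of "\<lambda>m. \<Sum>n<N. f m n x" q] f that pq
      by (simp add: g_def sum_nonneg)
    then have "(\<Sum>n<N. f m n x) = 0" using f that by (intro antisym sum_nonneg) auto
    then show ?thesis using f that by (subst (asm) sum_nonneg_eq_0_iff) auto
  qed
  define h where "h = (\<lambda>m n x. f m n x / u x)"
  have h0: "0 \<le> h m n x" if "m \<in> F" "x \<in> \<Omega>" for m n x using f u_nn that by (simp add: h_def)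
  have fh: "f m n x = u x * h m n x" if "x \<in> \<Omega>" "m \<in> F" "n < N" for m n x
    using f_zero[of x m n] that by (auto simp: h_def)
  have avg_le: "E n (f m n) x \<le> K * u x * avg u n (h m n) x"
    if "x \<in> \<Omega>" "m \<in> F" "n < N" for m n x
  proof -
    have "(\<Sum>y\<in>cell n x. f m n y) = (\<Sum>y\<in>cell n x. u y * h m n y)"
      using that cell_subset by (intro sum.cong refl fh) auto
    moreover have "(\<Sum>y\<in>cell n x. u y) = 0 \<Longrightarrow> (\<Sum>y\<in>cell n x. u y * h m n y) = 0"
      using u_nn cell_subset by (subst (asm) sum_nonneg_eq_0_iff) (auto intro!: sum.neutral)
    ultimately have "E n (f m n) x = E n u x * avg u n (h m n) x"
      by (auto simp: avg_def)
    also have "\<dots> \<le> K * u x * avg u n (h m n) x"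
      using that u_avg u_nn h0 by (intro mult_right_mono avg_nonneg) auto
    finally show ?thesis .
  qed
  define R where "R = (\<lambda>x. pnorm q F (\<lambda>m. \<Sum>n<N. avg u n (h m n) x))"
  have R0: "0 \<le> R x" for x by (simp add: R_def)
  have S_le: "pnorm q F (\<lambda>m. \<Sum>n<N. E n (f m n) x) \<le> K * u x * R x" if x: "x \<in> \<Omega>" for x
  proof -
    have "pnorm q F (\<lambda>m. \<Sum>n<N. E n (f m n) x)
        \<le> pnorm q F (\<lambda>m. K * u x * (\<Sum>n<N. avg u n (h m n) x))"
      unfolding sum_distrib_left using pq x f avg_le
      by (intro pnorm_mono sum_mono sum_nonneg avg_nonneg) auto
    also have "\<dots> = K * u x * R x"
      unfolding R_def using pq K u_nn[OF x] u_nn h0 by (intro pnorm_scale sum_nonneg avg_nonneg) auto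
    finally show ?thesis .
  qed
  have uR: "(\<Sum>x\<in>\<Omega>. u x * R x powr q) \<le> q powr q * Y"
  proof -
    have "(\<Sum>x\<in>\<Omega>. u x * R x powr q) \<le> q powr q * (\<Sum>x\<in>\<Omega>. u x * pnorm q F (\<lambda>m. \<Sum>n<N. h m n x) powr q)"
      unfolding R_def using pq u_nn h0 F by (intro dual_Doob) auto
    also have "(\<Sum>x\<in>\<Omega>. u x * pnorm q F (\<lambda>m. \<Sum>n<N. h m n x) powr q) \<le> Y"
      unfolding Y_def
    proof (rule sum_mono)
      fix x assume x: "x \<in> \<Omega>"
      have "pnorm q F (\<lambda>m. \<Sum>n<N. h m n x) = pnorm q F (\<lambda>m. inverse (u x) * (\<Sum>n<N. f m n x))"
        by (simp add: h_def sum_distrib_left divide_inverse mult.commute)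
      also have "\<dots> = inverse (u x) * g x"
        unfolding g_def using u_nn[OF x] f x pq by (intro pnorm_scale sum_nonneg) auto
      finally have e: "pnorm q F (\<lambda>m. \<Sum>n<N. h m n x) = inverse (u x) * g x" .
      show "u x * pnorm q F (\<lambda>m. \<Sum>n<N. h m n x) powr q \<le> g x powr p"
      proof (cases "g x = 0")
        case False
        then have gp: "g x > 0" using g0[of x] by simp
        then have u0p: "u0 x > 0" by (simp add: u0_def)
        then have up: "u x > 0" using u_ge[OF x] by linarith
        have "u x * (inverse (u x) * g x) powr q = u x powr (1 - q) * g x powr q"
          using up gp by (simp add: powr_mult powr_diff inverse_powr powr_minus divide_inverse)
        also have "\<dots> \<le> u0 x powr (1 - q) * g x powr q"
          using up u0p u_ge[OF x] pq by (intro mult_right_mono powr_mono2') auto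
        also have "u0 x powr (1 - q) = g x powr (p - q)"
        proof -
          have "(q - p) / (q - 1) * (1 - q) = p - q" using pq by (simp add: divide_simps) (simp add: algebra_simps)
          then show ?thesis by (simp add: u0_def powr_powr)
        qed
        also have "g x powr (p - q) * g x powr q = g x powr p" by (simp flip: powr_add)
        finally show ?thesis by (simp add: e)
      qed (simp add: e)
    qed
    finally show ?thesis using pq by simp
  qed
  have us: "(\<Sum>x\<in>\<Omega>. u x powr s) \<le> 2 powr s * Y"
  proof -
    have "(\<Sum>x\<in>\<Omega>. u x powr s) = pnorm s \<Omega> u powr s" using s by (simp add: pnorm_powr)
    also have "\<dots> \<le> (2 * pnorm s \<Omega> u0) powr s" using s u_norm by (intro powr_mono2) auto
    also have "\<dots> = 2 powr s * (\<Sum>x\<in>\<Omega>. u0 x powr s)" using s by (simp add: powr_mult pnorm_powr)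
    also have "(\<Sum>x\<in>\<Omega>. u0 x powr s) = Y"
      unfolding Y_def u0_def powr_powr s_def using pq by (intro sum.cong refl) simp
    finally show ?thesis .
  qed
  have "(\<Sum>x\<in>\<Omega>. pnorm q F (\<lambda>m. \<Sum>n<N. E n (f m n) x) powr p) \<le> (\<Sum>x\<in>\<Omega>. (K * u x * R x) powr p)"
    using pq S_le by (intro sum_mono powr_mono2) auto
  also have "\<dots> = (\<Sum>x\<in>\<Omega>. K powr p * ((u x * R x powr q) powr (p / q) * (u x powr s) powr (1 - p / q)))"
  proof (rule sum.cong[OF refl])
    fix x assume x: "x \<in> \<Omega>"
    have e: "p / q + s * (1 - p / q) = p"
    proof -
      have "s * (1 - p / q) = p * (q - 1) / q" using pq by (simp add: s_def field_simps)
      then show ?thesis using pq by (simp add: field_simps)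
    qed
    have "(u x * R x powr q) powr (p / q) * (u x powr s) powr (1 - p / q)
        = (u x powr (p / q) * u x powr (s * (1 - p / q))) * R x powr p"
      using u_nn[OF x] pq R0 by (simp add: powr_mult powr_powr)
    also have "\<dots> = u x powr p * R x powr p" unfolding powr_add[symmetric] e ..
    finally show "(K * u x * R x) powr p = K powr p * ((u x * R x powr q) powr (p / q) * (u x powr s) powr (1 - p / q))"
      using u_nn[OF x] K R0 by (simp add: powr_mult)
  qed
  also have "\<dots> \<le> K powr p * ((\<Sum>x\<in>\<Omega>. u x * R x powr q) powr (p / q) * (\<Sum>x\<in>\<Omega>. u x powr s) powr (1 - p / q))"
    unfolding sum_distrib_left[symmetric] using pq u_nn
    by (intro mult_left_mono sum_geometric_mean_le) auto
  also have "\<dots> \<le> K powr p * ((q powr q * Y) powr (p / q) * (2 powr s * Y) powr (1 - p / q))"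
    using pq uR us u_nn by (intro mult_left_mono mult_mono powr_mono2) (auto intro!: sum_nonneg)
  also have "\<dots> = K powr p * (q powr p * 2 powr (s * (1 - p / q))) * (Y powr (p / q) * Y powr (1 - p / q))"
    using pq Y by (simp add: powr_mult powr_powr)
  also have "Y powr (p / q) * Y powr (1 - p / q) = Y" using Y by (simp flip: powr_add)
  finally show ?thesis by (simp add: Y_def g_def K_def)
qed

end

text \<open>
  Only the fact that the constants depend on nothing but the exponents matters: they must not depend
  on the space, the partitions or the number of terms.
\<close>

definition stein_const :: "real \<Rightarrow> real \<Rightarrow> real" where
  "stein_const p q = (if q \<le> p then p powr p else
     let s = p * (q - 1) / (q - p)
     in (2 * (s / (s - 1))) powr p * (q powr p * 2 powr (s * (1 - p / q))))"

lemma stein_const_nonneg: "0 \<le> stein_const p q"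
  by (simp add: stein_const_def Let_def)

definition mixed_const :: "real \<Rightarrow> real \<Rightarrow> real \<Rightarrow> real" where
  "mixed_const p q r = (if r = 1 then stein_const p q else stein_const p q powr (1 / r)
     * (stein_const (p / (p - 1)) (q / (q - 1)) powr (p - 1)) powr (1 - 1 / r))"

lemma mixed_const_nonneg: "0 \<le> mixed_const p q r"
  by (simp add: mixed_const_def stein_const_nonneg)

text \<open>
  The exponents for which the two methods work: all exponents above \<open>1\<close> by weights and interpolation,
  and \<open>r = 1\<close> with \<open>q \<le> p\<close> by the dual Doob inequality alone.
\<close>

definition admissible :: "real \<Rightarrow> real \<Rightarrow> real \<Rightarrow> bool" where
  "admissible p q r \<longleftrightarrow> 1 \<le> r \<and> (1 < p \<and> 1 < q \<or> r = 1 \<and> 1 \<le> q \<and> q \<le> p)"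

context nested_cells
begin

lemma Stein:
  assumes pq: "1 < p \<and> 1 < q \<or> 1 \<le> q \<and> q \<le> p" and F: "finite F"
    and f: "\<And>m n x. m \<in> F \<Longrightarrow> x \<in> \<Omega> \<Longrightarrow> 0 \<le> f m n x"
  shows "(\<Sum>x\<in>\<Omega>. pnorm q F (\<lambda>m. \<Sum>n<N. E n (f m n) x) powr p)
    \<le> stein_const p q * (\<Sum>x\<in>\<Omega>. pnorm q F (\<lambda>m. \<Sum>n<N. f m n x) powr p)"
proof (cases "q \<le> p")
  case True
  then show ?thesis using dual_Doob[of "\<lambda>_. 1" F f q p N] assms by (auto simp: stein_const_def)
next
  case False
  then show ?thesis using Stein_lt[of p q F f N] assms by (auto simp: stein_const_def Let_def)
qed

lemma avg_geometric_mean_le: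
  assumes "\<And>y. y \<in> \<Omega> \<Longrightarrow> 0 \<le> a y" "\<And>y. y \<in> \<Omega> \<Longrightarrow> 0 \<le> b y" and \<theta>: "0 < \<theta>" "0 < \<eta>" "\<theta> + \<eta> = 1"
  shows "E n (\<lambda>y. a y powr \<theta> * b y powr \<eta>) x \<le> E n a x powr \<theta> * E n b x powr \<eta>"
proof -
  define c where "c = real (card (cell n x))"
  have nn: "0 \<le> (\<Sum>y\<in>cell n x. a y)" "0 \<le> (\<Sum>y\<in>cell n x. b y)"
    by (auto intro!: sum_nonneg assms(1,2) simp: cell_def)
  have "(\<Sum>y\<in>cell n x. a y powr \<theta> * b y powr \<eta>) \<le> (\<Sum>y\<in>cell n x. a y) powr \<theta> * (\<Sum>y\<in>cell n x. b y) powr \<eta>"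
    by (intro sum_geometric_mean_le \<theta> assms(1,2) subsetD[OF cell_subset])
  then have "(\<Sum>y\<in>cell n x. a y powr \<theta> * b y powr \<eta>) / c
      \<le> (\<Sum>y\<in>cell n x. a y) powr \<theta> * (\<Sum>y\<in>cell n x. b y) powr \<eta> / c"
    by (intro divide_right_mono) (auto simp: c_def)
  also have "\<dots> = ((\<Sum>y\<in>cell n x. a y) / c) powr \<theta> * ((\<Sum>y\<in>cell n x. b y) / c) powr \<eta>"
  proof -
    have "c powr \<theta> * c powr \<eta> = c" using \<theta> by (simp add: c_def flip: powr_add)
    moreover have "0 \<le> c" by (simp add: c_def)
    ultimately show ?thesis using nn by (simp add: powr_divide)
  qed
  finally show ?thesis by (simp add: avg_def c_def)
qed

text \<open>
  For \<open>r > 1\<close> put \<open>\<phi> m = pnorm r {..<N} (f m)\<close> and \<open>g = f powr r * \<phi> powr (1 - r)\<close>. Then \<open>f\<close> is a geometric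
  mean of \<open>g\<close>, which sums to \<open>\<phi>\<close> over \<open>n\<close>, and of \<open>\<phi>\<close>, which does not depend on \<open>n\<close>. Averages respect
  geometric means, so the claim follows from the case \<open>r = 1\<close> for \<open>g\<close> and the maximal inequality for \<open>\<phi>\<close>.
\<close>

theorem mixed_norm_Stein:
  assumes adm: "admissible p q r" and F: "finite F"
    and f: "\<And>m n x. m \<in> F \<Longrightarrow> x \<in> \<Omega> \<Longrightarrow> 0 \<le> f m n x"
  shows "(\<Sum>x\<in>\<Omega>. pnorm q F (\<lambda>m. pnorm r {..<N} (\<lambda>n. E n (f m n) x)) powr p)
    \<le> mixed_const p q r * (\<Sum>x\<in>\<Omega>. pnorm q F (\<lambda>m. pnorm r {..<N} (\<lambda>n. f m n x)) powr p)"
proof (cases "r = 1")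
  case True
  have "pnorm q F (\<lambda>m. pnorm 1 {..<N} (\<lambda>n. E n (f m n) x)) = pnorm q F (\<lambda>m. \<Sum>n<N. E n (f m n) x)" for x
    using f by (intro pnorm_cong pnorm_1 avg_nonneg) auto
  moreover have "pnorm q F (\<lambda>m. pnorm 1 {..<N} (\<lambda>n. f m n x)) = pnorm q F (\<lambda>m. \<Sum>n<N. f m n x)" if "x \<in> \<Omega>" for x
    using f that by (intro pnorm_cong pnorm_1) auto
  ultimately show ?thesis
    using Stein[of p q F f N] adm True F f by (auto simp: mixed_const_def admissible_def)
next
  case False
  then have pqr: "1 < p" "1 < q" "1 < r" using adm by (auto simp: admissible_def)
  define \<phi> where "\<phi> = (\<lambda>m x. pnorm r {..<N} (\<lambda>n. f m n x))"
  have \<phi>0: "0 \<le> \<phi> m x" for m x by (simp add: \<phi>_def)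
  define g where "g = (\<lambda>m n x. f m n x powr r * \<phi> m x powr (1 - r))"
  have g0: "0 \<le> g m n x" for m n x by (simp add: g_def)
  define S where "S = (\<lambda>x m. \<Sum>n<N. E n (g m n) x)"
  have S0: "0 \<le> S x m" for x m unfolding S_def using g0 by (intro sum_nonneg avg_nonneg) auto
  define M where "M = (\<lambda>x m. maxavg N (\<phi> m) x)"
  have M0: "0 \<le> M x m" for x m by (simp add: M_def maxavg_nonneg)
  define Y where "Y = (\<Sum>x\<in>\<Omega>. pnorm q F (\<lambda>m. \<phi> m x) powr p)"
  have Y0: "0 \<le> Y" by (simp add: Y_def sum_nonneg)
  let ?L = "\<lambda>x. pnorm q F (\<lambda>m. pnorm r {..<N} (\<lambda>n. E n (f m n) x))"
  let ?C = "stein_const p q" and ?D = "stein_const (p / (p - 1)) (q / (q - 1)) powr (p - 1)"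
  have f_eq: "f m n x = g m n x powr (1/r) * \<phi> m x powr (1 - 1/r)" if "m \<in> F" "n < N" "x \<in> \<Omega>" for m n x
  proof (cases "\<phi> m x = 0")
    case True
    then have "f m n x = 0"
      using pnorm_component_le[of "{..<N}" n "\<lambda>n. f m n x" r] f[OF that(1,3), of n] that(2) pqr
      by (simp add: \<phi>_def)
    then show ?thesis using True pqr by simp
  next
    case False
    have "(1 - r) * (1/r) + (1 - 1/r) = 0" using pqr by (simp add: field_simps)
    then have "\<phi> m x powr ((1 - r) * (1/r)) * \<phi> m x powr (1 - 1/r) = 1"
      using False by (simp flip: powr_add)
    then show ?thesis using f that pqr by (simp add: g_def powr_mult powr_powr mult.assoc)
  qed
  have sum_g: "(\<Sum>n<N. g m n x) = \<phi> m x" if "m \<in> F" for m x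
  proof -
    have "(\<Sum>n<N. g m n x) = \<phi> m x powr r * \<phi> m x powr (1 - r)"
      using pqr by (simp add: g_def sum_distrib_right[symmetric] \<phi>_def pnorm_powr)
    then show ?thesis using \<phi>0 by (simp flip: powr_add)
  qed
  have inner: "pnorm r {..<N} (\<lambda>n. E n (f m n) x) \<le> S x m powr (1/r) * M x m powr (1 - 1/r)"
    if "m \<in> F" for m x
  proof -
    have "E n (f m n) x powr r \<le> E n (g m n) x * M x m powr (r - 1)" if n: "n < N" for n
    proof -
      have "E n (f m n) x \<le> E n (\<lambda>x. g m n x powr (1/r) * \<phi> m x powr (1 - 1/r)) x"
        using f_eq[OF \<open>m \<in> F\<close> n] by (intro avg_mono) auto
      also have "\<dots> \<le> E n (g m n) x powr (1/r) * E n (\<phi> m) x powr (1 - 1/r)"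
        using pqr g0 \<phi>0 by (intro avg_geometric_mean_le) auto
      also have "\<dots> \<le> E n (g m n) x powr (1/r) * M x m powr (1 - 1/r)"
        unfolding M_def using pqr \<phi>0 n by (intro mult_left_mono powr_mono2 avg_le_maxavg avg_nonneg) auto
      finally have "E n (f m n) x powr r
          \<le> (E n (g m n) x powr (1/r) * M x m powr (1 - 1/r)) powr r"
        using pqr f \<open>m \<in> F\<close> by (intro powr_mono2 avg_nonneg) auto
      also have "\<dots> = E n (g m n) x * M x m powr (r - 1)"
      proof -
        have "(1 - 1/r) * r = r - 1" using pqr by (simp add: field_simps)
        moreover have "0 \<le> E n (g m n) x" using g0 by (intro avg_nonneg) auto
        ultimately show ?thesis using pqr by (simp add: powr_mult powr_powr)
      qed
      finally show ?thesis .
    qed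
    then have "(\<Sum>n<N. E n (f m n) x powr r) \<le> S x m * M x m powr (r - 1)"
      unfolding S_def sum_distrib_right by (intro sum_mono) auto
    then have "pnorm r {..<N} (\<lambda>n. E n (f m n) x) \<le> (S x m * M x m powr (r - 1)) powr (1/r)"
      unfolding pnorm_def using pqr by (intro powr_mono2) (auto intro!: sum_nonneg)
    also have "\<dots> = S x m powr (1/r) * M x m powr (1 - 1/r)"
      using pqr S0 by (simp add: powr_mult powr_powr diff_divide_distrib)
    finally show ?thesis .
  qed
  have "(\<Sum>x\<in>\<Omega>. ?L x powr p)
      \<le> (\<Sum>x\<in>\<Omega>. (pnorm q F (S x) powr p) powr (1/r) * (pnorm q F (M x) powr p) powr (1 - 1/r))"
  proof (rule sum_mono)
    fix x
    have "?L x
        \<le> pnorm q F (\<lambda>m. S x m powr (1/r) * M x m powr (1 - 1/r))"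
      using pqr inner by (intro pnorm_mono) auto
    also have "\<dots> \<le> pnorm q F (S x) powr (1/r) * pnorm q F (M x) powr (1 - 1/r)"
      using pqr S0 M0 by (intro pnorm_geometric_mean_le) auto
    finally have "?L x powr p
        \<le> (pnorm q F (S x) powr (1/r) * pnorm q F (M x) powr (1 - 1/r)) powr p"
      using pqr by (intro powr_mono2) auto
    also have "\<dots> = (pnorm q F (S x) powr p) powr (1/r) * (pnorm q F (M x) powr p) powr (1 - 1/r)"
      by (simp add: powr_mult powr_powr mult.commute)
    finally show "?L x powr p
        \<le> (pnorm q F (S x) powr p) powr (1/r) * (pnorm q F (M x) powr p) powr (1 - 1/r)" .
  qed
  also have "\<dots> \<le> (\<Sum>x\<in>\<Omega>. pnorm q F (S x) powr p) powr (1/r) * (\<Sum>x\<in>\<Omega>. pnorm q F (M x) powr p) powr (1 - 1/r)"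
    using pqr by (intro sum_geometric_mean_le) auto
  also have "\<dots> \<le> (?C * Y) powr (1/r) * (?D * Y) powr (1 - 1/r)"
  proof (intro mult_mono powr_mono2)
    have "(\<Sum>x\<in>\<Omega>. pnorm q F (S x) powr p) \<le> ?C * (\<Sum>x\<in>\<Omega>. pnorm q F (\<lambda>m. \<Sum>n<N. g m n x) powr p)"
      unfolding S_def using pqr F g0 by (intro Stein) auto
    also have "(\<Sum>x\<in>\<Omega>. pnorm q F (\<lambda>m. \<Sum>n<N. g m n x) powr p) = Y"
      unfolding Y_def using sum_g by (intro sum.cong refl arg_cong[where f="\<lambda>t. t powr p"] pnorm_cong) auto
    finally show "(\<Sum>x\<in>\<Omega>. pnorm q F (S x) powr p) \<le> ?C * Y" .
    show "(\<Sum>x\<in>\<Omega>. pnorm q F (M x) powr p) \<le> ?D * Y"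
      unfolding M_def Y_def
    proof (rule Fefferman_Stein_of_Stein)
      fix h :: "_ \<Rightarrow> nat \<Rightarrow> _ \<Rightarrow> real"
      assume h: "\<And>m n x. m \<in> F \<Longrightarrow> x \<in> \<Omega> \<Longrightarrow> 0 \<le> h m n x"
      show "(\<Sum>x\<in>\<Omega>. pnorm (q / (q - 1)) F (\<lambda>m. \<Sum>n<N. E n (h m n) x) powr (p / (p - 1)))
        \<le> stein_const (p / (p - 1)) (q / (q - 1))
          * (\<Sum>x\<in>\<Omega>. pnorm (q / (q - 1)) F (\<lambda>m. \<Sum>n<N. h m n x) powr (p / (p - 1)))"
        using pqr h F by (intro Stein) (auto simp: field_simps)
    qed (use pqr \<phi>0 stein_const_nonneg in auto)
  qed (use pqr Y0 in \<open>auto intro!: sum_nonneg mult_nonneg_nonneg\<close>)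
  also have "\<dots> = mixed_const p q r * (Y powr (1/r) * Y powr (1 - 1/r))"
    using pqr stein_const_nonneg Y0 by (simp add: mixed_const_def powr_mult)
  also have "Y powr (1/r) * Y powr (1 - 1/r) = Y" using Y0 by (simp flip: powr_add)
  finally show ?thesis by (simp add: Y_def \<phi>_def)
qed

end

section \<open>Exponential kernels on an interval of integers\<close>

text \<open>
  The norm of \<open>\<ell>\<^sup>q(\<ell>\<^sup>r)\<close> on the square \<open>m, n < N\<close>, for nonnegative entries.
\<close>

definition mnorm :: "real \<Rightarrow> real \<Rightarrow> nat \<Rightarrow> (nat \<times> nat \<Rightarrow> real) \<Rightarrow> real" where
  "mnorm q r N y = pnorm q {..<N} (\<lambda>m. pnorm r {..<N} (\<lambda>n. y (m, n)))"

lemma mnorm_nonneg [simp]: "0 \<le> mnorm q r N y"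
  by (simp add: mnorm_def)

lemma mnorm_mono:
  assumes "\<And>m n. m < N \<Longrightarrow> n < N \<Longrightarrow> 0 \<le> x (m, n)" "\<And>m n. m < N \<Longrightarrow> n < N \<Longrightarrow> x (m, n) \<le> y (m, n)" "1 \<le> q" "1 \<le> r"
  shows "mnorm q r N x \<le> mnorm q r N y"
  unfolding mnorm_def using assms by (intro pnorm_mono) auto

lemma mnorm_mono_dim:
  assumes "N \<le> N'" "1 \<le> q" "1 \<le> r"
  shows "mnorm q r N x \<le> mnorm q r N' x"
proof -
  have "mnorm q r N x \<le> pnorm q {..<N} (\<lambda>m. pnorm r {..<N'} (\<lambda>n. x (m, n)))"
    unfolding mnorm_def using assms by (intro pnorm_mono pnorm_mono_set) auto
  also have "\<dots> \<le> mnorm q r N' x"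
    unfolding mnorm_def using assms by (intro pnorm_mono_set) auto
  finally show ?thesis .
qed

lemma mnorm_scale:
  assumes "0 \<le> c" "\<And>m n. m < N \<Longrightarrow> n < N \<Longrightarrow> 0 \<le> x (m, n)" "1 \<le> q" "1 \<le> r"
  shows "mnorm q r N (\<lambda>i. c * x i) = c * mnorm q r N x"
proof -
  have "mnorm q r N (\<lambda>i. c * x i) = pnorm q {..<N} (\<lambda>m. c * pnorm r {..<N} (\<lambda>n. x (m, n)))"
    unfolding mnorm_def using assms by (intro pnorm_cong pnorm_scale) auto
  also have "\<dots> = c * mnorm q r N x"
    unfolding mnorm_def using assms by (intro pnorm_scale) auto
  finally show ?thesis .
qed

lemma mnorm_sum_le:
  assumes "\<And>m n j. m < N \<Longrightarrow> n < N \<Longrightarrow> j \<in> J \<Longrightarrow> 0 \<le> x j (m, n)" "1 \<le> q" "1 \<le> r" "finite J"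
  shows "mnorm q r N (\<lambda>i. \<Sum>j\<in>J. x j i) \<le> (\<Sum>j\<in>J. mnorm q r N (x j))"
proof -
  have "mnorm q r N (\<lambda>i. \<Sum>j\<in>J. x j i) \<le> pnorm q {..<N} (\<lambda>m. \<Sum>j\<in>J. pnorm r {..<N} (\<lambda>n. x j (m, n)))"
    unfolding mnorm_def using assms by (intro pnorm_mono pnorm_sum_le) auto
  also have "\<dots> \<le> (\<Sum>j\<in>J. mnorm q r N (x j))"
    unfolding mnorm_def using assms by (intro pnorm_sum_le) auto
  finally show ?thesis .
qed

lemma mnorm_component_le:
  assumes "m < N" "n < N" "0 \<le> x (m, n)" "1 \<le> q" "1 \<le> r"
  shows "x (m, n) \<le> mnorm q r N x"
proof -
  have "x (m, n) \<le> pnorm r {..<N} (\<lambda>n. x (m, n))"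
    using pnorm_component_le[of "{..<N}" n "\<lambda>n. x (m, n)" r] assms by auto
  also have "\<dots> \<le> mnorm q r N x"
    unfolding mnorm_def
    using pnorm_component_le[of "{..<N}" m "\<lambda>m. pnorm r {..<N} (\<lambda>n. x (m, n))" q] assms by auto
  finally show ?thesis .
qed

text \<open>
  If a block boundary separates \<open>x\<close> and \<open>y\<close>, a further shift by half a block moves both to the interior.
\<close>

lemma same_block_after_shift:
  fixes x y \<omega> h :: nat
  assumes xy: "x \<le> y" "y - x \<le> h" and h: "0 < h" and dv: "2 * h dvd P"
    and bad: "(x + \<omega>) div (2 * h) \<noteq> (y + \<omega>) div (2 * h)"
  shows "(x + (\<omega> + h) mod P) div (2 * h) = (y + (\<omega> + h) mod P) div (2 * h)"
proof -
  define u where "u = y - x"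
  have same: "z div (2 * h) = (z + u) div (2 * h) \<longleftrightarrow> z mod (2 * h) + u < 2 * h" for z
  proof -
    have "(z + u) div (2 * h) = (z div (2 * h) * (2 * h) + (z mod (2 * h) + u)) div (2 * h)"
      by (metis add.assoc div_mult_mod_eq)
    also have "\<dots> = z div (2 * h) + (z mod (2 * h) + u) div (2 * h)"
      using h by (intro div_mult_self3) auto
    finally show ?thesis using h by (auto simp: div_eq_0_iff)
  qed
  have yx: "y + w = (x + w) + u" for w using xy by (simp add: u_def)
  define a where "a = (x + \<omega>) mod (2 * h)"
  have a: "2 * h \<le> a + u" "a < 2 * h" using bad h unfolding yx same by (auto simp: a_def)
  then have "h \<le> a" using xy by (simp add: u_def)
  have "(x + (\<omega> + h) mod P) mod (2 * h) = (x + (\<omega> + h)) mod (2 * h)"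
    by (metis mod_add_right_eq mod_mod_cancel[OF dv])
  also have "\<dots> = (a + h) mod (2 * h)" unfolding a_def by (simp add: mod_add_left_eq add.assoc)
  also have "a + h = (a - h) + 2 * h" using \<open>h \<le> a\<close> by simp
  also have "((a - h) + 2 * h) mod (2 * h) = a - h" using a by simp
  finally show ?thesis unfolding yx same using a xy h by (simp add: u_def)
qed

text \<open>
  The shift by half a block maps the bad shifts injectively to good ones.
\<close>

lemma half_of_shifts_same_block:
  fixes x y :: nat
  assumes d: "\<bar>real x - real y\<bar> \<le> 2 ^ k" and kJ: "Suc k \<le> J"
  shows "2 ^ J \<le> 2 * card {\<omega>. \<omega> < 2 ^ J \<and> (x + \<omega>) div 2 ^ Suc k = (y + \<omega>) div 2 ^ Suc k}"
  using d
proof (induction x y rule: linorder_wlog)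
  case (sym x y)
  then show ?case by (simp add: eq_commute abs_minus_commute)
next
  case (le x y)
  let ?P = "2 ^ J :: nat" and ?h = "2 ^ k :: nat"
  define G where "G = {\<omega>. \<omega> < ?P \<and> (x + \<omega>) div (2 * ?h) = (y + \<omega>) div (2 * ?h)}"
  define B where "B = {\<omega>. \<omega> < ?P \<and> (x + \<omega>) div (2 * ?h) \<noteq> (y + \<omega>) div (2 * ?h)}"
  have fin: "finite G" "finite B" by (auto simp: G_def B_def)
  have "real (y - x) \<le> real ?h" using le by (simp add: of_nat_diff)
  then have yx: "y - x \<le> ?h" by (simp only: of_nat_le_iff)
  have "2 * ?h dvd ?P" using kJ by (metis le_imp_power_dvd power_Suc)
  then have "(\<lambda>\<omega>. (\<omega> + ?h) mod ?P) ` B \<subseteq> G"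
    using same_block_after_shift[OF le(1) yx] by (auto simp: G_def B_def)
  moreover have "inj_on (\<lambda>\<omega>. (\<omega> + ?h) mod ?P) B"
  proof (rule inj_onI)
    fix a b assume "a \<in> B" "b \<in> B" "(a + ?h) mod ?P = (b + ?h) mod ?P"
    then show "a = b"
    proof (induction a b rule: linorder_wlog)
      case (le a b)
      then have "?P dvd (b + ?h) - (a + ?h)"
        using mod_eq_dvd_iff_nat[of "a + ?h" "b + ?h" ?P] by (metis add_le_mono1)
      then have "?P dvd b - a" by simp
      moreover have "b - a < ?P" using le by (auto simp: B_def)
      ultimately have "b - a = 0" by (meson nat_dvd_not_less not_gr_zero)
      then show ?case using le by simp
    qed simp
  qed
  ultimately have "card B \<le> card G" using fin by (metis card_image card_mono)
  moreover have "card B + card G = ?P"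
  proof -
    have "B \<union> G = {..<?P}" "B \<inter> G = {}" by (auto simp: B_def G_def)
    then show ?thesis using fin by (metis card_Un_disjoint card_lessThan)
  qed
  ultimately show ?case by (simp add: G_def)
qed

lemma exp_minus_le_inverse_square:
  fixes z :: real assumes "0 < z" shows "exp (- z) \<le> 2 / z\<^sup>2"
proof -
  have "z\<^sup>2 / 2 \<le> exp z" using exp_lower_Taylor_quadratic[of z] assms by simp
  then show ?thesis using assms by (simp add: exp_minus field_simps)
qed

text \<open>
  On the right is a mean over all shifts \<open>\<omega>\<close> and a weighted sum over the scales \<open>l + Suc j\<close> of the kernels of
  averages over shifted dyadic blocks. A single scale suffices: the least \<open>j\<close> with
  \<open>\<bar>x - y\<bar> \<le> 2 ^ (l + j)\<close>. For \<open>j > 0\<close> the distance exceeds \<open>2 ^ (l + j - 1)\<close>, and the exponential decay, used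
  only as \<open>exp (- z) \<le> 2 / z\<^sup>2\<close>, outweighs the loss from the larger block.
\<close>

lemma exponential_le_block_averages:
  fixes x y l J J' :: nat
  assumes d: "\<bar>real x - real y\<bar> \<le> 2 ^ J'" and J: "l + Suc J' \<le> J"
  shows "exp (- (\<bar>real x - real y\<bar> / 2 ^ l)) / 2 ^ l
    \<le> (\<Sum>j\<le>J'. \<Sum>\<omega><2 ^ J. 32 / 2 ^ j / 2 ^ J *
        (if (x + \<omega>) div 2 ^ (l + Suc j) = (y + \<omega>) div 2 ^ (l + Suc j) then 1 / 2 ^ (l + Suc j) else 0))"
    (is "?k \<le> (\<Sum>j\<le>J'. ?t j)")
proof -
  define D where "D = \<bar>real x - real y\<bar>"
  define j where "j = (LEAST j. D \<le> 2 ^ (l + j))"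
  have "D \<le> 2 ^ (l + J')" using d order_trans[of D "2 ^ J'" "2 ^ (l + J')"] by (simp add: D_def)
  then have j: "D \<le> 2 ^ (l + j)" "j \<le> J'" unfolding j_def by (auto intro: LeastI Least_le)
  have e: "exp (- (D / 2 ^ l)) \<le> 8 / 4 ^ j"
  proof (cases j)
    case 0
    have "0 \<le> D" by (simp add: D_def)
    then have "exp (- (D / 2 ^ l)) \<le> 1" by simp
    also have "1 \<le> 8 / (4::real) ^ j" using 0 by simp
    finally show ?thesis .
  next
    case (Suc i)
    then have "\<not> D \<le> 2 ^ (l + i)" using not_less_Least[of i "\<lambda>j. D \<le> 2 ^ (l + j)"] by (simp add: j_def)
    then have i: "2 ^ i \<le> D / 2 ^ l" by (simp add: field_simps power_add)
    then have "exp (- (D / 2 ^ l)) \<le> exp (- (2 ^ i))" by simp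
    also have "\<dots> \<le> 2 / (2 ^ i)\<^sup>2" by (rule exp_minus_le_inverse_square) simp
    also have "\<dots> = 8 / 4 ^ j" by (simp add: Suc power2_eq_square power_mult_distrib[symmetric])
    finally show ?thesis .
  qed
  let ?G = "{\<omega>. \<omega> < 2 ^ J \<and> (x + \<omega>) div 2 ^ (l + Suc j) = (y + \<omega>) div 2 ^ (l + Suc j)}"
  have "(2::nat) ^ J \<le> 2 * card ?G"
    using half_of_shifts_same_block[of x y "l + j" J] j J by (simp add: D_def)
  then have "real (2 ^ J) \<le> real (2 * card ?G)" by (simp only: of_nat_le_iff)
  then have G: "1 / 2 \<le> real (card ?G) / 2 ^ J" by (simp add: field_simps)
  have "?k \<le> (8 / 4 ^ j) / 2 ^ l" using e by (intro divide_right_mono) (auto simp: D_def)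
  also have "\<dots> = 32 / 2 ^ j * (1 / 2 ^ (l + Suc j)) * (1 / 2)"
    by (simp add: power_add field_simps power_mult_distrib[symmetric])
  also have "\<dots> \<le> 32 / 2 ^ j * (1 / 2 ^ (l + Suc j)) * (real (card ?G) / 2 ^ J)"
    using G by (intro mult_left_mono) auto
  also have "\<dots> = ?t j"
  proof -
    have "(\<Sum>\<omega><2 ^ J. if (x + \<omega>) div 2 ^ (l + Suc j) = (y + \<omega>) div 2 ^ (l + Suc j) then 1 / 2 ^ (l + Suc j) else (0::real))
       = (\<Sum>\<omega>\<in>?G. 1 / 2 ^ (l + Suc j))"
      by (subst sum.inter_filter[symmetric]) (auto intro!: sum.cong)
    then show ?thesis unfolding sum_distrib_left[symmetric] by (simp add: field_simps)
  qed
  also have "\<dots> \<le> (\<Sum>j\<le>J'. ?t j)"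
    using j by (intro member_le_sum) (auto intro!: sum_nonneg)
  finally show ?thesis .
qed

definition exp_kernel_sum :: "nat \<Rightarrow> nat \<Rightarrow> (nat \<Rightarrow> real) \<Rightarrow> nat \<Rightarrow> real" where
  "exp_kernel_sum M l f x = (\<Sum>y<M. exp (- (\<bar>real x - real y\<bar> / 2 ^ l)) / 2 ^ l * f y)"

text \<open>
  For a fixed shift and a fixed \<open>j\<close> the blocks of the scales \<open>N - Suc n + Suc j\<close> are nested and become
  finer as \<open>n\<close> grows, so \<open>mixed_norm_Stein\<close> applies to each term of the mean. The triangle inequality
  and the summability of the weights do the rest.
\<close>

theorem mixed_norm_exp_kernel:
  assumes adm: "admissible p q r" and f: "\<And>m n x. 0 \<le> f x (m, n)"
  shows "(\<Sum>x<M. mnorm q r N (\<lambda>(m, n). exp_kernel_sum M (N - Suc n) (\<lambda>y. f y (m, n)) x) powr p)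
    \<le> 64 powr p * mixed_const p q r * (\<Sum>x<M. mnorm q r N (f x) powr p)"
proof -
  have pqr: "1 \<le> p" "1 \<le> q" "1 \<le> r" using adm by (auto simp: admissible_def)
  (* Any J' with M \<le> 2 ^ J' would do; it bounds the distances that occur. *)
  define J' where "J' = M"
  define J where "J = N + Suc J'"
  define I where "I = {..J'} \<times> {..<2 ^ J :: nat}"
  define w where "w = (\<lambda>(j, \<omega>::nat). 32 / 2 ^ j / 2 ^ J :: real)"
  define label where "label = (\<lambda>(j, \<omega>) n x. (x + \<omega> :: nat) div 2 ^ (N - Suc n + Suc j))"
  define A where "A = (\<lambda>i x (m, n). nested_cells.avg {..<M} (label i) (\<lambda>_. 1) n (\<lambda>y. f y (m, n)) x)"
  have finI: "finite I" by (simp add: I_def)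
  have w0: "0 \<le> w i" for i by (simp add: w_def split: prod.split)
  have w_sum: "(\<Sum>i\<in>I. w i) \<le> 64"
  proof -
    have "(\<Sum>i\<in>I. w i) = 32 * (\<Sum>j\<le>J'. (1/2) ^ j)"
      unfolding I_def w_def by (simp add: sum.cartesian_product[symmetric] sum_distrib_left power_divide)
    also have "(\<Sum>j\<le>J'. (1/2) ^ j) = 2 - (1/2 :: real) ^ J'" by (induction J') auto
    finally show ?thesis by simp
  qed
  have cells: "nested_cells {..<M} (label i)" for i
  proof
    fix n k x y assume nk: "n \<le> k" and eq: "label i k x = label i k y"
    obtain j \<omega> where i: "i = (j, \<omega>)" by (cases i)
    define e where "e = N - Suc k + Suc j"
    obtain d where d: "N - Suc n + Suc j = e + d" using nk by (metis e_def add_le_mono1 diff_le_mono2 Suc_le_mono le_Suc_ex)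
    show "label i n x = label i n y"
    proof -
      have L: "label i n' z = (z + \<omega>) div 2 ^ (N - Suc n' + Suc j)" for n' z by (simp add: i label_def)
      show ?thesis using eq unfolding L d e_def[symmetric] power_add div_mult2_eq by simp
    qed
  qed simp
  have pointwise: "exp_kernel_sum M (N - Suc n) (\<lambda>y. f y (m, n)) x \<le> (\<Sum>i\<in>I. w i * A i x (m, n))"
    if n: "n < N" and x: "x < M" for m n x
  proof -
    define e where "e = (\<lambda>i::nat \<times> nat. N - Suc n + Suc (fst i))"
    have block: "(\<Sum>y<M. (if label i n x = label i n y then 1 / 2 ^ e i else 0) * f y (m, n)) \<le> A i x (m, n)" for i
    proof -
      interpret nested_cells "{..<M}" "label i" by (rule cells)
      obtain j \<omega> where i: "i = (j, \<omega>)" by (cases i)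
      define c where "c = (x + \<omega>) div 2 ^ e i"
      have "(\<lambda>y. y + \<omega>) ` cell n x \<subseteq> {c * 2 ^ e i..<c * 2 ^ e i + 2 ^ e i}"
      proof safe
        fix y assume "y \<in> cell n x"
        then have "label i n y = label i n x" by (simp add: cell_def)
        then have "(y + \<omega>) div 2 ^ e i = c" by (simp add: label_def i c_def e_def)
        then have "y + \<omega> = c * 2 ^ e i + (y + \<omega>) mod 2 ^ e i" by (metis div_mult_mod_eq)
        moreover have "(y + \<omega>) mod 2 ^ e i < 2 ^ e i" by simp
        ultimately show "y + \<omega> \<in> {c * 2 ^ e i..<c * 2 ^ e i + 2 ^ e i}" unfolding atLeastLessThan_iff by linarith
      qed
      then have "card ((\<lambda>y. y + \<omega>) ` cell n x) \<le> 2 ^ e i" by (metis card_atLeastLessThan card_mono diff_add_inverse finite_atLeastLessThan)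
      then have "card (cell n x) \<le> 2 ^ e i" by (simp add: card_image)
      then have card_le: "real (card (cell n x)) \<le> 2 ^ e i" by (metis of_nat_le_iff of_nat_numeral of_nat_power)
      have "x \<in> cell n x" using x by (intro self_in_cell) simp
      then have "0 < card (cell n x)" by (auto simp: card_gt_0_iff)
      have "(\<Sum>y<M. (if label i n x = label i n y then 1 / 2 ^ e i else 0) * f y (m, n)) = (\<Sum>y\<in>cell n x. f y (m, n)) / 2 ^ e i"
        unfolding cell_def sum_divide_distrib by (subst sum.inter_filter) (auto intro!: sum.cong)
      also have "\<dots> \<le> (\<Sum>y\<in>cell n x. f y (m, n)) / card (cell n x)"
        using card_le \<open>0 < card (cell n x)\<close> f by (intro divide_left_mono sum_nonneg) auto
      finally show ?thesis by (simp add: A_def avg_def)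
    qed
    have "exp_kernel_sum M (N - Suc n) (\<lambda>y. f y (m, n)) x
      \<le> (\<Sum>y<M. (\<Sum>i\<in>I. w i * (if label i n x = label i n y then 1 / 2 ^ e i else 0)) * f y (m, n))"
      unfolding exp_kernel_sum_def
    proof (intro sum_mono mult_right_mono f)
      fix y assume y: "y \<in> {..<M}"
      have "\<bar>real x - real y\<bar> \<le> real M" using x y by auto
      also have "real M \<le> 2 ^ J'" unfolding J'_def by (metis less_imp_le of_nat_less_two_power)
      finally have d: "\<bar>real x - real y\<bar> \<le> 2 ^ J'" .
      have "(\<Sum>j\<le>J'. \<Sum>\<omega><2 ^ J. 32 / 2 ^ j / 2 ^ J * (if (x + \<omega>) div 2 ^ (N - Suc n + Suc j)
            = (y + \<omega>) div 2 ^ (N - Suc n + Suc j) then 1 / 2 ^ (N - Suc n + Suc j) else 0))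
          = (\<Sum>i\<in>I. w i * (if label i n x = label i n y then 1 / 2 ^ e i else 0))"
        unfolding I_def sum.cartesian_product
        by (intro sum.cong refl) (simp only: w_def label_def e_def split_beta fst_conv snd_conv)
      with exponential_le_block_averages[OF d, of "N - Suc n" J]
      show "exp (- (\<bar>real x - real y\<bar> / 2 ^ (N - Suc n))) / 2 ^ (N - Suc n)
          \<le> (\<Sum>i\<in>I. w i * (if label i n x = label i n y then 1 / 2 ^ e i else 0))"
        using n by (simp only: J_def)
    qed
    also have "\<dots> = (\<Sum>i\<in>I. w i * (\<Sum>y<M. (if label i n x = label i n y then 1 / 2 ^ e i else 0) * f y (m, n)))"
      unfolding sum_distrib_left sum_distrib_right by (subst sum.swap) (simp add: mult_ac)
    also have "\<dots> \<le> (\<Sum>i\<in>I. w i * A i x (m, n))"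
      using block w0 by (intro sum_mono mult_left_mono) auto
    finally show ?thesis .
  qed
  have A0: "0 \<le> A i x (m, n)" for i x m n
    unfolding A_def using f by (auto intro!: nested_cells.avg_nonneg[OF cells])
  define Y where "Y = (\<Sum>x<M. mnorm q r N (f x) powr p)"
  define T where "T = pnorm p {..<M} (\<lambda>x. mnorm q r N (\<lambda>(m, n). exp_kernel_sum M (N - Suc n) (\<lambda>y. f y (m, n)) x))"
  have block_norm: "pnorm p {..<M} (\<lambda>x. mnorm q r N (A i x)) \<le> (mixed_const p q r * Y) powr (1 / p)" for i
  proof -
    have "(\<Sum>x<M. mnorm q r N (A i x) powr p) \<le> mixed_const p q r * Y"
      using nested_cells.mixed_norm_Stein[OF cells[of i] adm, where F="{..<N}" and f="\<lambda>m n x. f x (m, n)" and N=N] f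
      by (simp add: mnorm_def A_def Y_def)
    then show ?thesis unfolding pnorm_def[of p] using pqr by (intro powr_mono2) (auto intro!: sum_nonneg)
  qed
  have "T \<le> pnorm p {..<M} (\<lambda>x. \<Sum>i\<in>I. w i * mnorm q r N (A i x))"
    unfolding T_def
  proof (rule pnorm_mono)
    fix x assume x: "x \<in> {..<M}"
    have "mnorm q r N (\<lambda>(m, n). exp_kernel_sum M (N - Suc n) (\<lambda>y. f y (m, n)) x)
        \<le> mnorm q r N (\<lambda>k. \<Sum>i\<in>I. w i * A i x k)"
      using pointwise x f pqr by (intro mnorm_mono) (auto simp: exp_kernel_sum_def intro!: sum_nonneg)
    also have "\<dots> \<le> (\<Sum>i\<in>I. mnorm q r N (\<lambda>k. w i * A i x k))"
      using w0 A0 pqr finI by (intro mnorm_sum_le) auto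
    also have "\<dots> = (\<Sum>i\<in>I. w i * mnorm q r N (A i x))"
      using w0 A0 pqr by (intro sum.cong refl mnorm_scale) auto
    finally show "mnorm q r N (\<lambda>(m, n). exp_kernel_sum M (N - Suc n) (\<lambda>y. f y (m, n)) x)
        \<le> (\<Sum>i\<in>I. w i * mnorm q r N (A i x))" .
  qed (use pqr in auto)
  also have "\<dots> \<le> (\<Sum>i\<in>I. pnorm p {..<M} (\<lambda>x. w i * mnorm q r N (A i x)))"
    using pqr finI w0 by (intro pnorm_sum_le) auto
  also have "\<dots> = (\<Sum>i\<in>I. w i * pnorm p {..<M} (\<lambda>x. mnorm q r N (A i x)))"
    using w0 pqr by (intro sum.cong refl pnorm_scale) auto
  also have "\<dots> \<le> (\<Sum>i\<in>I. w i * (mixed_const p q r * Y) powr (1 / p))"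
    using w0 block_norm by (intro sum_mono mult_left_mono) auto
  also have "\<dots> \<le> 64 * (mixed_const p q r * Y) powr (1 / p)"
    unfolding sum_distrib_right[symmetric] using w_sum by (intro mult_right_mono) auto
  finally have "T powr p \<le> (64 * (mixed_const p q r * Y) powr (1 / p)) powr p"
    using pqr by (intro powr_mono2) (auto simp: T_def)
  also have "\<dots> = 64 powr p * mixed_const p q r * Y"
    using pqr mixed_const_nonneg[of p q r] by (simp add: powr_mult powr_powr Y_def sum_nonneg)
  finally show ?thesis using pqr by (simp add: T_def Y_def pnorm_powr)
qed

section \<open>The space of double sequences\<close>

definition trunc_norm :: "real \<Rightarrow> real \<Rightarrow> nat \<Rightarrow> dseq \<Rightarrow> real" where
  "trunc_norm q r N x = mnorm q r N (\<lambda>i. cmod (x i))"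

lemma trunc_norm_nonneg [simp]: "0 \<le> trunc_norm q r N x"
  by (simp add: trunc_norm_def)

lemma mnorm_altdef:
  assumes "1 \<le> r"
  shows "mnorm q r N y = (\<Sum>m<N. (\<Sum>n<N. y (m, n) powr r) powr (q / r)) powr (1 / q)"
  using assms by (simp add: mnorm_def pnorm_def powr_powr)

text \<open>
  Membership and norm are determined by the finite truncations. Through this Fatou property the
  triangle inequality, completeness, measurability and bounds for integrals are reduced to finite sums.
\<close>

lemma mem_lqr_space_iff:
  assumes qr: "1 \<le> q" "1 \<le> r"
  shows "x \<in> lqr_space q r \<and> lqr_norm q r x \<le> B \<longleftrightarrow> (\<forall>N. trunc_norm q r N x \<le> B)"
proof (intro iffI allI conjI)
  fix N assume x: "x \<in> lqr_space q r \<and> lqr_norm q r x \<le> B"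
  then have s1: "summable (\<lambda>n. cmod (x (m, n)) powr r)" for m by (auto simp: lqr_space_def)
  have s2: "summable (\<lambda>m. (\<Sum>n. cmod (x (m, n)) powr r) powr (q / r))" using x by (auto simp: lqr_space_def)
  have "(\<Sum>m<N. (\<Sum>n<N. cmod (x (m, n)) powr r) powr (q / r)) \<le> (\<Sum>m<N. (\<Sum>n. cmod (x (m, n)) powr r) powr (q / r))"
    using qr s1 by (intro sum_mono powr_mono2 sum_le_suminf sum_nonneg) auto
  also have "\<dots> \<le> (\<Sum>m. (\<Sum>n. cmod (x (m, n)) powr r) powr (q / r))"
    using s2 by (intro sum_le_suminf) auto
  finally have "trunc_norm q r N x \<le> lqr_norm q r x"
    unfolding trunc_norm_def mnorm_altdef[OF qr(2)] lqr_norm_def using qr by (intro powr_mono2 sum_nonneg) auto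
  with x show "trunc_norm q r N x \<le> B" by simp
next
  assume le: "\<forall>N. trunc_norm q r N x \<le> B"
  have B: "0 \<le> B" using le[rule_format, of 0] trunc_norm_nonneg[of q r 0 x] by linarith
  have s1: "summable (\<lambda>n. cmod (x (m, n)) powr r)" for m
  proof (rule summableI_nonneg_bounded)
    fix k
    let ?N = "max (Suc m) k"
    have "pnorm r {..<k} (\<lambda>n. cmod (x (m, n))) \<le> pnorm r {..<?N} (\<lambda>n. cmod (x (m, n)))"
      using qr by (intro pnorm_mono_set) auto
    also have "\<dots> \<le> trunc_norm q r ?N x"
      unfolding trunc_norm_def mnorm_def
      using pnorm_component_le[of "{..<?N}" m "\<lambda>m. pnorm r {..<?N} (\<lambda>n. cmod (x (m, n)))" q] qr by auto
    also have "\<dots> \<le> B" using le by blast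
    finally have "pnorm r {..<k} (\<lambda>n. cmod (x (m, n))) powr r \<le> B powr r" using qr by (intro powr_mono2) auto
    then show "(\<Sum>n<k. cmod (x (m, n)) powr r) \<le> B powr r" using qr by (simp add: pnorm_powr)
  qed auto
  have part: "(\<Sum>m<K. (\<Sum>n. cmod (x (m, n)) powr r) powr (q / r)) \<le> B powr q" for K
  proof (rule LIMSEQ_le_const2)
    show "(\<lambda>k. \<Sum>m<K. (\<Sum>n<k. cmod (x (m, n)) powr r) powr (q / r))
        \<longlonglongrightarrow> (\<Sum>m<K. (\<Sum>n. cmod (x (m, n)) powr r) powr (q / r))"
      using qr summable_LIMSEQ[OF s1]
      by (intro tendsto_sum tendsto_powr') (auto intro!: always_eventually sum_nonneg)
    show "\<exists>N. \<forall>k\<ge>N. (\<Sum>m<K. (\<Sum>n<k. cmod (x (m, n)) powr r) powr (q / r)) \<le> B powr q"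
    proof (intro exI[of _ K] allI impI)
      fix k assume "K \<le> k"
      have "(\<Sum>m<K. (\<Sum>n<k. cmod (x (m, n)) powr r) powr (q / r)) \<le> (\<Sum>m<k. (\<Sum>n<k. cmod (x (m, n)) powr r) powr (q / r))"
        using \<open>K \<le> k\<close> by (intro sum_mono2) auto
      also have "\<dots> = trunc_norm q r k x powr q"
        using qr by (simp add: trunc_norm_def mnorm_altdef powr_powr sum_nonneg)
      also have "\<dots> \<le> B powr q" using le qr by (intro powr_mono2) auto
      finally show "(\<Sum>m<K. (\<Sum>n<k. cmod (x (m, n)) powr r) powr (q / r)) \<le> B powr q" .
    qed
  qed
  then have s2: "summable (\<lambda>m. (\<Sum>n. cmod (x (m, n)) powr r) powr (q / r))"
    by (intro summableI_nonneg_bounded) auto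
  with s1 show "x \<in> lqr_space q r" by (simp add: lqr_space_def)
  have "(\<Sum>m. (\<Sum>n. cmod (x (m, n)) powr r) powr (q / r)) \<le> B powr q"
    using s2 part by (intro suminf_le_const)
  then have "lqr_norm q r x \<le> (B powr q) powr (1 / q)"
    unfolding lqr_norm_def using qr s2 by (intro powr_mono2 suminf_nonneg) auto
  then show "lqr_norm q r x \<le> B" using B qr by (simp add: powr_powr)
qed

locale lqr =
  fixes q r :: real
  assumes q1: "1 \<le> q" and r1: "1 \<le> r"
begin

abbreviation V where "V \<equiv> lqr_space q r"
abbreviation nrm where "nrm \<equiv> lqr_norm q r"
abbreviation tn where "tn \<equiv> trunc_norm q r"

lemma nrm_nonneg [simp]: "0 \<le> nrm x" by (simp add: lqr_norm_def)

lemma tn_le_nrm: "x \<in> V \<Longrightarrow> tn N x \<le> nrm x"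
  using mem_lqr_space_iff[OF q1 r1, of x "nrm x"] by blast

lemma lqrI: "(\<And>N. tn N x \<le> B) \<Longrightarrow> x \<in> V" and nrm_leI: "(\<And>N. tn N x \<le> B) \<Longrightarrow> nrm x \<le> B"
  using mem_lqr_space_iff[OF q1 r1, of x B] by blast+

lemma tn_mono_dim: "N \<le> N' \<Longrightarrow> tn N x \<le> tn N' x"
  unfolding trunc_norm_def using q1 r1 by (intro mnorm_mono_dim)

lemma tn_tendsto: "x \<in> V \<Longrightarrow> (\<lambda>N. tn N x) \<longlonglongrightarrow> nrm x"
proof -
  assume x: "x \<in> V"
  obtain L where L: "(\<lambda>N. tn N x) \<longlonglongrightarrow> L" "\<And>N. tn N x \<le> L"
    using incseq_convergent[of "\<lambda>N. tn N x" "nrm x"] tn_le_nrm[OF x] tn_mono_dim[of _ _ x]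
    by (auto simp: incseq_def)
  have "nrm x = L"
    using nrm_leI[of x L] L tn_le_nrm[OF x] by (intro antisym LIMSEQ_le_const2[OF L(1)]) auto
  with L show ?thesis by simp
qed

lemma tn_mono: "(\<And>i. cmod (x i) \<le> cmod (y i)) \<Longrightarrow> tn N x \<le> tn N y"
  unfolding trunc_norm_def using q1 r1 by (intro mnorm_mono) auto

lemma tn_triangle: "tn N (x + y) \<le> tn N x + tn N y"
proof -
  have "tn N (x + y) \<le> mnorm q r N (\<lambda>i. \<Sum>j\<in>{False, True}. cmod ((if j then x else y) i))"
    unfolding trunc_norm_def using q1 r1
    by (intro mnorm_mono) (auto simp: add.commute norm_triangle_ineq)
  also have "\<dots> \<le> (\<Sum>j\<in>{False, True}. mnorm q r N (\<lambda>i. cmod ((if j then x else y) i)))"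
    using q1 r1 by (intro mnorm_sum_le) auto
  finally show ?thesis by (simp add: trunc_norm_def)
qed

lemma tn_cscale: "tn N (cscale c x) = cmod c * tn N x"
  unfolding trunc_norm_def cscale_def norm_mult using q1 r1 by (intro mnorm_scale) auto

lemma lqr_dominated:
  assumes "x \<in> V" "\<And>i. cmod (y i) \<le> C * cmod (x i)" "0 \<le> C"
  shows "y \<in> V" "nrm y \<le> C * nrm x"
proof -
  have "tn N y \<le> C * nrm x" for N
  proof -
    have "tn N y \<le> tn N (cscale (of_real C) x)"
      using assms by (intro tn_mono) (auto simp: cscale_def norm_mult)
    also have "\<dots> \<le> C * nrm x" using assms tn_le_nrm[of x N] by (simp add: tn_cscale mult_left_mono)
    finally show ?thesis .
  qed
  then show "y \<in> V" "nrm y \<le> C * nrm x" by (auto intro: lqrI nrm_leI)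
qed

lemma add_in_lqr: "x \<in> V \<Longrightarrow> y \<in> V \<Longrightarrow> x + y \<in> V"
  and nrm_triangle: "x \<in> V \<Longrightarrow> y \<in> V \<Longrightarrow> nrm (x + y) \<le> nrm x + nrm y"
proof -
  assume "x \<in> V" "y \<in> V"
  then have "tn N (x + y) \<le> nrm x + nrm y" for N
    using tn_triangle[of N x y] tn_le_nrm[of x N] tn_le_nrm[of y N] by linarith
  then show "x + y \<in> V" "nrm (x + y) \<le> nrm x + nrm y" by (auto intro: lqrI nrm_leI)
qed

lemma cscale_in_lqr: "x \<in> V \<Longrightarrow> cscale c x \<in> V"
  by (rule lqr_dominated(1)[of x _ "cmod c"]) (auto simp: cscale_def norm_mult)

lemma nrm_cscale: "x \<in> V \<Longrightarrow> nrm (cscale c x) = cmod c * nrm x"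
proof -
  assume x: "x \<in> V"
  have "(\<lambda>N. tn N (cscale c x)) \<longlonglongrightarrow> cmod c * nrm x"
    unfolding tn_cscale by (intro tendsto_mult tendsto_const tn_tendsto x)
  then show ?thesis using tn_tendsto[OF cscale_in_lqr[OF x]] LIMSEQ_unique by blast
qed

lemma uminus_in_lqr: "x \<in> V \<Longrightarrow> - x \<in> V"
  by (rule lqr_dominated(1)[of x _ 1]) auto

lemma diff_in_lqr: "x \<in> V \<Longrightarrow> y \<in> V \<Longrightarrow> x - y \<in> V"
  using add_in_lqr[of x "- y"] uminus_in_lqr by simp

lemma component_le_nrm: "x \<in> V \<Longrightarrow> cmod (x i) \<le> nrm x"
proof -
  assume x: "x \<in> V"
  obtain m n where i: "i = (m, n)" by (cases i)
  have "cmod (x i) \<le> tn (Suc (max m n)) x"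
    unfolding trunc_norm_def i using q1 r1 by (intro mnorm_component_le) auto
  also have "\<dots> \<le> nrm x" by (rule tn_le_nrm[OF x])
  finally show ?thesis .
qed

lemma zero_in_lqr: "0 \<in> V" and nrm_zero: "nrm 0 = 0"
proof -
  have "tn N 0 \<le> 0" for N by (simp add: trunc_norm_def mnorm_altdef r1)
  then show "0 \<in> V" "nrm 0 = 0" using nrm_leI[of 0 0] nrm_nonneg[of 0] by (auto intro: lqrI)
qed

lemma nrm_eq_0_iff: "x \<in> V \<Longrightarrow> nrm x = 0 \<longleftrightarrow> x = 0"
  using component_le_nrm[of x] nrm_zero by (fastforce simp: fun_eq_iff)

text \<open>
  A Cauchy sequence converges in every coordinate, and the truncated norms of the differences pass to
  the limit.
\<close>

lemma complex_banach_lqr: "complex_banach V nrm"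
  unfolding complex_banach_def complex_subspace_def
proof (intro conjI ballI allI impI)
  fix s :: "nat \<Rightarrow> dseq"
  assume s: "(\<forall>k. s k \<in> V) \<and> (\<forall>e>0. \<exists>K. \<forall>i\<ge>K. \<forall>j\<ge>K. nrm (s i - s j) < e)"
  then have sV: "s k \<in> V" for k by blast
  have "Cauchy (\<lambda>k. s k i)" for i
  proof (rule metric_CauchyI)
    fix e :: real assume "0 < e"
    then obtain K where "\<forall>i\<ge>K. \<forall>j\<ge>K. nrm (s i - s j) < e" using s by blast
    moreover have "dist (s k i) (s l i) \<le> nrm (s k - s l)" for k l
      using component_le_nrm[OF diff_in_lqr[OF sV sV]] by (simp add: dist_norm)
    ultimately show "\<exists>M. \<forall>m\<ge>M. \<forall>n\<ge>M. dist (s m i) (s n i) < e" by (meson order_le_less_trans)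
  qed
  then have "\<exists>y. (\<lambda>k. s k i) \<longlonglongrightarrow> y" for i by (meson Cauchy_convergent_iff convergent_def)
  then obtain x where x: "\<And>i. (\<lambda>k. s k i) \<longlonglongrightarrow> x i" by metis
  have close: "s k - x \<in> V \<and> nrm (s k - x) \<le> e" if K: "\<forall>i\<ge>K. \<forall>j\<ge>K. nrm (s i - s j) < e" and k: "k \<ge> K" for e K k
  proof -
    have "tn N (s k - x) \<le> e" for N
    proof (rule LIMSEQ_le_const2)
      show "(\<lambda>j. tn N (s k - s j)) \<longlonglongrightarrow> tn N (s k - x)"
        unfolding trunc_norm_def mnorm_altdef[OF r1] fun_diff_def using q1 r1 x
        by (intro tendsto_sum tendsto_powr' tendsto_norm tendsto_diff tendsto_const)
           (auto intro!: always_eventually sum_nonneg)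
      have "tn N (s k - s j) \<le> e" if "j \<ge> K" for j
        using tn_le_nrm[OF diff_in_lqr[OF sV sV], of N k j] K k that by (meson less_imp_le order_trans)
      then show "\<exists>M. \<forall>j\<ge>M. tn N (s k - s j) \<le> e" by blast
    qed
    then show ?thesis by (auto intro: lqrI nrm_leI)
  qed
  obtain K where "\<forall>i\<ge>K. \<forall>j\<ge>K. nrm (s i - s j) < 1" using s zero_less_one by blast
  from close[OF this order_refl] have "s K - (s K - x) \<in> V" using diff_in_lqr[OF sV] by blast
  then have xV: "x \<in> V" by simp
  have "(\<lambda>k. nrm (s k - x)) \<longlonglongrightarrow> 0"
  proof (rule LIMSEQ_I)
    fix e :: real assume "0 < e"
    then obtain K where "\<forall>i\<ge>K. \<forall>j\<ge>K. nrm (s i - s j) < e / 2" using s half_gt_zero by blast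
    from close[OF this] have "\<forall>k\<ge>K. nrm (s k - x) \<le> e / 2" by blast
    then show "\<exists>no. \<forall>k\<ge>no. norm (nrm (s k - x) - 0) < e" using \<open>0 < e\<close> by (intro exI[of _ K]) force
  qed
  with xV show "\<exists>x\<in>V. (\<lambda>k. nrm (s k - x)) \<longlonglongrightarrow> 0" by blast
qed (auto simp: zero_in_lqr add_in_lqr cscale_in_lqr nrm_eq_0_iff nrm_cscale nrm_triangle)

text \<open>
  As \<open>q\<close> and \<open>r\<close> are finite, the norm is absolutely continuous. Density of the domain, strong
  continuity, the generator, analyticity and strong measurability all rest on this lemma.
\<close>

lemma dominated_convergence_lqr:
  assumes x: "x \<in> V"
    and dom: "\<forall>\<^sub>F h in F. \<forall>i. cmod (y h i) \<le> C * cmod (x i)"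
    and lim: "\<And>i. ((\<lambda>h. y h i) \<longlongrightarrow> 0) F"
  shows "((\<lambda>h. nrm (y h)) \<longlongrightarrow> 0) F"
proof (cases "F = bot")
  case False
  define z where "z = cscale (of_real \<bar>C\<bar>) x"
  have zV: "z \<in> V" unfolding z_def by (intro cscale_in_lqr x)
  have dom: "\<forall>\<^sub>F h in F. \<forall>i. cmod (y h i) \<le> cmod (z i)"
    using dom
  proof eventually_elim
    case (elim h)
    show ?case
    proof
      fix i
      have "cmod (y h i) \<le> C * cmod (x i)" using elim by blast
      also have "\<dots> \<le> \<bar>C\<bar> * cmod (x i)" by (intro mult_right_mono) auto
      finally show "cmod (y h i) \<le> cmod (z i)" by (simp add: z_def cscale_def norm_mult)
    qed
  qed
  have prod: "\<forall>\<^sub>F (k, h) in at_top \<times>\<^sub>F F. P k h" if "\<forall>\<^sub>F h in F. \<forall>k. P k h" for P :: "nat \<Rightarrow> _ \<Rightarrow> bool"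
    unfolding eventually_prod_filter using that
    by (intro exI[of _ "\<lambda>_. True"] exI[of _ "\<lambda>h. \<forall>k. P k h"]) auto
  have s1: "summable (\<lambda>n. cmod (z (m, n)) powr r)" for m using zV by (simp add: lqr_space_def)
  have s2: "summable (\<lambda>m. (\<Sum>n. cmod (z (m, n)) powr r) powr (q / r))" using zV by (simp add: lqr_space_def)
  have inner: "((\<lambda>h. \<Sum>n. cmod (y h (m, n)) powr r) \<longlongrightarrow> 0) F" for m
  proof -
    have "((\<lambda>h. \<Sum>n. cmod (y h (m, n)) powr r) \<longlongrightarrow> (\<Sum>n. 0)) F"
    proof (rule tannerys_theorem[THEN conjunct2, THEN conjunct2])
      show "((\<lambda>h. cmod (y h (m, n)) powr r) \<longlongrightarrow> 0) F" for n
        using r1 lim[of "(m, n)"] by (intro tendsto_zero_powrI[where b = r] tendsto_norm_zero tendsto_const) auto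
      show "\<forall>\<^sub>F (n, h) in at_top \<times>\<^sub>F F. norm (cmod (y h (m, n)) powr r) \<le> cmod (z (m, n)) powr r"
        using dom r1 by (intro prod) (auto elim!: eventually_mono intro!: powr_mono2)
    qed (use s1 False in auto)
    then show ?thesis by simp
  qed
  have "((\<lambda>h. \<Sum>m. (\<Sum>n. cmod (y h (m, n)) powr r) powr (q / r)) \<longlongrightarrow> (\<Sum>m. 0)) F"
  proof (rule tannerys_theorem[THEN conjunct2, THEN conjunct2])
    show "((\<lambda>h. (\<Sum>n. cmod (y h (m, n)) powr r) powr (q / r)) \<longlongrightarrow> 0) F" for m
    proof (rule tendsto_zero_powrI[where b = "q / r"])
      show "\<forall>\<^sub>F h in F. 0 \<le> (\<Sum>n. cmod (y h (m, n)) powr r)"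
        using dom
      proof eventually_elim
        case (elim h)
        then have "summable (\<lambda>n. cmod (y h (m, n)) powr r)"
          using r1 by (intro summable_comparison_test'[OF s1[of m], of 0]) (auto intro!: powr_mono2)
        then show ?case by (intro suminf_nonneg) auto
      qed
    qed (use inner q1 r1 in auto)
    show "\<forall>\<^sub>F (m, h) in at_top \<times>\<^sub>F F. norm ((\<Sum>n. cmod (y h (m, n)) powr r) powr (q / r))
        \<le> (\<Sum>n. cmod (z (m, n)) powr r) powr (q / r)"
    proof (rule prod, use dom in eventually_elim, rule allI)
      fix h m assume h: "\<forall>i. cmod (y h i) \<le> cmod (z i)"
      then have le: "cmod (y h (m, n)) powr r \<le> cmod (z (m, n)) powr r" for n using r1 by (intro powr_mono2) auto
      have "summable (\<lambda>n. cmod (y h (m, n)) powr r)"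
        using le by (intro summable_comparison_test'[OF s1[of m], of 0]) auto
      then have "(\<Sum>n. cmod (y h (m, n)) powr r) powr (q / r) \<le> (\<Sum>n. cmod (z (m, n)) powr r) powr (q / r)"
        using s1 q1 r1 by (intro powr_mono2 suminf_le suminf_nonneg le) auto
      then show "norm ((\<Sum>n. cmod (y h (m, n)) powr r) powr (q / r)) \<le> (\<Sum>n. cmod (z (m, n)) powr r) powr (q / r)"
        by simp
    qed
  qed (use s2 False in auto)
  then have lim0: "((\<lambda>h. \<Sum>m. (\<Sum>n. cmod (y h (m, n)) powr r) powr (q / r)) \<longlongrightarrow> 0) F" by simp
  show ?thesis
    unfolding lqr_norm_def
  proof (rule tendsto_zero_powrI[where b = "1 / q", OF lim0])
    show "\<forall>\<^sub>F h in F. 0 \<le> (\<Sum>m. (\<Sum>n. cmod (y h (m, n)) powr r) powr (q / r))"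
      using dom
    proof eventually_elim
      case (elim h)
      then have "\<And>i. cmod (y h i) \<le> 1 * cmod (z i)" unfolding mult_1 by blast
      then have "y h \<in> V" by (rule lqr_dominated(1)[OF zV]) simp
      then show ?case by (intro suminf_nonneg) (auto simp: lqr_space_def)
    qed
  qed (use q1 in auto)
qed simp


end

section \<open>Diagonal operators\<close>

text \<open>
  The operator, its resolvents and the semigroup with its holomorphic extension all multiply by a
  sequence that depends on the inner index \<open>n\<close> only.
\<close>

definition mult_op :: "(nat \<Rightarrow> complex) \<Rightarrow> dseq \<Rightarrow> dseq" where
  "mult_op a x = (\<lambda>(m, n). a n * x (m, n))"

lemma mult_op_apply: "mult_op a x i = a (snd i) * x i"
  by (simp add: mult_op_def split_beta)

lemma diag_op_eq: "diag_op = mult_op (\<lambda>n. 2 ^ Suc n)"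
  by (simp add: fun_eq_iff diag_op_def mult_op_def)

lemma diag_semigroup_eq: "diag_semigroup t = mult_op (\<lambda>n. of_real (exp (- (2 ^ Suc n * t))))"
  by (simp add: fun_eq_iff diag_semigroup_def mult_op_def)

lemma mult_op_linear:
  "mult_op a (x + y) = mult_op a x + mult_op a y" "mult_op a (cscale c x) = cscale c (mult_op a x)"
  by (simp_all add: fun_eq_iff mult_op_apply cscale_def distrib_left)

lemma mult_op_mult_op: "mult_op a (mult_op b x) = mult_op (\<lambda>n. a n * b n) x"
  by (simp add: fun_eq_iff mult_op_apply)

lemma mult_op_1: "mult_op (\<lambda>n. 1) x = x"
  by (simp add: fun_eq_iff mult_op_apply)

context lqr
begin

abbreviation D where "D \<equiv> diag_dom q r"

lemma mult_op_bounded: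
  assumes x: "x \<in> V" and a: "\<And>n. cmod (a n) \<le> C" and "0 \<le> C"
  shows "mult_op a x \<in> V" "nrm (mult_op a x) \<le> C * nrm x"
  by (rule lqr_dominated[OF x, where C = C]; use assms in \<open>simp add: mult_op_apply norm_mult mult_right_mono\<close>)+

lemma bounded_operator_mult_op:
  assumes "\<And>n. cmod (a n) \<le> C" "0 \<le> C"
  shows "bounded_operator V nrm (mult_op a)"
  unfolding bounded_operator_def linear_operator_def complex_subspace_def
  using mult_op_bounded[of _ a C] assms zero_in_lqr
  by (auto simp: add_in_lqr cscale_in_lqr mult_op_linear)

lemma mult_op_tendsto_0:
  assumes x: "x \<in> V" and dom: "\<forall>\<^sub>F h in F. \<forall>n. cmod (a h n) \<le> C"
    and lim: "\<And>n. ((\<lambda>h. a h n) \<longlongrightarrow> 0) F"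
  shows "((\<lambda>h. nrm (mult_op (a h) x)) \<longlongrightarrow> 0) F"
proof (rule dominated_convergence_lqr[OF x, where C = C])
  show "\<forall>\<^sub>F h in F. \<forall>i. cmod (mult_op (a h) x i) \<le> C * cmod (x i)"
    using dom by eventually_elim (simp add: mult_op_apply norm_mult mult_right_mono)
  show "((\<lambda>h. mult_op (a h) x i) \<longlongrightarrow> 0) F" for i
    unfolding mult_op_apply by (intro tendsto_mult_left_zero lim)
qed

lemma finite_support_in_lqr:
  assumes "\<And>m n. K \<le> m \<or> K \<le> n \<Longrightarrow> x (m, n) = 0"
  shows "x \<in> V"
proof -
  have s1: "summable (\<lambda>n. cmod (x (m, n)) powr r)" for m
    using assms by (intro summable_finite[of "{..<K}"]) auto
  have "(\<Sum>n. cmod (x (m, n)) powr r) = 0" if "K \<le> m" for m using assms that by simp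
  then have "summable (\<lambda>m. (\<Sum>n. cmod (x (m, n)) powr r) powr (q / r))"
    by (intro summable_finite[of "{..<K}"]) auto
  with s1 show ?thesis by (simp add: lqr_space_def)
qed

definition cut :: "nat \<Rightarrow> dseq \<Rightarrow> dseq" where
  "cut K x = (\<lambda>(m, n). if m < K \<and> n < K then x (m, n) else 0)"

lemma cut_in_lqr: "cut K x \<in> V"
  by (rule finite_support_in_lqr[of K]) (auto simp: cut_def)

lemma densely_defined_diag: "densely_defined V nrm D"
  unfolding densely_defined_def
proof (intro ballI allI impI)
  fix x and e :: real assume x: "x \<in> V" and e: "0 < e"
  have "(\<lambda>K. nrm (x - cut K x)) \<longlonglongrightarrow> 0"
  proof (rule dominated_convergence_lqr[OF x, where C = 1])
    show "(\<lambda>K. (x - cut K x) i) \<longlonglongrightarrow> 0" for i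
      by (rule tendsto_eventually, rule eventually_sequentiallyI[of "Suc (max (fst i) (snd i))"])
         (auto simp: cut_def split: prod.split)
  qed (auto simp: cut_def intro!: always_eventually)
  then have "\<forall>\<^sub>F K in sequentially. nrm (x - cut K x) < e" using e by (rule order_tendstoD)
  then obtain K where "nrm (x - cut K x) < e" by (auto simp: eventually_sequentially)
  moreover have "diag_op (cut K x) \<in> V"
    by (rule finite_support_in_lqr[of K]) (auto simp: cut_def diag_op_def)
  ultimately show "\<exists>y\<in>D. nrm (x - y) < e" using cut_in_lqr by (auto simp: diag_dom_def)
qed

lemma linear_operator_diag: "linear_operator V D diag_op"
  unfolding linear_operator_def complex_subspace_def diag_dom_def diag_op_eq
proof (intro conjI ballI allI)
  have "mult_op a 0 = 0" for a by (simp add: fun_eq_iff mult_op_apply)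
  then show "0 \<in> {x \<in> V. mult_op (\<lambda>n. 2 ^ Suc n) x \<in> V}" using zero_in_lqr by simp
qed (auto simp: mult_op_linear add_in_lqr cscale_in_lqr)

lemma Re_nonneg_in_closure_sector:
  assumes "0 \<le> Re z" "pi / 2 < \<omega>"
  shows "z \<in> closure (sector \<omega>)"
proof (cases "z = 0")
  case True
  have "(\<lambda>n. of_real (1 / Suc n) :: complex) \<longlonglongrightarrow> of_real 0"
    using LIMSEQ_inverse_real_of_nat by (intro tendsto_of_real) (simp add: divide_inverse)
  moreover have "of_real (1 / Suc n) \<in> sector \<omega>" for n
  proof -
    have "0 < \<omega>" using assms pi_gt_zero by linarith
    then show ?thesis by (auto simp: sector_def Arg_of_real simp del: of_real_divide)
  qed
  ultimately show ?thesis unfolding closure_sequential True by (metis of_real_0)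
next
  case False
  then have "\<bar>Arg z\<bar> \<le> pi / 2" using assms Re_Ln_pos_le[OF False] by (simp add: Arg_eq_Im_Ln)
  then have "z \<in> sector \<omega>" using assms False by (simp add: sector_def)
  then show ?thesis by (simp add: closure_def)
qed

text \<open>
  Any angle above \<open>pi / 2\<close> will do: for \<open>Re \<mu> < 0\<close> the distance from \<open>\<mu>\<close> to a positive number is at least the
  modulus of either, so \<open>\<mu>\<close> times the resolvent and the operator times the resolvent are contractions.
\<close>

lemma sectorial_diag: "sectorial V nrm D diag_op"
  unfolding sectorial_def
proof (rule conjI[OF linear_operator_diag], rule exI[of _ "3 * pi / 4"],
    rule conjI[OF _ conjI[OF _ exI[of _ "1::real", OF allI[OF impI]]]])
  show "0 < 3 * pi / 4" by simp
  show "3 * pi / 4 < pi" by simp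
  fix \<mu> assume "\<mu> \<notin> closure (sector (3 * pi / 4))"
  then have \<mu>: "Re \<mu> < 0" using Re_nonneg_in_closure_sector[of \<mu> "3 * pi / 4"] pi_gt_zero by force
  let ?l = "\<lambda>n. 2 ^ Suc n :: complex"
  let ?R = "mult_op (\<lambda>n. 1 / (\<mu> - ?l n))"
  have l: "?l n = of_real (2 ^ Suc n)" for n by simp
  have ge: "cmod \<mu> \<le> cmod (\<mu> - ?l n)" "cmod (?l n) \<le> cmod (\<mu> - ?l n)" for n
  proof -
    have "(0::real) < 2 ^ Suc n" by simp
    then have "\<bar>Re \<mu>\<bar> \<le> \<bar>Re \<mu> - 2 ^ Suc n\<bar>" using \<mu> by linarith
    then have "(Re \<mu>)\<^sup>2 \<le> (Re \<mu> - 2 ^ Suc n)\<^sup>2" by (simp only: abs_le_square_iff)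
    then show "cmod \<mu> \<le> cmod (\<mu> - ?l n)" unfolding l cmod_def by (intro real_sqrt_le_mono) simp
    have "cmod (?l n) = 2 ^ Suc n" by (simp add: norm_mult norm_power)
    also have "\<dots> \<le> \<bar>Re (\<mu> - ?l n)\<bar>" unfolding l using \<mu> by simp
    also have "\<dots> \<le> cmod (\<mu> - ?l n)" by (rule abs_Re_le_cmod)
    finally show "cmod (?l n) \<le> cmod (\<mu> - ?l n)" .
  qed
  have pos: "0 < cmod \<mu>" using \<mu> by auto
  have nz: "\<mu> - ?l n \<noteq> 0" for n using ge(1)[of n] pos by force
  have b: "cmod (1 / (\<mu> - ?l n)) \<le> 1 / cmod \<mu>" for n
    using ge(1)[of n] pos by (simp add: norm_divide frac_le del: power_Suc)
  have b': "cmod (?l n * (1 / (\<mu> - ?l n))) \<le> 1" for n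
    using ge(2)[of n] nz[of n] by (simp add: norm_divide divide_le_eq_1 del: power_Suc)
  show "\<exists>R. bounded_operator V nrm R \<and> (\<forall>x\<in>V. R x \<in> D \<and> cscale \<mu> (R x) - diag_op (R x) = x) \<and>
      (\<forall>x\<in>D. R (cscale \<mu> x - diag_op x) = x) \<and> (\<forall>x\<in>V. cmod \<mu> * nrm (R x) \<le> 1 * nrm x)"
  proof (intro exI[of _ ?R] conjI ballI)
    show "bounded_operator V nrm ?R" by (rule bounded_operator_mult_op[OF b]) simp
    fix x assume x: "x \<in> V"
    have "?R x \<in> V" by (rule mult_op_bounded(1)[OF x b]) simp
    moreover have "diag_op (?R x) \<in> V"
      unfolding diag_op_eq mult_op_mult_op by (rule mult_op_bounded(1)[OF x b']) simp
    ultimately show "?R x \<in> D" by (simp add: diag_dom_def)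
    show "cscale \<mu> (?R x) - diag_op (?R x) = x"
      using nz by (simp add: fun_eq_iff cscale_def diag_op_eq mult_op_apply left_diff_distrib[symmetric] divide_simps
          del: power_Suc)
    have "nrm (?R x) \<le> 1 / cmod \<mu> * nrm x" by (rule mult_op_bounded(2)[OF x b]) simp
    then show "cmod \<mu> * nrm (?R x) \<le> 1 * nrm x" using pos by (simp add: field_simps)
  next
    fix x assume "x \<in> D"
    show "?R (cscale \<mu> x - diag_op x) = x"
      using nz by (simp add: fun_eq_iff cscale_def diag_op_eq mult_op_apply left_diff_distrib[symmetric] divide_simps
          del: power_Suc)
  qed
qed

lemma C0_semigroup_diag: "C0_semigroup V nrm diag_semigroup"
  unfolding C0_semigroup_def
proof (intro conjI allI ballI impI)
  show "bounded_operator V nrm (diag_semigroup t)" if "0 \<le> t" for t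
    unfolding diag_semigroup_eq using that by (intro bounded_operator_mult_op[of _ 1]) auto
  show "diag_semigroup 0 x = x" for x by (simp add: diag_semigroup_eq mult_op_1)
  show "diag_semigroup (s + t) x = diag_semigroup s (diag_semigroup t x)" for s t x
    unfolding diag_semigroup_eq mult_op_mult_op by (simp add: distrib_left exp_add[symmetric] flip: of_real_mult)
  show "((\<lambda>t. nrm (diag_semigroup t x - x)) \<longlongrightarrow> 0) (at_right 0)" if x: "x \<in> V" for x
  proof -
    have e: "diag_semigroup t x - x = mult_op (\<lambda>n. of_real (exp (- (2 ^ Suc n * t))) - 1) x" for t
      by (simp add: fun_eq_iff mult_op_apply diag_semigroup_eq left_diff_distrib)
    show ?thesis
      unfolding e
    proof (rule mult_op_tendsto_0[OF x, where C = 2])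
      show "\<forall>\<^sub>F t in at_right 0. \<forall>n. cmod (of_real (exp (- (2 ^ Suc n * t))) - 1) \<le> 2"
        using eventually_at_right_less
      proof eventually_elim
        case (elim t)
        show ?case
        proof
          fix n
          have "cmod (of_real (exp (- (2 ^ Suc n * t))) - 1) \<le> cmod (of_real (exp (- (2 ^ Suc n * t)))) + cmod 1"
            by (rule norm_triangle_ineq4)
          also have "\<dots> \<le> 2" using elim by simp
          finally show "cmod (of_real (exp (- (2 ^ Suc n * t))) - 1) \<le> 2" .
        qed
      qed
      show "((\<lambda>t. complex_of_real (exp (- (2 ^ Suc n * t))) - 1) \<longlongrightarrow> 0) (at_right 0)" for n
      proof -
        have "((\<lambda>t. complex_of_real (exp (- (2 ^ Suc n * t))) - 1) \<longlongrightarrow> of_real (exp (- (2 ^ Suc n * 0))) - 1) (at_right 0)"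
          by (intro tendsto_intros)
        then show ?thesis by simp
      qed
    qed
  qed
qed

lemma norm_exp_minus_1_le: "cmod (exp z - 1) \<le> cmod z * exp (cmod z)"
proof -
  have "cmod (exp z - exp 0) \<le> exp (cmod z) * cmod (z - 0)"
  proof (rule field_differentiable_bound[of "cball 0 (cmod z)" exp exp])
    show "(exp has_field_derivative exp w) (at w within cball 0 (cmod z))" for w :: complex
      by (rule DERIV_subset[OF DERIV_exp]) simp
    show "cmod (exp w) \<le> exp (cmod z)" if "w \<in> cball 0 (cmod z)" for w
      using that norm_exp[of w] by (meson exp_le_cancel_iff mem_cball_0 order_trans)
  qed auto
  then show ?thesis by (simp add: mult.commute)
qed

lemma difference_quotient_exp_tendsto:
  "((\<lambda>h. (1 / h) * (exp (- (a * h)) - 1) + a) \<longlongrightarrow> 0) (at (0 :: complex))"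
proof -
  have "((\<lambda>h. exp (- (a * h))) has_field_derivative - a) (at 0)"
    by (auto intro!: derivative_eq_intros)
  then have "((\<lambda>h. (exp (- (a * h)) - 1) / h) \<longlongrightarrow> - a) (at 0)" by (simp add: has_field_derivative_iff)
  then have "((\<lambda>h. (exp (- (a * h)) - 1) / h + a) \<longlongrightarrow> - a + a) (at 0)" by (intro tendsto_intros)
  then show ?thesis by simp
qed

text \<open>
  On the domain the difference quotients are dominated by twice the entries of \<open>diag_op x\<close>. Conversely,
  a limit of the quotients in norm is a limit in every coordinate, hence equal to \<open>- diag_op x\<close>.
\<close>

lemma neg_generates_diag: "neg_generates V nrm D diag_op diag_semigroup"
proof -
  have quot: "(1 / h) *\<^sub>R (diag_semigroup h x - x)
      = mult_op (\<lambda>n. of_real (1 / h) * (of_real (exp (- (2 ^ Suc n * h))) - 1)) x" for h x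
    by (simp add: fun_eq_iff mult_op_apply diag_semigroup_eq left_diff_distrib scaleR_fun_def scaleR_conv_of_real)
  have lim: "((\<lambda>h. of_real (1 / h) * (of_real (exp (- (2 ^ Suc n * h))) - 1) + 2 ^ Suc n :: complex) \<longlongrightarrow> 0) (at_right 0)" for n
  proof -
    have "filterlim complex_of_real (at 0) (at_right 0)"
      by (auto simp: filterlim_at eventually_at_filter intro!: tendsto_eq_intros)
    from filterlim_compose[OF difference_quotient_exp_tendsto[of "2 ^ Suc n"] this]
    show ?thesis by (simp add: exp_of_real[symmetric])
  qed
  have conv: "((\<lambda>h. nrm ((1 / h) *\<^sub>R (diag_semigroup h x - x) + diag_op x)) \<longlongrightarrow> 0) (at_right 0)" if x: "x \<in> D" for x
  proof -
    have Ax: "diag_op x \<in> V" using x by (simp add: diag_dom_def)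
    show ?thesis
    proof (rule dominated_convergence_lqr[OF Ax, where C = 2])
      show "\<forall>\<^sub>F h in at_right 0. \<forall>i. cmod (((1 / h) *\<^sub>R (diag_semigroup h x - x) + diag_op x) i) \<le> 2 * cmod (diag_op x i)"
        using eventually_at_right_less
      proof eventually_elim
        case (elim h)
        show ?case
        proof
          fix i :: "nat \<times> nat"
          define a where "a = (2::real) ^ Suc (snd i)"
          have a: "0 < a" by (simp add: a_def)
          have "1 - exp (- (a * h)) \<le> a * h" using exp_ge_add_one_self[of "- (a * h)"] by linarith
          then have "- a \<le> 1 / h * (exp (- (a * h)) - 1)" using elim by (simp add: field_simps)
          moreover have "1 / h * (exp (- (a * h)) - 1) \<le> 0" using a elim by (intro mult_nonneg_nonpos) auto
          ultimately have "\<bar>1 / h * (exp (- (a * h)) - 1) + a\<bar> \<le> 2 * a" using a by linarith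
          then have *: "cmod (of_real (1 / h * (exp (- (a * h)) - 1) + a)) \<le> 2 * a" unfolding norm_of_real .
          have "((1 / h) *\<^sub>R (diag_semigroup h x - x) + diag_op x) i = of_real (1 / h * (exp (- (a * h)) - 1) + a) * x i"
            unfolding quot by (simp add: mult_op_apply diag_op_eq a_def algebra_simps)
          moreover have "cmod (diag_op x i) = a * cmod (x i)" by (simp add: diag_op_eq mult_op_apply norm_mult norm_power a_def)
          ultimately show "cmod (((1 / h) *\<^sub>R (diag_semigroup h x - x) + diag_op x) i) \<le> 2 * cmod (diag_op x i)"
            using mult_right_mono[OF *, of "cmod (x i)"] by (simp add: norm_mult mult.assoc)
        qed
      qed
      show "((\<lambda>h. ((1 / h) *\<^sub>R (diag_semigroup h x - x) + diag_op x) i) \<longlongrightarrow> 0) (at_right 0)" for i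
      proof -
        have "((1 / h) *\<^sub>R (diag_semigroup h x - x) + diag_op x) i
            = (of_real (1 / h) * (of_real (exp (- (2 ^ Suc (snd i) * h))) - 1) + 2 ^ Suc (snd i)) * x i" for h
          unfolding quot by (simp add: mult_op_apply diag_op_eq distrib_right)
        then show ?thesis using tendsto_mult_left_zero[OF lim] by (simp only:)
      qed
    qed
  qed
  have "x \<in> D" if x: "x \<in> V" and y: "y \<in> V"
    and l: "((\<lambda>h. nrm ((1 / h) *\<^sub>R (diag_semigroup h x - x) - y)) \<longlongrightarrow> 0) (at_right 0)" for x y
  proof -
    have "diag_op x i = - y i" for i
    proof -
      let ?f = "\<lambda>h. of_real (1 / h) * (of_real (exp (- (2 ^ Suc (snd i) * h))) - 1)"
      have inV: "(1 / h) *\<^sub>R (diag_semigroup h x - x) - y \<in> V" if "0 < h" for h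
      proof -
        have "diag_semigroup h x \<in> V"
          unfolding diag_semigroup_eq using that by (intro mult_op_bounded(1)[OF x, of _ 1]) auto
        then have "cscale (of_real (1 / h)) (diag_semigroup h x - x) \<in> V" using x by (intro cscale_in_lqr diff_in_lqr)
        moreover have "cscale (of_real (1 / h)) (diag_semigroup h x - x) = (1 / h) *\<^sub>R (diag_semigroup h x - x)"
          by (simp add: fun_eq_iff cscale_def scaleR_fun_def scaleR_conv_of_real)
        ultimately show ?thesis using y by (auto intro: diff_in_lqr)
      qed
      have "((\<lambda>h. ?f h * x i - y i) \<longlongrightarrow> 0) (at_right 0)"
      proof (rule Lim_null_comparison[OF _ l])
        show "\<forall>\<^sub>F h in at_right 0. cmod (?f h * x i - y i) \<le> nrm ((1 / h) *\<^sub>R (diag_semigroup h x - x) - y)"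
          using eventually_at_right_less
        proof eventually_elim
          case (elim h)
          have "?f h * x i - y i = ((1 / h) *\<^sub>R (diag_semigroup h x - x) - y) i"
            unfolding quot by (simp add: mult_op_apply)
          then show ?case using component_le_nrm[OF inV[OF elim]] by (simp only:)
        qed
      qed
      then have "((\<lambda>h. (?f h + 2 ^ Suc (snd i)) * x i - (?f h * x i - y i)) \<longlongrightarrow> 0 * x i - 0) (at_right 0)"
        by (intro tendsto_diff tendsto_mult lim tendsto_const)
      then have "((\<lambda>h::real. 2 ^ Suc (snd i) * x i + y i) \<longlongrightarrow> 0) (at_right 0)" by (simp add: algebra_simps)
      then have "2 ^ Suc (snd i) * x i + y i = 0" by (simp add: tendsto_const_iff)
      then show ?thesis by (simp add: diag_op_eq mult_op_apply eq_neg_iff_add_eq_0)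
    qed
    then have "diag_op x = - y" by (simp add: fun_eq_iff)
    then show ?thesis using x y uminus_in_lqr by (simp add: diag_dom_def)
  qed
  moreover have "\<exists>y\<in>V. ((\<lambda>h. nrm ((1 / h) *\<^sub>R (diag_semigroup h x - x) - y)) \<longlongrightarrow> 0) (at_right 0)" if x: "x \<in> D" for x
    using conv[OF x] x uminus_in_lqr[of "diag_op x"] by (intro bexI[of _ "- diag_op x"]) (auto simp: diag_dom_def)
  ultimately have "D = {x \<in> V. \<exists>y\<in>V. ((\<lambda>h. nrm ((1 / h) *\<^sub>R (diag_semigroup h x - x) - y)) \<longlongrightarrow> 0) (at_right 0)}"
    by (auto simp: diag_dom_def)
  with conv C0_semigroup_diag show ?thesis unfolding neg_generates_def by blast
qed


text \<open>
  At a point \<open>z\<close> with \<open>\<delta> = Re z / 2 > 0\<close> the factors \<open>exp (- (\<lambda> n * z))\<close> leave a decay \<open>exp (- (\<lambda> n * \<delta>))\<close> after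
  the growth of the difference quotient for \<open>cmod h < \<delta>\<close> is paid for. This absorbs the factor \<open>\<lambda> n\<close> uniformly
  in \<open>n\<close>.
\<close>

lemma analytic_semigroup_diag: "analytic_semigroup V nrm diag_semigroup"
  unfolding analytic_semigroup_def
proof (intro conjI C0_semigroup_diag exI[of _ "pi / 4"] ballI)
  show "0 < pi / 4" "pi / 4 < pi / 2" using pi_gt_zero by auto
  fix x assume x: "x \<in> V"
  let ?l = "\<lambda>n. 2 ^ Suc n :: complex"
  define F where "F = (\<lambda>z. mult_op (\<lambda>n. exp (- (?l n * z))) x)"
  have Re_pos: "0 < Re z" if "z \<in> sector (pi / 4)" for z
  proof -
    have "z \<noteq> 0" "\<bar>Im (Ln z)\<bar> < pi / 2" using that pi_gt_zero by (auto simp: sector_def Arg_eq_Im_Ln)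
    then show ?thesis using Re_Ln_pos_lt by blast
  qed
  have norm_exp: "cmod (exp (- (?l n * z))) = exp (- (2 ^ Suc n * Re z))" for n z
  proof -
    have "Re (?l n * z) = 2 ^ Suc n * Re z"
    proof -
      have "?l n = of_real (2 ^ Suc n)" by simp
      then show ?thesis by (simp only: times_complex.sel Re_complex_of_real Im_complex_of_real)
    qed
    then show ?thesis by (simp add: norm_exp_eq_Re)
  qed
  have FV: "F z \<in> V" if "0 < Re z" for z
    unfolding F_def by (rule mult_op_bounded(1)[OF x, where C = 1]) (use that in \<open>simp_all add: norm_exp del: power_Suc\<close>)
  show "\<exists>F. (\<forall>t>0. F (complex_of_real t) = diag_semigroup t x) \<and>
      (\<forall>z\<in>sector (pi / 4). F z \<in> V \<and>
         (\<exists>y\<in>V. ((\<lambda>h. nrm (cscale (1 / h) (F (z + h) - F z) - y)) \<longlongrightarrow> 0) (at 0))) \<and>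
      ((\<lambda>z. nrm (F z - x)) \<longlongrightarrow> 0) (at 0 within sector (pi / 4))"
  proof (intro exI[of _ F] conjI allI impI ballI)
    show "F (complex_of_real t) = diag_semigroup t x" for t
      by (simp add: F_def diag_semigroup_eq exp_of_real[symmetric])
    have "((\<lambda>z. nrm (mult_op (\<lambda>n. exp (- (?l n * z)) - 1) x)) \<longlongrightarrow> 0) (at 0 within sector (pi / 4))"
    proof (rule mult_op_tendsto_0[OF x, where C = 2])
      show "\<forall>\<^sub>F z in at 0 within sector (pi / 4). \<forall>n. cmod (exp (- (?l n * z)) - 1) \<le> 2"
        unfolding eventually_at_filter
      proof (intro always_eventually allI impI)
        fix z n assume "z \<in> sector (pi / 4)"
        then have "exp (- (2 ^ Suc n * Re z)) \<le> 1" using Re_pos[of z] by simp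
        then show "cmod (exp (- (?l n * z)) - 1) \<le> 2"
          using norm_triangle_ineq4[of "exp (- (?l n * z))" 1, unfolded norm_exp norm_one] by linarith
      qed
      show "((\<lambda>z. exp (- (?l n * z)) - 1) \<longlongrightarrow> 0) (at 0 within sector (pi / 4))" for n
      proof -
        have "((\<lambda>z. exp (- (?l n * z)) - 1) \<longlongrightarrow> exp (- (?l n * 0)) - 1) (at 0 within sector (pi / 4))"
          by (intro tendsto_intros)
        then show ?thesis by simp
      qed
    qed
    moreover have "F z - x = mult_op (\<lambda>n. exp (- (?l n * z)) - 1) x" for z
      by (simp add: F_def fun_eq_iff mult_op_apply left_diff_distrib)
    ultimately show "((\<lambda>z. nrm (F z - x)) \<longlongrightarrow> 0) (at 0 within sector (pi / 4))" by simp
    fix z assume "z \<in> sector (pi / 4)"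
    then have z: "0 < Re z" by (rule Re_pos)
    then show "F z \<in> V" by (rule FV)
    define \<delta> where "\<delta> = Re z / 2"
    have \<delta>: "0 < \<delta>" using z by (simp add: \<delta>_def)
    have decay: "2 ^ Suc n * exp (- (2 ^ Suc n * \<delta>)) \<le> 1 / \<delta>" for n
    proof -
      have "2 ^ Suc n * \<delta> \<le> exp (2 ^ Suc n * \<delta>)" using exp_ge_add_one_self[of "2 ^ Suc n * \<delta>"] by linarith
      then show ?thesis using \<delta> by (simp add: exp_minus field_simps)
    qed
    define a where "a = (\<lambda>n. - ?l n * exp (- (?l n * z)))"
    have norm_l: "cmod (?l n) = 2 ^ Suc n" for n by (simp add: norm_mult norm_power)
    have yV: "mult_op a x \<in> V"
    proof (rule mult_op_bounded(1)[OF x])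
      fix n
      have "cmod (a n) = 2 ^ Suc n * exp (- (2 ^ Suc n * Re z))"
        by (simp only: a_def norm_mult norm_minus_cancel norm_l norm_exp)
      also have "\<dots> \<le> 2 ^ Suc n * exp (- (2 ^ Suc n * \<delta>))"
        using z by (intro mult_left_mono) (auto simp: \<delta>_def)
      finally show "cmod (a n) \<le> 1 / \<delta>" using decay[of n] by linarith
    qed (use \<delta> in simp)
    have e: "cscale (1 / h) (F (z + h) - F z) - mult_op a x
        = mult_op (\<lambda>n. exp (- (?l n * z)) * ((1 / h) * (exp (- (?l n * h)) - 1) + ?l n)) x" for h
      by (simp add: F_def a_def fun_eq_iff mult_op_apply cscale_def distrib_left exp_add algebra_simps exp_diff exp_minus)
    have "((\<lambda>h. nrm (cscale (1 / h) (F (z + h) - F z) - mult_op a x)) \<longlongrightarrow> 0) (at 0)"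
      unfolding e
    proof (rule mult_op_tendsto_0[OF x, where C = "2 / \<delta>"])
      show "((\<lambda>h. exp (- (?l n * z)) * ((1 / h) * (exp (- (?l n * h)) - 1) + ?l n)) \<longlongrightarrow> 0) (at 0)" for n
        using tendsto_mult_right_zero[OF difference_quotient_exp_tendsto] .
      have "\<forall>\<^sub>F h in at 0. cmod h < \<delta>"
        using \<delta> by (auto simp: eventually_at intro!: exI[of _ \<delta>])
      moreover have "\<forall>\<^sub>F h in at 0. h \<noteq> (0::complex)" by (rule eventually_neq_at_within)
      ultimately show "\<forall>\<^sub>F h in at 0. \<forall>n. cmod (exp (- (?l n * z)) * ((1 / h) * (exp (- (?l n * h)) - 1) + ?l n)) \<le> 2 / \<delta>"
      proof eventually_elim
        case (elim h)
        show ?case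
        proof
          fix n
          define L where "L = (2::real) ^ Suc n"
          have L: "0 < L" by (simp add: L_def)
          have "cmod (exp (- (?l n * h)) - 1) \<le> L * cmod h * exp (L * cmod h)"
            using norm_exp_minus_1_le[of "- (?l n * h)"] by (simp only: norm_minus_cancel norm_mult norm_l L_def)
          also have "\<dots> \<le> L * cmod h * exp (L * \<delta>)"
            using L elim by (intro mult_left_mono) auto
          finally have "cmod ((1 / h) * (exp (- (?l n * h)) - 1)) \<le> L * exp (L * \<delta>)"
            using elim by (simp add: norm_mult norm_divide field_simps)
          then have "cmod ((1 / h) * (exp (- (?l n * h)) - 1) + ?l n) \<le> L * exp (L * \<delta>) + L"
            using norm_triangle_ineq[of "(1 / h) * (exp (- (?l n * h)) - 1)" "?l n"] norm_l[of n] unfolding L_def by linarith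
          also have "\<dots> \<le> 2 * (L * exp (L * \<delta>))" using L \<delta> by simp
          finally have "exp (- (L * Re z)) * cmod ((1 / h) * (exp (- (?l n * h)) - 1) + ?l n)
              \<le> exp (- (L * Re z)) * (2 * (L * exp (L * \<delta>)))" by (intro mult_left_mono) auto
          also have "\<dots> = 2 * (L * (exp (- (L * Re z)) * exp (L * \<delta>)))" by simp
          also have "exp (- (L * Re z)) * exp (L * \<delta>) = exp (- (L * \<delta>))"
            by (simp add: \<delta>_def flip: exp_add)
          also have "2 * (L * exp (- (L * \<delta>))) \<le> 2 * (1 / \<delta>)"
            using decay[of n] unfolding L_def by (intro mult_left_mono) auto
          finally show "cmod (exp (- (?l n * z)) * ((1 / h) * (exp (- (?l n * h)) - 1) + ?l n)) \<le> 2 / \<delta>"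
            unfolding norm_mult[of "exp _"] norm_exp L_def by simp
        qed
      qed
    qed
    with yV show "\<exists>y\<in>V. ((\<lambda>h. nrm (cscale (1 / h) (F (z + h) - F z) - y)) \<longlongrightarrow> 0) (at 0)" by blast
  qed
qed

end

section \<open>From integer kernels to convolutions on the half line\<close>

lemma pnorm_le_sum:
  assumes "\<And>i. i \<in> A \<Longrightarrow> 0 \<le> x i" "1 \<le> q"
  shows "pnorm q A x \<le> (\<Sum>i\<in>A. x i)"
proof (cases "finite A")
  case True
  define S where "S = (\<Sum>i\<in>A. x i)"
  have S: "0 \<le> S" "\<And>i. i \<in> A \<Longrightarrow> x i \<le> S"
    unfolding S_def using assms True by (auto intro: sum_nonneg member_le_sum)
  have "(\<Sum>i\<in>A. x i powr q) = (\<Sum>i\<in>A. x i * x i powr (q - 1))"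
    using assms by (intro sum.cong powr_eq_mult_powr) auto
  also have "\<dots> \<le> (\<Sum>i\<in>A. x i * S powr (q - 1))"
    using assms S by (intro sum_mono mult_left_mono powr_mono2) auto
  also have "\<dots> = S powr q" using S assms by (simp add: sum_distrib_right[symmetric] S_def[symmetric] powr_eq_mult_powr[of S q])
  finally have "pnorm q A x \<le> (S powr q) powr (1/q)" unfolding pnorm_def using assms by (intro powr_mono2 sum_nonneg) auto
  then show ?thesis using S assms by (simp add: powr_powr S_def)
qed (simp add: pnorm_def)

lemma borel_measurable_pnorm [measurable]:
  assumes "\<And>i. i \<in> A \<Longrightarrow> (\<lambda>t. h i t) \<in> borel_measurable M"
  shows "(\<lambda>t. pnorm q A (\<lambda>i. h i t)) \<in> borel_measurable M"
  unfolding pnorm_def using assms by measurable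

lemma borel_measurable_mnorm:
  assumes "\<And>i. (\<lambda>t. h t i) \<in> borel_measurable M"
  shows "(\<lambda>t. mnorm q r N (h t)) \<in> borel_measurable M"
  unfolding mnorm_def using assms by measurable

text \<open>
  Minkowski's integral inequality: pair the family of integrals with its own power \<open>q - 1\<close>, exchange sum
  and integral, and apply Hoelder's inequality under the integral.
\<close>

lemma Minkowski_pnorm_integral:
  assumes h: "\<And>i. i \<in> A \<Longrightarrow> integrable M (h i)" "\<And>i t. i \<in> A \<Longrightarrow> 0 \<le> h i t" and q: "1 \<le> q" and A: "finite A"
  shows "integrable M (\<lambda>t. pnorm q A (\<lambda>i. h i t))"
    and "pnorm q A (\<lambda>i. integral\<^sup>L M (h i)) \<le> (\<integral>t. pnorm q A (\<lambda>i. h i t) \<partial>M)"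
proof -
  show int: "integrable M (\<lambda>t. pnorm q A (\<lambda>i. h i t))"
  proof (rule Bochner_Integration.integrable_bound)
    show "integrable M (\<lambda>t. \<Sum>i\<in>A. h i t)" using h by (intro Bochner_Integration.integrable_sum) auto
    show "(\<lambda>t. pnorm q A (\<lambda>i. h i t)) \<in> borel_measurable M"
      using h by (intro borel_measurable_pnorm) auto
    show "AE t in M. norm (pnorm q A (\<lambda>i. h i t)) \<le> norm (\<Sum>i\<in>A. h i t)"
      using h q pnorm_le_sum[of A "\<lambda>i. h i _" q] by (auto simp: sum_nonneg)
  qed
  define v where "v = (\<lambda>i. integral\<^sup>L M (h i))"
  have v0: "0 \<le> v i" if "i \<in> A" for i unfolding v_def using h that by (intro Bochner_Integration.integral_nonneg) auto
  have "pnorm q A v powr q = (\<Sum>i\<in>A. v i * v i powr (q - 1))"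
    using q v0 by (subst pnorm_powr) (auto intro!: sum.cong powr_eq_mult_powr)
  also have "\<dots> = (\<Sum>i\<in>A. \<integral>t. h i t * v i powr (q - 1) \<partial>M)"
    by (simp add: v_def)
  also have "\<dots> = (\<integral>t. (\<Sum>i\<in>A. h i t * v i powr (q - 1)) \<partial>M)"
    using h by (intro Bochner_Integration.integral_sum[symmetric]) auto
  also have "\<dots> \<le> (\<integral>t. pnorm q A (\<lambda>i. h i t) * pnorm q A v powr (q - 1) \<partial>M)"
    using h v0 q A int by (intro integral_mono pnorm_Holder) auto
  also have "\<dots> = (\<integral>t. pnorm q A (\<lambda>i. h i t) \<partial>M) * pnorm q A v powr (q - 1)" by simp
  finally have *: "pnorm q A v * pnorm q A v powr (q - 1) \<le> (\<integral>t. pnorm q A (\<lambda>i. h i t) \<partial>M) * pnorm q A v powr (q - 1)"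
    using q powr_eq_mult_powr[of "pnorm q A v" q] by simp
  show "pnorm q A (\<lambda>i. integral\<^sup>L M (h i)) \<le> (\<integral>t. pnorm q A (\<lambda>i. h i t) \<partial>M)"
  proof (cases "pnorm q A v = 0")
    case True
    then show ?thesis using int by (simp add: v_def Bochner_Integration.integral_nonneg)
  next
    case False
    then have "0 < pnorm q A v powr (q - 1)" by simp
    with * show ?thesis by (simp add: v_def)
  qed
qed

lemma Minkowski_mnorm_integral:
  assumes h: "\<And>m n. m < N \<Longrightarrow> n < N \<Longrightarrow> integrable M (\<lambda>t. h t (m, n))" "\<And>i t. 0 \<le> h t i" and q: "1 \<le> q" "1 \<le> r"
  shows "integrable M (\<lambda>t. mnorm q r N (h t))"
    and "mnorm q r N (\<lambda>i. \<integral>t. h t i \<partial>M) \<le> (\<integral>t. mnorm q r N (h t) \<partial>M)"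
proof -
  have inner: "integrable M (\<lambda>t. pnorm r {..<N} (\<lambda>n. h t (m, n)))"
    "pnorm r {..<N} (\<lambda>n. \<integral>t. h t (m, n) \<partial>M) \<le> (\<integral>t. pnorm r {..<N} (\<lambda>n. h t (m, n)) \<partial>M)" if "m < N" for m
    using Minkowski_pnorm_integral[of "{..<N}" M "\<lambda>n t. h t (m, n)" r] h q that by auto
  show "integrable M (\<lambda>t. mnorm q r N (h t))"
    unfolding mnorm_def using Minkowski_pnorm_integral(1)[of "{..<N}" M "\<lambda>m t. pnorm r {..<N} (\<lambda>n. h t (m, n))" q] inner q
    by auto
  have "mnorm q r N (\<lambda>i. \<integral>t. h t i \<partial>M) \<le> pnorm q {..<N} (\<lambda>m. \<integral>t. pnorm r {..<N} (\<lambda>n. h t (m, n)) \<partial>M)"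
    unfolding mnorm_def using inner q by (intro pnorm_mono) auto
  also have "\<dots> \<le> (\<integral>t. mnorm q r N (h t) \<partial>M)"
    unfolding mnorm_def using Minkowski_pnorm_integral(2)[of "{..<N}" M "\<lambda>m t. pnorm r {..<N} (\<lambda>n. h t (m, n))" q] inner q
    by auto
  finally show "mnorm q r N (\<lambda>i. \<integral>t. h t i \<partial>M) \<le> (\<integral>t. mnorm q r N (h t) \<partial>M)" .
qed

lemma le_1_plus_powr: "0 \<le> x \<Longrightarrow> 1 \<le> p \<Longrightarrow> x \<le> 1 + x powr p" for x p :: real
proof (cases "x \<le> 1")
  case False
  assume "1 \<le> p"
  with False have "x powr 1 \<le> x powr p" by (intro powr_mono) auto
  with False show ?thesis by simp
qed (auto simp: add_increasing2)

text \<open>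
  Integrate the tangent inequality at the mean value; its linear part vanishes.
\<close>

lemma Jensen_powr:
  fixes h :: "'a \<Rightarrow> real"
  assumes "finite_measure M" and pos: "0 < measure M (space M)" and p: "1 \<le> p" and h0: "\<And>t. 0 \<le> h t"
    and h: "h \<in> borel_measurable M" and hp: "integrable M (\<lambda>t. h t powr p)"
  shows "integrable M h"
    and "measure M (space M) * ((\<integral>t. h t \<partial>M) / measure M (space M)) powr p \<le> (\<integral>t. h t powr p \<partial>M)"
proof -
  interpret finite_measure M by fact
  show int: "integrable M h"
  proof (rule Bochner_Integration.integrable_bound)
    show "integrable M (\<lambda>t. 1 + h t powr p)" using hp by simp
    show "AE t in M. norm (h t) \<le> norm (1 + h t powr p)" using h0 p by (simp add: le_1_plus_powr)
  qed (rule h)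
  define c where "c = measure M (space M)"
  define b where "b = (\<integral>t. h t \<partial>M) / c"
  have b: "0 \<le> b" using h0 by (simp add: b_def c_def)
  have "(\<integral>t. b powr p - h t powr p \<partial>M) \<le> (\<integral>t. p * b powr (p - 1) * (b - h t) \<partial>M)"
    using h0 p b int hp by (intro integral_mono powr_tangent_le) auto
  then have "c * b powr p - (\<integral>t. h t powr p \<partial>M) \<le> p * b powr (p - 1) * (c * b - (\<integral>t. h t \<partial>M))"
    using int hp by (simp add: c_def)
  also have "c * b - (\<integral>t. h t \<partial>M) = 0" using pos by (simp add: b_def c_def)
  finally show "measure M (space M) * ((\<integral>t. h t \<partial>M) / measure M (space M)) powr p \<le> (\<integral>t. h t powr p \<partial>M)"
    by (simp add: b_def c_def)
qed

abbreviation Lp_mass :: "real \<Rightarrow> real set \<Rightarrow> (real \<Rightarrow> real) \<Rightarrow> ennreal" where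
  "Lp_mass p A u \<equiv> \<integral>\<^sup>+t. ennreal (u t powr p) * indicator A t \<partial>lborel"

text \<open>
  The coordinates of \<open>A u\<close> for nonnegative data \<open>G\<close>.
\<close>

definition weighted_conv :: "(real \<Rightarrow> nat \<times> nat \<Rightarrow> real) \<Rightarrow> real \<Rightarrow> nat \<times> nat \<Rightarrow> real" where
  "weighted_conv G t = (\<lambda>(m, n). 2 ^ Suc n * (LBINT s:{0<..<t}. exp (- (2 ^ Suc n * (t - s))) * G s (m, n)))"

lemma weighted_conv_nonneg:
  assumes "\<And>s i. 0 \<le> G s i" shows "0 \<le> weighted_conv G t i"
  using assms by (auto simp: weighted_conv_def set_lebesgue_integral_def intro!: Bochner_Integration.integral_nonneg split: prod.split)

text \<open>
  The time interval \<open>{0..<2 ^ K}\<close> is cut into cells of length \<open>width = 2 powr (- N)\<close>. For \<open>n < N\<close> the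
  product \<open>2 ^ Suc n * width\<close> is at most \<open>1\<close>, so the \<open>n\<close>-th kernel varies by a factor of at most \<open>exp 1\<close> over
  one cell, and it becomes the integer kernel of scale \<open>N - Suc n\<close> acting on the means over the cells.
\<close>

context
  fixes p q r :: real and G :: "real \<Rightarrow> nat \<times> nat \<Rightarrow> real" and K N :: nat
  assumes adm: "admissible p q r"
    and G0: "\<And>s i. 0 \<le> G s i" and Gm: "\<And>i. (\<lambda>s. G s i) \<in> borel_measurable borel"
    and Gfin: "Lp_mass p {0..<2 ^ K} (\<lambda>s. mnorm q r N (G s)) < \<infinity>"
begin

lemma exponents_ge_1: "1 \<le> p" "1 \<le> q" "1 \<le> r"
  using adm by (auto simp: admissible_def)

lemma mnorm_G_measurable [measurable]: "(\<lambda>s. mnorm q r N (G s)) \<in> borel_measurable borel"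
  using Gm by (rule borel_measurable_mnorm)

definition width :: real where "width = 1 / 2 ^ N"
definition time_cell :: "nat \<Rightarrow> real set" where "time_cell y = {real y * width..<real (Suc y) * width}"
definition n_cells :: nat where "n_cells = 2 ^ (K + N)"
definition cell_mean :: "nat \<Rightarrow> nat \<times> nat \<Rightarrow> real" where
  "cell_mean y i = (LBINT s:time_cell y. G s i) / width"

lemma width_pos: "0 < width" by (simp add: width_def)

lemma time_cell_sets [measurable]: "time_cell y \<in> sets borel" by (simp add: time_cell_def)

lemma mem_time_cell_iff: "s \<in> time_cell y \<longleftrightarrow> 0 \<le> s \<and> nat \<lfloor>s / width\<rfloor> = y"
proof -
  have "s \<in> time_cell y \<longleftrightarrow> \<lfloor>s / width\<rfloor> = int y"
    using width_pos by (simp add: time_cell_def floor_eq_iff field_simps)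
  also have "\<dots> \<longleftrightarrow> 0 \<le> s \<and> nat \<lfloor>s / width\<rfloor> = y"
  proof -
    define k where "k = \<lfloor>s / width\<rfloor>"
    have "0 \<le> k \<longleftrightarrow> 0 \<le> s" using width_pos by (simp add: k_def zero_le_divide_iff)
    then show ?thesis unfolding k_def[symmetric] by auto
  qed
  finally show ?thesis .
qed

lemma time_cell_disjoint: "x \<noteq> y \<Longrightarrow> time_cell x \<inter> time_cell y = {}"
  by (auto simp: mem_time_cell_iff)

lemma Union_time_cell: "(\<Union>y<n_cells. time_cell y) = {0..<2 ^ K}"
proof -
  have "2 ^ K = real n_cells * width" by (simp add: n_cells_def width_def power_add)
  moreover have "s / width < real n_cells \<longleftrightarrow> nat \<lfloor>s / width\<rfloor> < n_cells" if "0 \<le> s" for s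
    using that width_pos by (metis floor_less_iff nat_less_iff of_int_of_nat_eq zero_le_floor divide_nonneg_pos)
  ultimately show ?thesis using width_pos by (auto simp: mem_time_cell_iff pos_divide_less_eq)
qed

lemma indicator_time_cells: "indicator {0..<2 ^ K} s = (\<Sum>y<n_cells. indicator (time_cell y) s :: ennreal)"
  unfolding Union_time_cell[symmetric]
  by (rule indicator_UN_disjoint) (auto simp: disjoint_family_on_def dest: time_cell_disjoint)

lemma time_cell_measure: "emeasure lborel (time_cell y) = ennreal width" "measure lborel (time_cell y) = width"
  using width_pos by (auto simp: time_cell_def algebra_simps)

text \<open>
  Passing to cell means does not increase the \<open>p\<close>-th power of the norm: Minkowski's integral inequality
  for the inner norms, Jensen's inequality for the power.
\<close>

lemma cell_mean_bound:
  assumes y: "y < n_cells"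
  shows "\<And>m n. m < N \<Longrightarrow> n < N \<Longrightarrow> set_integrable lborel (time_cell y) (\<lambda>s. G s (m, n))"
    and "ennreal (width * mnorm q r N (cell_mean y) powr p)
      \<le> Lp_mass p (time_cell y) (\<lambda>s. mnorm q r N (G s))"
proof -
  define M where "M = restrict_space lborel (time_cell y)"
  have M: "finite_measure M" "measure M (space M) = width"
  proof -
    have "emeasure M (space M) = ennreal width" by (simp add: M_def emeasure_restrict_space time_cell_measure space_restrict_space)
    then show "finite_measure M" "measure M (space M) = width" using width_pos by (auto intro!: finite_measureI simp: measure_def)
  qed
  have Gm': "(\<lambda>s. G s i) \<in> borel_measurable M" for i
    unfolding M_def using Gm[of i] by (intro measurable_restrict_space1) auto
  have "time_cell y \<subseteq> {0..<2 ^ K}" unfolding Union_time_cell[symmetric] using y by blast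
  then have le: "Lp_mass p (time_cell y) (\<lambda>s. mnorm q r N (G s))
      \<le> Lp_mass p {0..<2 ^ K} (\<lambda>s. mnorm q r N (G s))"
    by (intro nn_integral_mono mult_left_mono) (auto simp: indicator_def)
  have nn: "(\<integral>\<^sup>+s. ennreal (mnorm q r N (G s) powr p) \<partial>M)
      = Lp_mass p (time_cell y) (\<lambda>s. mnorm q r N (G s))"
    by (simp add: M_def nn_integral_restrict_space)
  have int_p: "integrable M (\<lambda>s. mnorm q r N (G s) powr p)"
  proof (rule integrableI_nonneg)
    show "(\<integral>\<^sup>+s. ennreal (mnorm q r N (G s) powr p) \<partial>M) < \<infinity>" unfolding nn using le Gfin by (rule order_le_less_trans)
  qed (use borel_measurable_mnorm[OF Gm'] in auto)
  note J = Jensen_powr[OF M(1) _ exponents_ge_1(1) mnorm_nonneg borel_measurable_mnorm[OF Gm'] int_p]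
  have int: "integrable M (\<lambda>s. G s (m, n))" if "m < N" "n < N" for m n
  proof (rule Bochner_Integration.integrable_bound[OF J(1)])
    show "AE s in M. norm (G s (m, n)) \<le> norm (mnorm q r N (G s))"
      using mnorm_component_le[of m N n "G _" q r] that G0 exponents_ge_1 by auto
  qed (use M width_pos Gm' in auto)
  then show "set_integrable lborel (time_cell y) (\<lambda>s. G s (m, n))" if "m < N" "n < N" for m n
    using that unfolding M_def set_integrable_def by (subst (asm) integrable_restrict_space) auto
  have cell_mean: "cell_mean y = (\<lambda>i. (1 / width) * (\<integral>s. G s i \<partial>M))"
    by (auto simp: cell_mean_def M_def set_lebesgue_integral_def integral_restrict_space fun_eq_iff)
  have "mnorm q r N (cell_mean y) = (1 / width) * mnorm q r N (\<lambda>i. \<integral>s. G s i \<partial>M)"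
    unfolding cell_mean using width_pos G0 exponents_ge_1 by (intro mnorm_scale Bochner_Integration.integral_nonneg) auto
  also have "\<dots> \<le> (1 / width) * (\<integral>s. mnorm q r N (G s) \<partial>M)"
    using int G0 exponents_ge_1 width_pos by (intro mult_left_mono Minkowski_mnorm_integral) auto
  finally have "width * mnorm q r N (cell_mean y) powr p \<le> width * ((\<integral>s. mnorm q r N (G s) \<partial>M) / width) powr p"
    using width_pos exponents_ge_1 by (intro mult_left_mono powr_mono2) auto
  also have "\<dots> \<le> (\<integral>s. mnorm q r N (G s) powr p \<partial>M)" using J(2) M width_pos by simp
  finally have "ennreal (width * mnorm q r N (cell_mean y) powr p) \<le> ennreal (\<integral>s. mnorm q r N (G s) powr p \<partial>M)"
    by (rule ennreal_leI)
  also have "\<dots> = (\<integral>\<^sup>+s. ennreal (mnorm q r N (G s) powr p) \<partial>M)"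
    using int_p by (intro nn_integral_eq_integral[symmetric]) auto
  finally show "ennreal (width * mnorm q r N (cell_mean y) powr p)
      \<le> Lp_mass p (time_cell y) (\<lambda>s. mnorm q r N (G s))" unfolding nn .
qed

lemma cell_mean_nonneg: "0 \<le> cell_mean y i"
  using width_pos G0 by (auto simp: cell_mean_def set_lebesgue_integral_def intro!: Bochner_Integration.integral_nonneg divide_nonneg_pos)

lemma weighted_conv_le_kernel:
  assumes t: "t \<in> time_cell x" and x: "x < n_cells" and mn: "m < N" "n < N"
  shows "weighted_conv G t (m, n) \<le> exp 1 * exp_kernel_sum n_cells (N - Suc n) (\<lambda>y. cell_mean y (m, n)) x"
proof -
  define L where "L = (2::real) ^ Suc n"
  define e where "e = (\<lambda>y. exp (- (L * width * \<bar>real x - real y\<bar>)))"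
  have L: "0 < L" by (simp add: L_def)
  have Lw: "L * width = 1 / 2 ^ (N - Suc n)"
  proof -
    have "(2::real) ^ N = 2 ^ Suc n * 2 ^ (N - Suc n)" using mn by (simp add: power_add[symmetric] del: power_Suc)
    then show ?thesis by (simp add: L_def width_def)
  qed
  then have Lw1: "L * width \<le> 1" by simp
  have t0: "0 \<le> t" "t < 2 ^ K" using t x Union_time_cell by (auto simp: set_eq_iff)
  have pt: "indicator {0<..<t} s * (exp (- (L * (t - s))) * G s (m, n))
      \<le> (\<Sum>y<n_cells. exp 1 * e y * (indicator (time_cell y) s * G s (m, n)))" for s
  proof (cases "s \<in> {0<..<t}")
    case True
    then have "s \<in> {0..<2 ^ K}" using t0 by auto
    then obtain y where y: "y < n_cells" "s \<in> time_cell y" unfolding Union_time_cell[symmetric] by blast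
    have "exp (- (L * (t - s))) \<le> exp 1 * e y"
    proof -
      have "real y * width \<le> s" "s < t" "t < real (Suc x) * width" "real x * width \<le> t" "s < real (Suc y) * width"
        using y t True by (auto simp: time_cell_def)
      then have "real y * width < real (Suc x) * width" by linarith
      then have "y \<le> x" using width_pos by (simp add: mult_less_cancel_right_pos)
      then have "L * (width * (real x - real y - 1)) \<le> L * (t - s)"
        using \<open>s < real (Suc y) * width\<close> \<open>real x * width \<le> t\<close> L by (intro mult_left_mono) (auto simp: algebra_simps)
      then have "L * width * \<bar>real x - real y\<bar> \<le> L * (t - s) + 1"
        using Lw1 \<open>y \<le> x\<close> by (simp add: algebra_simps)
      then show ?thesis unfolding e_def mult_exp_exp by simp
    qed
    then have "exp (- (L * (t - s))) * G s (m, n) \<le> exp 1 * e y * (indicator (time_cell y) s * G s (m, n))"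
      using y G0 by (simp add: mult_right_mono)
    also have "\<dots> \<le> (\<Sum>y<n_cells. exp 1 * e y * (indicator (time_cell y) s * G s (m, n)))"
      using y G0 by (intro member_le_sum[of y "{..<n_cells}" "\<lambda>y. exp 1 * e y * (indicator (time_cell y) s * G s (m, n))"]) (auto simp: e_def)
    finally show ?thesis using True by simp
  qed (auto intro!: sum_nonneg mult_nonneg_nonneg simp: G0 e_def)
  have int: "integrable lborel (\<lambda>s. indicator (time_cell y) s * G s (m, n))" if "y < n_cells" for y
    using cell_mean_bound(1)[OF that mn] by (simp add: set_integrable_def)
  have "(LBINT s:{0<..<t}. exp (- (L * (t - s))) * G s (m, n))
      \<le> (\<integral>s. (\<Sum>y<n_cells. exp 1 * e y * (indicator (time_cell y) s * G s (m, n))) \<partial>lborel)"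
    unfolding set_lebesgue_integral_def real_scaleR_def
  proof (rule integral_mono_AE)
    show i: "integrable lborel (\<lambda>s. \<Sum>y<n_cells. exp 1 * e y * (indicator (time_cell y) s * G s (m, n)))"
      using int by (intro Bochner_Integration.integrable_sum integrable_mult_right) auto
    have [measurable]: "(\<lambda>s. G s (m, n)) \<in> borel_measurable borel" by (rule Gm)
    show "integrable lborel (\<lambda>s. indicator {0<..<t} s * (exp (- (L * (t - s))) * G s (m, n)))"
      by (rule Bochner_Integration.integrable_bound[OF i]) (use pt G0 in \<open>auto intro!: AE_I2 simp: abs_mult order_trans[OF pt]\<close>)
  qed (use pt in auto)
  also have "\<dots> = (\<Sum>y<n_cells. exp 1 * e y * (\<integral>s. indicator (time_cell y) s * G s (m, n) \<partial>lborel))"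
    using int by (subst Bochner_Integration.integral_sum) auto
  also have "\<dots> = (\<Sum>y<n_cells. exp 1 * e y * (width * cell_mean y (m, n)))"
    using width_pos by (simp add: cell_mean_def set_lebesgue_integral_def)
  finally have "weighted_conv G t (m, n) \<le> L * (\<Sum>y<n_cells. exp 1 * e y * (width * cell_mean y (m, n)))"
    using L by (simp add: weighted_conv_def L_def del: power_Suc)
  also have "\<dots> = exp 1 * (\<Sum>y<n_cells. e y * (L * width) * cell_mean y (m, n))"
    by (simp add: sum_distrib_left mult_ac)
  also have "\<dots> = exp 1 * exp_kernel_sum n_cells (N - Suc n) (\<lambda>y. cell_mean y (m, n)) x"
    by (simp add: exp_kernel_sum_def e_def Lw)
  finally show ?thesis .
qed

lemma weighted_conv_estimate:
  "Lp_mass p {0..<2 ^ K} (\<lambda>t. mnorm q r N (weighted_conv G t))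
    \<le> ennreal (exp p * 64 powr p * mixed_const p q r)
      * Lp_mass p {0..<2 ^ K} (\<lambda>s. mnorm q r N (G s))"
proof -
  define k where "k = (\<lambda>x. mnorm q r N (\<lambda>(m, n). exp_kernel_sum n_cells (N - Suc n) (\<lambda>y. cell_mean y (m, n)) x))"
  have pt: "ennreal (mnorm q r N (weighted_conv G t) powr p) * indicator {0..<2 ^ K} t
      \<le> (\<Sum>x<n_cells. ennreal (exp p * k x powr p) * indicator (time_cell x) t)" for t
  proof (cases "t \<in> {0..<2 ^ K}")
    case True
    then obtain x where x: "x < n_cells" "t \<in> time_cell x" unfolding Union_time_cell[symmetric] by blast
    have "mnorm q r N (weighted_conv G t) \<le> mnorm q r N (\<lambda>i. exp 1 * (case i of (m, n) \<Rightarrow> exp_kernel_sum n_cells (N - Suc n) (\<lambda>y. cell_mean y (m, n)) x))"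
      using weighted_conv_le_kernel[OF x(2,1)] weighted_conv_nonneg G0 exponents_ge_1 by (intro mnorm_mono) auto
    also have "\<dots> = exp 1 * k x"
      unfolding k_def using exponents_ge_1 cell_mean_nonneg by (intro mnorm_scale) (auto simp: exp_kernel_sum_def intro!: sum_nonneg)
    finally have "mnorm q r N (weighted_conv G t) powr p \<le> (exp 1 * k x) powr p" using exponents_ge_1 by (intro powr_mono2) auto
    also have "\<dots> = exp p * k x powr p" by (simp add: powr_mult k_def exp_powr_real)
    finally have "ennreal (mnorm q r N (weighted_conv G t) powr p) * indicator {0..<2 ^ K} t
        \<le> ennreal (exp p * k x powr p) * indicator (time_cell x) t" using x True by (simp add: ennreal_leI)
    also have "\<dots> \<le> (\<Sum>x<n_cells. ennreal (exp p * k x powr p) * indicator (time_cell x) t)"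
      using x by (intro member_le_sum) auto
    finally show ?thesis .
  qed auto
  have "Lp_mass p {0..<2 ^ K} (\<lambda>t. mnorm q r N (weighted_conv G t))
      \<le> (\<integral>\<^sup>+t. (\<Sum>x<n_cells. ennreal (exp p * k x powr p) * indicator (time_cell x) t) \<partial>lborel)"
    using pt by (intro nn_integral_mono) auto
  also have "\<dots> = (\<Sum>x<n_cells. ennreal (exp p * k x powr p) * ennreal width)"
    by (subst nn_integral_sum) (simp_all add: nn_integral_cmult_indicator time_cell_measure)
  also have "\<dots> = ennreal (\<Sum>x<n_cells. exp p * k x powr p * width)"
    using width_pos by (subst sum_ennreal[symmetric]) (auto simp: ennreal_mult'' intro!: sum.cong)
  also have "\<dots> = ennreal (exp p * width * (\<Sum>x<n_cells. k x powr p))" by (simp add: sum_distrib_left mult_ac)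
  also have "\<dots> \<le> ennreal (exp p * width * (64 powr p * mixed_const p q r * (\<Sum>x<n_cells. mnorm q r N (cell_mean x) powr p)))"
    unfolding k_def using width_pos cell_mean_nonneg mixed_norm_exp_kernel[OF adm, of cell_mean N n_cells]
    by (intro ennreal_leI mult_left_mono) auto
  also have "\<dots> = ennreal (exp p * 64 powr p * mixed_const p q r) * (\<Sum>x<n_cells. ennreal (width * mnorm q r N (cell_mean x) powr p))"
    using width_pos mixed_const_nonneg
    by (subst sum_ennreal) (auto simp: ennreal_mult[symmetric] sum_nonneg sum_distrib_left mult_ac)
  also have "\<dots> \<le> ennreal (exp p * 64 powr p * mixed_const p q r)
      * (\<Sum>x<n_cells. \<integral>\<^sup>+s. ennreal (mnorm q r N (G s) powr p) * indicator (time_cell x) s \<partial>lborel)"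
    using cell_mean_bound(2) by (intro mult_left_mono sum_mono) auto
  also have "(\<Sum>x<n_cells. \<integral>\<^sup>+s. ennreal (mnorm q r N (G s) powr p) * indicator (time_cell x) s \<partial>lborel)
      = (\<integral>\<^sup>+s. (\<Sum>x<n_cells. ennreal (mnorm q r N (G s) powr p) * indicator (time_cell x) s) \<partial>lborel)"
    by (subst nn_integral_sum) auto
  also have "\<dots> = Lp_mass p {0..<2 ^ K} (\<lambda>s. mnorm q r N (G s))"
    unfolding indicator_time_cells sum_distrib_left ..
  finally show ?thesis .
qed

end

section \<open>Measurability and Bochner integrals are coordinatewise\<close>

context lqr
begin

lemma tn_measurable:
  assumes "\<And>i. (\<lambda>t. f t i) \<in> borel_measurable M"
  shows "(\<lambda>t. tn N (f t)) \<in> borel_measurable M"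
  unfolding trunc_norm_def using assms by (intro borel_measurable_mnorm) measurable

lemma nrm_measurable:
  assumes "\<And>i. (\<lambda>t. f t i) \<in> borel_measurable M"
  shows "(\<lambda>t. nrm (f t)) \<in> borel_measurable M"
  unfolding lqr_norm_def using assms by measurable

lemma lqr_space_measurable:
  assumes "\<And>i. (\<lambda>t. f t i) \<in> borel_measurable M"
  shows "{t \<in> space M. f t \<in> V} \<in> sets M"
proof -
  have "x \<in> V \<longleftrightarrow> (\<exists>B::nat. \<forall>N. tn N x \<le> real B)" for x
  proof
    assume "x \<in> V"
    then show "\<exists>B::nat. \<forall>N. tn N x \<le> real B"
      using tn_le_nrm real_arch_simple[of "nrm x"] by (meson order_trans)
  qed (auto intro: lqrI)
  moreover have "{t \<in> space M. \<exists>B::nat. \<forall>N. tn N (f t) \<le> real B} \<in> sets M"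
    using tn_measurable[OF assms] by measurable
  ultimately show ?thesis by simp
qed

lemma sum_fun_apply: "(\<Sum>j\<in>A. f j) i = (\<Sum>j\<in>A. f j i)"
  for f :: "'j \<Rightarrow> 'i \<Rightarrow> 'b :: comm_monoid_add"
  by (induction A rule: infinite_finite_induct) auto

text \<open>
  Coordinates are approximated separately, and only finitely many at a time. The factor \<open>2\<close> provides the
  domination for \<open>dominated_convergence_lqr\<close>.
\<close>

lemma simple_approximation:
  assumes f: "\<And>i. (\<lambda>t. f t i) \<in> borel_measurable M"
  obtains g :: "nat \<Rightarrow> 'a \<Rightarrow> dseq" where
    "\<And>k. simple_function M (g k)" "\<And>k t. g k t \<in> V"
    "\<And>k t i. t \<in> space M \<Longrightarrow> cmod (g k t i) \<le> 2 * cmod (f t i)"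
    "\<And>t i. t \<in> space M \<Longrightarrow> (\<lambda>k. g k t i) \<longlonglongrightarrow> f t i"
proof -
  have "\<forall>i. \<exists>s. (\<forall>k. simple_function M (s k)) \<and> (\<forall>t\<in>space M. (\<lambda>k. s k t) \<longlonglongrightarrow> f t i)
      \<and> (\<forall>k. \<forall>t\<in>space M. dist (s k t) 0 \<le> 2 * dist (f t i) 0)"
    using borel_measurable_implies_sequence_metric[OF f] by blast
  then obtain s where s: "\<And>i k. simple_function M (s i k)" "\<And>i t. t \<in> space M \<Longrightarrow> (\<lambda>k. s i k t) \<longlonglongrightarrow> f t i"
    "\<And>i k t. t \<in> space M \<Longrightarrow> cmod (s i k t) \<le> 2 * cmod (f t i)"
    unfolding dist_0_norm dist_commute[of _ 0] by metis
  define I where "I = (\<lambda>k::nat. {..<k} \<times> {..<k})"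
  define g where "g = (\<lambda>k t. \<Sum>j\<in>I k. (\<lambda>i. if i = j then s j k t else 0))"
  have g: "g k t i = (if i \<in> I k then s i k t else 0)" for k t i
    by (simp add: g_def sum_fun_apply I_def)
  show thesis
  proof
    show "simple_function M (g k)" for k
      unfolding g_def by (intro simple_function_sum simple_function_compose1[OF s(1)])
    show "g k t \<in> V" for k t by (rule finite_support_in_lqr[of k]) (auto simp: g I_def)
    show "cmod (g k t i) \<le> 2 * cmod (f t i)" if "t \<in> space M" for k t i using s(3)[OF that] by (simp add: g)
    show "(\<lambda>k. g k t i) \<longlonglongrightarrow> f t i" if "t \<in> space M" for t i
    proof (rule Lim_transform_eventually[OF s(2)[OF that]])
      show "\<forall>\<^sub>F k in sequentially. s i k t = g k t i"
        by (rule eventually_sequentiallyI[of "Suc (max (fst i) (snd i))"]) (auto simp: g I_def mem_Times_iff)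
    qed
  qed
qed

lemma simple_approximation_converges:
  assumes "x \<in> V" "\<And>k i. cmod (y k i) \<le> 2 * cmod (x i)" "\<And>i. (\<lambda>k. y k i) \<longlonglongrightarrow> x i"
  shows "(\<lambda>k. nrm (x - y k)) \<longlonglongrightarrow> 0" "nrm (x - y k) \<le> 3 * nrm x"
proof -
  have le: "cmod ((x - y k) i) \<le> 3 * cmod (x i)" for k i
    using norm_triangle_ineq4[of "x i" "y k i"] assms(2)[of k i] by simp
  show "nrm (x - y k) \<le> 3 * nrm x" by (rule lqr_dominated(2)[OF assms(1) le]) simp
  show "(\<lambda>k. nrm (x - y k)) \<longlonglongrightarrow> 0"
  proof (rule dominated_convergence_lqr[OF assms(1), where C = 3])
    show "(\<lambda>k. (x - y k) i) \<longlonglongrightarrow> 0" for i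
      using tendsto_diff[OF tendsto_const[of "x i"] assms(3)[of i]] by simp
  qed (use le in \<open>auto intro!: always_eventually\<close>)
qed

lemma strongly_measurableI:
  assumes f: "\<And>i. (\<lambda>t. f t i) \<in> borel_measurable M" and V: "AE t in M. f t \<in> V"
  shows "strongly_measurable V nrm M f"
proof -
  obtain g :: "nat \<Rightarrow> 'a \<Rightarrow> dseq" where g: "\<And>k. simple_function M (g k)" "\<And>k t. g k t \<in> V"
    "\<And>k t i. t \<in> space M \<Longrightarrow> cmod (g k t i) \<le> 2 * cmod (f t i)"
    "\<And>t i. t \<in> space M \<Longrightarrow> (\<lambda>k. g k t i) \<longlonglongrightarrow> f t i"
    using simple_approximation[of f M, OF f] by metis
  have conv: "(\<lambda>k. nrm (f t - g k t)) \<longlonglongrightarrow> 0" if "f t \<in> V" "t \<in> space M" for t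
    using simple_approximation_converges[of "f t" "\<lambda>k. g k t"] that g(3,4) by auto
  from V AE_space have "AE t in M. (\<lambda>k. nrm (f t - g k t)) \<longlonglongrightarrow> 0"
    by eventually_elim (rule conv)
  then show ?thesis unfolding strongly_measurable_def using V g(1,2) by blast
qed

lemma integral_in_lqr:
  assumes f: "\<And>i. (\<lambda>t. f t i) \<in> borel_measurable M" and V: "AE t in M. f t \<in> V"
    and int: "integrable M (\<lambda>t. nrm (f t))"
  shows "integrable M (\<lambda>t. f t i)" "(\<lambda>i. \<integral>t. f t i \<partial>M) \<in> V"
    and "nrm (\<lambda>i. \<integral>t. f t i \<partial>M) \<le> (\<integral>t. nrm (f t) \<partial>M)"
proof -
  have int_i: "integrable M (\<lambda>t. f t i)" for i
    by (rule Bochner_Integration.integrable_bound[OF int f], use V in eventually_elim) (simp add: component_le_nrm)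
  then show "integrable M (\<lambda>t. f t i)" .
  have "tn N (\<lambda>i. \<integral>t. f t i \<partial>M) \<le> (\<integral>t. nrm (f t) \<partial>M)" for N
  proof -
    have "tn N (\<lambda>i. \<integral>t. f t i \<partial>M) \<le> mnorm q r N (\<lambda>i. \<integral>t. cmod (f t i) \<partial>M)"
      unfolding trunc_norm_def using q1 r1 int_i by (intro mnorm_mono integral_norm_bound) auto
    also have "\<dots> \<le> (\<integral>t. tn N (f t) \<partial>M)"
      unfolding trunc_norm_def using q1 r1 int_i by (intro Minkowski_mnorm_integral(2)) auto
    also have "\<dots> \<le> (\<integral>t. nrm (f t) \<partial>M)"
    proof (rule integral_mono_AE[OF _ int])
      show "integrable M (\<lambda>t. tn N (f t))"
        unfolding trunc_norm_def using q1 r1 int_i by (intro Minkowski_mnorm_integral(1)) auto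
      show "AE t in M. tn N (f t) \<le> nrm (f t)" using V by eventually_elim (rule tn_le_nrm)
    qed
    finally show ?thesis .
  qed
  then show "(\<lambda>i. \<integral>t. f t i \<partial>M) \<in> V" "nrm (\<lambda>i. \<integral>t. f t i \<partial>M) \<le> (\<integral>t. nrm (f t) \<partial>M)"
    by (auto intro: lqrI nrm_leI)
qed

lemma scaleR_in_lqr: "x \<in> V \<Longrightarrow> c *\<^sub>R x \<in> V"
  by (rule lqr_dominated(1)[where C = "\<bar>c\<bar>"]) (auto simp: scaleR_fun_def)

lemma sum_in_lqr: "(\<And>j. j \<in> A \<Longrightarrow> f j \<in> V) \<Longrightarrow> (\<Sum>j\<in>A. f j) \<in> V"
  by (induction A rule: infinite_finite_induct) (auto intro: add_in_lqr simp: zero_in_lqr)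

lemma simple_bochner_integral_coordinate:
  assumes g: "Bochner_Integration.simple_bochner_integrable M (g :: 'a \<Rightarrow> dseq)"
  shows "Bochner_Integration.simple_bochner_integral M g i = (\<integral>t. g t i \<partial>M)" "integrable M (\<lambda>t. g t i)"
proof -
  have lin: "linear (\<lambda>x::dseq. x i)" by (rule linearI) (auto simp: scaleR_fun_def)
  have si: "Bochner_Integration.simple_bochner_integrable M (\<lambda>t. g t i)"
    using simple_bochner_integrable_compose2[of "\<lambda>x y. x i" M g g] g by simp
  show "Bochner_Integration.simple_bochner_integral M g i = (\<integral>t. g t i \<partial>M)"
    using simple_bochner_integral_linear[OF lin g] simple_bochner_integrable_eq_integral[OF si] by simp
  show "integrable M (\<lambda>t. g t i)"
    using has_bochner_integral_simple_bochner_integrable[OF si] by (rule integrable.intros)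
qed

lemma has_bochner_integral_in_coordinates:
  assumes "finite_measure M"
    and f: "\<And>i. (\<lambda>t. f t i) \<in> borel_measurable M" and V: "AE t in M. f t \<in> V"
    and int: "integrable M (\<lambda>t. nrm (f t))"
  shows "has_bochner_integral_in V nrm M f (\<lambda>i. \<integral>t. f t i \<partial>M)"
proof -
  interpret finite_measure M by fact
  obtain g :: "nat \<Rightarrow> 'a \<Rightarrow> dseq" where g: "\<And>k. simple_function M (g k)" "\<And>k t. g k t \<in> V"
    "\<And>k t i. t \<in> space M \<Longrightarrow> cmod (g k t i) \<le> 2 * cmod (f t i)"
    "\<And>t i. t \<in> space M \<Longrightarrow> (\<lambda>k. g k t i) \<longlonglongrightarrow> f t i"
    using simple_approximation[of f M, OF f] by metis
  have gs: "Bochner_Integration.simple_bochner_integrable M (g k)" for k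
    using g(1) by (intro simple_bochner_integrable.intros) auto
  have gm: "(\<lambda>t. g k t i) \<in> borel_measurable M" for k i
    using simple_bochner_integral_coordinate(2)[OF gs] by (rule borel_measurable_integrable)
  have dm: "(\<lambda>t. (f t - g k t) i) \<in> borel_measurable M" for k i using f gm by (simp add: fun_diff_def)
  have nm: "(\<lambda>t. nrm (f t - g k t)) \<in> borel_measurable M" for k using dm by (rule nrm_measurable)
  have conv: "(\<lambda>k. nrm (f t - g k t)) \<longlonglongrightarrow> 0" "nrm (f t - g k t) \<le> 3 * nrm (f t)"
    if "f t \<in> V" "t \<in> space M" for t k
    using simple_approximation_converges[of "f t" "\<lambda>k. g k t"] that g(3,4) by auto
  have bound: "AE t in M. nrm (f t - g k t) \<le> 3 * nrm (f t)" for k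
    using V AE_space by eventually_elim (rule conv(2))
  have "(\<lambda>k. \<integral>\<^sup>+t. ennreal (nrm (f t - g k t)) \<partial>M) \<longlonglongrightarrow> (\<integral>\<^sup>+t. 0 \<partial>M)"
  proof (rule nn_integral_dominated_convergence[where w = "\<lambda>t. ennreal (3 * nrm (f t))"])
    show "AE t in M. (\<lambda>k. ennreal (nrm (f t - g k t))) \<longlonglongrightarrow> 0"
      using V AE_space
      by eventually_elim (simp add: ennreal_tendsto_0_iff conv(1))
    show "AE t in M. ennreal (nrm (f t - g k t)) \<le> ennreal (3 * nrm (f t))" for k
      using bound[of k] by eventually_elim (rule ennreal_leI)
    show "(\<integral>\<^sup>+t. ennreal (3 * nrm (f t)) \<partial>M) < \<infinity>"
      using integrable_mult_right[OF int, of 3] by (subst nn_integral_eq_integral) auto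
  qed (use nm nrm_measurable[OF f] in auto)
  then have lim: "(\<lambda>k. \<integral>\<^sup>+t. ennreal (nrm (f t - g k t)) \<partial>M) \<longlonglongrightarrow> 0" by simp
  have dV: "AE t in M. f t - g k t \<in> V" for k using V by eventually_elim (rule diff_in_lqr[OF _ g(2)])
  have dint: "integrable M (\<lambda>t. nrm (f t - g k t))" for k
    by (rule Bochner_Integration.integrable_bound[OF integrable_mult_right[OF int, of 3] nm]) (use bound in auto)
  have le: "nrm ((\<lambda>i. \<integral>t. f t i \<partial>M) - Bochner_Integration.simple_bochner_integral M (g k)) \<le> (\<integral>t. nrm (f t - g k t) \<partial>M)" for k
  proof -
    have "(\<lambda>i. \<integral>t. f t i \<partial>M) - Bochner_Integration.simple_bochner_integral M (g k) = (\<lambda>i. \<integral>t. (f t - g k t) i \<partial>M)"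
      using integral_in_lqr(1)[OF f V int] simple_bochner_integral_coordinate[OF gs] by (simp add: fun_eq_iff)
    then show ?thesis using integral_in_lqr(3)[OF dm dV dint] by simp
  qed
  have "(\<lambda>k. ennreal (\<integral>t. nrm (f t - g k t) \<partial>M)) \<longlonglongrightarrow> 0"
    using lim by (subst nn_integral_eq_integral[symmetric]) (use dint in auto)
  then have "(\<lambda>k. \<integral>t. nrm (f t - g k t) \<partial>M) \<longlonglongrightarrow> 0" by (subst (asm) ennreal_tendsto_0_iff) auto
  then have "(\<lambda>k. nrm ((\<lambda>i. \<integral>t. f t i \<partial>M) - Bochner_Integration.simple_bochner_integral M (g k))) \<longlonglongrightarrow> 0"
    by (rule tendsto_sandwich[OF _ _ tendsto_const, rotated 2]) (use le in auto)
  with lim gs g(2) show ?thesis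
    unfolding has_bochner_integral_in_def using strongly_measurableI[OF f V] integral_in_lqr(2)[OF f V int] by blast
qed

text \<open>
  If simple functions approximate \<open>f\<close> in the mean, then their coordinates approximate the coordinates of
  \<open>f\<close> in the mean, since a coordinate is bounded by the norm.
\<close>

lemma has_bochner_integral_in_unique:
  assumes f: "\<And>i. (\<lambda>t. f t i) \<in> borel_measurable M" and V: "AE t in M. f t \<in> V"
    and int: "integrable M (\<lambda>t. nrm (f t))" and x: "has_bochner_integral_in V nrm M f x"
  shows "x = (\<lambda>i. \<integral>t. f t i \<partial>M)"
proof
  fix i
  obtain g :: "nat \<Rightarrow> 'a \<Rightarrow> dseq" where xV: "x \<in> V"
    and gs: "\<And>k. Bochner_Integration.simple_bochner_integrable M (g k)" and gV: "\<And>k. g k ` space M \<subseteq> V"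
    and l1: "(\<lambda>k. \<integral>\<^sup>+t. ennreal (nrm (f t - g k t)) \<partial>M) \<longlonglongrightarrow> 0"
    and l2: "(\<lambda>k. nrm (x - Bochner_Integration.simple_bochner_integral M (g k))) \<longlonglongrightarrow> 0"
    using x unfolding has_bochner_integral_in_def by blast
  let ?S = "\<lambda>k. Bochner_Integration.simple_bochner_integral M (g k)"
  have SV: "?S k \<in> V" for k
    unfolding Bochner_Integration.simple_bochner_integral_def using gV by (intro sum_in_lqr scaleR_in_lqr) auto
  have "(\<lambda>k. ?S k i) \<longlonglongrightarrow> x i"
  proof (rule LIM_zero_cancel, rule Lim_null_comparison[OF _ l2], intro always_eventually allI)
    fix k
    show "norm (?S k i - x i) \<le> nrm (x - ?S k)"
      using component_le_nrm[OF diff_in_lqr[OF xV SV[of k]], of i] by (simp add: norm_minus_commute)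
  qed
  moreover have "(\<lambda>k. ?S k i) \<longlonglongrightarrow> (\<integral>t. f t i \<partial>M)"
  proof -
    have le: "ennreal (norm (?S k i - (\<integral>t. f t i \<partial>M))) \<le> (\<integral>\<^sup>+t. ennreal (nrm (f t - g k t)) \<partial>M)" for k
    proof -
      have "?S k i - (\<integral>t. f t i \<partial>M) = (\<integral>t. g k t i - f t i \<partial>M)"
        using simple_bochner_integral_coordinate[OF gs] integral_in_lqr(1)[OF f V int] by simp
      then have "ennreal (norm (?S k i - (\<integral>t. f t i \<partial>M))) \<le> (\<integral>\<^sup>+t. ennreal (norm (g k t i - f t i)) \<partial>M)"
        using simple_bochner_integral_coordinate(2)[OF gs] integral_in_lqr(1)[OF f V int]
        by (simp only:) (intro integral_norm_bound_ennreal Bochner_Integration.integrable_diff)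
      also have "\<dots> \<le> (\<integral>\<^sup>+t. ennreal (nrm (f t - g k t)) \<partial>M)"
      proof (rule nn_integral_mono_AE, use V AE_space in eventually_elim)
        fix t assume "f t \<in> V" "t \<in> space M"
        then have "f t - g k t \<in> V" using gV by (intro diff_in_lqr) auto
        from component_le_nrm[OF this, of i]
        show "ennreal (norm (g k t i - f t i)) \<le> ennreal (nrm (f t - g k t))"
          by (intro ennreal_leI) (simp add: norm_minus_commute)
      qed
      finally show ?thesis .
    qed
    have "(\<lambda>k. ennreal (norm (?S k i - (\<integral>t. f t i \<partial>M)))) \<longlonglongrightarrow> 0"
      by (rule tendsto_sandwich[OF _ _ tendsto_const l1]) (use le in auto)
    then show ?thesis by (subst (asm) ennreal_tendsto_0_iff) (auto intro: LIM_zero_cancel tendsto_norm_zero_cancel)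
  qed
  ultimately show "x i = (\<integral>t. f t i \<partial>M)" by (rule LIMSEQ_unique)
qed

lemma bochner_integral_in_eq:
  assumes "finite_measure M" "\<And>i. (\<lambda>t. f t i) \<in> borel_measurable M" "AE t in M. f t \<in> V" "integrable M (\<lambda>t. nrm (f t))"
  shows "bochner_integral_in V nrm M f = (\<lambda>i. \<integral>t. f t i \<partial>M)"
  unfolding bochner_integral_in_def
  using has_bochner_integral_in_coordinates[OF assms] has_bochner_integral_in_unique[OF assms(2-4)] by (rule the_equality)

lemma bochner_integral_in_cong_AE:
  assumes eq: "AE t in M. f t = g t"
  shows "bochner_integral_in V nrm M f = bochner_integral_in V nrm M g"
proof -
  have *: "has_bochner_integral_in V nrm M f x \<longleftrightarrow> has_bochner_integral_in V nrm M g x" for x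
  proof -
    have "(\<integral>\<^sup>+t. ennreal (nrm (f t - h k t)) \<partial>M) = (\<integral>\<^sup>+t. ennreal (nrm (g t - h k t)) \<partial>M)" for h :: "nat \<Rightarrow> _" and k
      using eq by (intro nn_integral_cong_AE) auto
    moreover have "strongly_measurable V nrm M f \<longleftrightarrow> strongly_measurable V nrm M g"
    proof -
      have "(AE t in M. f t \<in> V) \<longleftrightarrow> (AE t in M. g t \<in> V)"
        by (rule eventually_subst, use eq in eventually_elim) simp
      moreover have "(AE t in M. (\<lambda>k. nrm (f t - h k t)) \<longlonglongrightarrow> 0) \<longleftrightarrow> (AE t in M. (\<lambda>k. nrm (g t - h k t)) \<longlonglongrightarrow> 0)" for h :: "nat \<Rightarrow> _"
        by (rule eventually_subst, use eq in eventually_elim) simp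
      ultimately show ?thesis by (simp add: strongly_measurable_def)
    qed
    ultimately show ?thesis by (simp add: has_bochner_integral_in_def)
  qed
  then show ?thesis by (simp add: bochner_integral_in_def)
qed

lemma borel_version_of_lebesgue:
  fixes f :: "real \<Rightarrow> complex"
  assumes "f \<in> borel_measurable lebesgue"
  obtains g where "g \<in> borel_measurable borel" "AE s in lebesgue. f s = g s"
proof -
  have "(\<lambda>s. Re (f s)) \<in> borel_measurable lebesgue" "(\<lambda>s. Im (f s)) \<in> borel_measurable lebesgue"
    using assms by measurable
  then obtain a b where ab: "a \<in> borel_measurable lborel" "AE s in lborel. Re (f s) = a s"
    "b \<in> borel_measurable lborel" "AE s in lborel. Im (f s) = b s"
    by (metis completion_ex_borel_measurable_real)
  show thesis
  proof
    show "(\<lambda>s. Complex (a s) (b s)) \<in> borel_measurable borel"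
      unfolding Complex_eq using ab by measurable
    show "AE s in lebesgue. f s = Complex (a s) (b s)"
      using AE_completion[OF ab(2)] AE_completion[OF ab(4)] by eventually_elim (simp add: complex_eq_iff)
  qed
qed

text \<open>
  Strong measurability with respect to the completed measure gives coordinates that are only Lebesgue
  measurable. A representative that is Borel measurable in each coordinate and lies in the space
  everywhere is needed for the joint measurability of the convolution integrand.
\<close>

lemma regular_representative:
  fixes f :: "real \<Rightarrow> dseq"
  assumes f: "strongly_measurable V nrm (lebesgue_on I) f" and I: "I \<in> sets borel"
  obtains F where "\<And>i. (\<lambda>s. F s i) \<in> borel_measurable borel" "\<And>s. F s \<in> V" "\<And>s. s \<notin> I \<Longrightarrow> F s = 0"
    "AE s in lebesgue_on I. f s = F s"
proof -
  have I': "I \<in> sets lebesgue" using I by simp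
  obtain g :: "nat \<Rightarrow> real \<Rightarrow> dseq" where fV: "AE s in lebesgue_on I. f s \<in> V"
    and g: "\<And>k. simple_function (lebesgue_on I) (g k)" "\<And>k. g k ` space (lebesgue_on I) \<subseteq> V"
    and lim: "AE s in lebesgue_on I. (\<lambda>k. nrm (f s - g k s)) \<longlonglongrightarrow> 0"
    using f unfolding strongly_measurable_def by blast
  have "\<exists>h. h \<in> borel_measurable borel \<and> (AE s in lebesgue_on I. f s i = h s)" for i
  proof -
    have gm: "(\<lambda>s. g k s i) \<in> borel_measurable (lebesgue_on I)" for k
      by (intro borel_measurable_simple_function simple_function_compose1[OF g(1)])
    define l where "l = (\<lambda>s. lim (\<lambda>k. g k s i))"
    have lm: "l \<in> borel_measurable (lebesgue_on I)"
      unfolding l_def by (rule borel_measurable_lim_metric[OF gm])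
    have fl: "AE s in lebesgue_on I. f s i = l s"
      using fV lim AE_space
    proof eventually_elim
      case (elim s)
      have "(\<lambda>k. g k s i) \<longlonglongrightarrow> f s i"
      proof (rule LIM_zero_cancel, rule Lim_null_comparison[OF _ elim(2)], intro always_eventually allI)
        fix k
        have "f s - g k s \<in> V" using elim g(2) by (intro diff_in_lqr) auto
        from component_le_nrm[OF this, of i]
        show "norm (g k s i - f s i) \<le> nrm (f s - g k s)" by (simp add: norm_minus_commute)
      qed
      then show ?case unfolding l_def by (rule limI[symmetric])
    qed
    obtain h where h: "h \<in> borel_measurable borel" "AE s in lebesgue. (if s \<in> I then l s else 0) = h s"
      by (rule borel_version_of_lebesgue[OF borel_measurable_if_I[OF lm I']])
    have "AE s in lebesgue. s \<in> I \<longrightarrow> l s = h s"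
      using h(2) by eventually_elim (simp split: if_split_asm)
    then have "AE s in lebesgue_on I. l s = h s"
      using I' by (simp add: AE_restrict_space_iff)
    then have "AE s in lebesgue_on I. f s i = h s"
      using fl AE_space by eventually_elim simp
    with h(1) show ?thesis by blast
  qed
  then obtain h where hm: "\<And>i. h i \<in> borel_measurable borel" and hf: "\<And>i. AE s in lebesgue_on I. f s i = h i s"
    by metis
  define A where "A = {s \<in> I. (\<lambda>i. h i s) \<in> V}"
  have A: "A \<in> sets borel"
  proof -
    have "{s \<in> space borel. (\<lambda>i. h i s) \<in> V} \<in> sets borel" using hm by (rule lqr_space_measurable)
    then have "I \<inter> {s \<in> space borel. (\<lambda>i. h i s) \<in> V} \<in> sets borel" using I by blast
    then show ?thesis by (simp add: A_def Int_def)
  qed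
  define F where "F = (\<lambda>s i. if s \<in> A then h i s else 0)"
  have F_if: "F s = (if s \<in> A then (\<lambda>i. h i s) else 0)" for s by (auto simp: F_def fun_eq_iff)
  show thesis
  proof
    show "(\<lambda>s. F s i) \<in> borel_measurable borel" for i
      unfolding F_def using hm A by (intro measurable_If_set) auto
    show "F s \<in> V" for s by (auto simp: F_if A_def zero_in_lqr)
    show "F s = 0" if "s \<notin> I" for s using that by (auto simp: F_if A_def)
    have "AE s in lebesgue_on I. \<forall>i. f s i = h i s"
      using hf by (simp add: AE_all_countable)
    then show "AE s in lebesgue_on I. f s = F s"
      using fV AE_space
    proof eventually_elim
      case (elim s)
      then have "f s = (\<lambda>i. h i s)" by (simp add: fun_eq_iff)
      with elim show ?case by (simp add: F_if A_def)
    qed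
  qed
qed

abbreviation mild where "mild \<equiv> mild_solution V nrm diag_semigroup"

abbreviation max_regularity where
  "max_regularity \<equiv> maximal_Lp_regularity V nrm D diag_op diag_semigroup"

text \<open>
  The Bochner integral sees \<open>f\<close> only up to null sets, so \<open>f\<close> can be replaced by \<open>F\<close>.
\<close>

lemma mild_solution_coordinates:
  assumes F: "\<And>i. (\<lambda>s. F s i) \<in> borel_measurable borel" "\<And>s. F s \<in> V"
    and fin: "(\<integral>\<^sup>+s. ennreal (nrm (F s)) * indicator {0<..<t} s \<partial>lborel) < \<infinity>"
    and eq: "AE s in lebesgue_on {0<..<t}. f s = F s"
  shows "mild f t
    = (\<lambda>(m, n). LBINT s:{0<..<t}. of_real (exp (- (2 ^ Suc n * (t - s)))) * F s (m, n))"
proof -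
  let ?M = "lebesgue_on {0<..<t}"
  let ?h = "\<lambda>s. diag_semigroup (t - s) (F s)"
  have Fm: "(\<lambda>s. F s i) \<in> borel_measurable ?M" for i
    using F(1) by (intro measurable_restrict_space1 measurable_completion) auto
  have hm: "(\<lambda>s. ?h s i) \<in> borel_measurable ?M" for i
  proof -
    have "(\<lambda>s. complex_of_real (exp (- (2 ^ Suc (snd i) * (t - s))))) \<in> borel_measurable ?M"
      by (intro measurable_restrict_space1 measurable_completion) measurable
    then show ?thesis unfolding diag_semigroup_eq mult_op_apply using Fm by (intro borel_measurable_times)
  qed
  have h: "?h s \<in> V \<and> nrm (?h s) \<le> nrm (F s)" if "s \<in> {0<..<t}" for s
    using mult_op_bounded[OF F(2)[of s], of "\<lambda>n. of_real (exp (- (2 ^ Suc n * (t - s))))" 1] that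
    by (simp add: diag_semigroup_eq)
  have hV: "AE s in ?M. ?h s \<in> V" using AE_space by eventually_elim (use h in auto)
  have int: "integrable ?M (\<lambda>s. nrm (F s))"
  proof (rule integrableI_nonneg)
    show "(\<lambda>s. nrm (F s)) \<in> borel_measurable ?M" using Fm by (rule nrm_measurable)
    show "(\<integral>\<^sup>+s. ennreal (nrm (F s)) \<partial>?M) < \<infinity>"
      using fin by (simp add: nn_integral_restrict_space nn_integral_completion)
  qed auto
  have hint: "integrable ?M (\<lambda>s. nrm (?h s))"
    by (rule Bochner_Integration.integrable_bound[OF int nrm_measurable[OF hm]], use AE_space in eventually_elim)
      (use h in auto)
  have "mild f t = bochner_integral_in V nrm ?M ?h"
    unfolding mild_solution_def by (rule bochner_integral_in_cong_AE, use eq in eventually_elim) simp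
  also have "\<dots> = (\<lambda>i. \<integral>s. ?h s i \<partial>?M)"
    by (rule bochner_integral_in_eq[OF _ hm hV hint]) (simp add: finite_measure_lebesgue_on)
  also have "\<dots> = (\<lambda>(m, n). LBINT s:{0<..<t}. of_real (exp (- (2 ^ Suc n * (t - s)))) * F s (m, n))"
  proof (rule ext, clarify)
    fix m n
    have "(\<integral>s. ?h s (m, n) \<partial>?M) = (\<integral>s. indicator {0<..<t} s *\<^sub>R ?h s (m, n) \<partial>lebesgue)"
      by (simp add: integral_restrict_space)
    also have "\<dots> = (\<integral>s. indicator {0<..<t} s *\<^sub>R ?h s (m, n) \<partial>lborel)"
      using F(1)[of "(m, n)"] by (intro integral_completion) (auto simp: diag_semigroup_def)
    finally show "(\<integral>s. ?h s (m, n) \<partial>?M) = (LBINT s:{0<..<t}. of_real (exp (- (2 ^ Suc n * (t - s)))) * F s (m, n))"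
      by (simp add: set_lebesgue_integral_def diag_semigroup_def)
  qed
  finally show ?thesis .
qed

end

section \<open>Maximal regularity\<close>

text \<open>
  The coordinates of the mild solution.
\<close>

definition causal_conv :: "(real \<Rightarrow> dseq) \<Rightarrow> real \<Rightarrow> dseq" where
  "causal_conv F t = (\<lambda>(m, n). LBINT s:{0<..<t}. of_real (exp (- (2 ^ Suc n * (t - s)))) * F s (m, n))"

definition initial_interval :: "real set \<Rightarrow> bool" where
  "initial_interval I \<longleftrightarrow> (\<exists>T>0. I = {0<..<T}) \<or> I = {0<..}"

lemma initial_intervalD:
  assumes "initial_interval I"
  shows "I \<in> sets borel" "I \<subseteq> {0<..}" "t \<in> I \<Longrightarrow> {0<..<t} \<subseteq> I"
  using assms unfolding initial_interval_def by auto

text \<open>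
  The indicator of \<open>{0<..<t}\<close> is written as a condition on the pair \<open>(t, s)\<close>, so that the integrand is
  jointly measurable and a parameter integral results.
\<close>

lemma causal_conv_measurable:
  assumes F: "\<And>i. (\<lambda>s. F s i) \<in> borel_measurable borel"
  shows "(\<lambda>t. causal_conv F t i) \<in> borel_measurable borel"
proof -
  obtain m n where i: "i = (m, n)" by (cases i)
  have "(\<lambda>t. \<integral>s. (if 0 < s \<and> s < t then of_real (exp (- (2 ^ Suc n * (t - s)))) * F s i else 0) \<partial>lborel) \<in> borel_measurable borel"
  proof (rule lborel.borel_measurable_lebesgue_integral)
    have [measurable]: "(\<lambda>s. F s i) \<in> borel_measurable borel" by (rule F)
    show "(\<lambda>(t, s). if 0 < s \<and> s < t then of_real (exp (- (2 ^ Suc n * (t - s)))) * F s i else 0)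
        \<in> borel_measurable (borel \<Otimes>\<^sub>M lborel)"
      by measurable
  qed
  moreover have "causal_conv F t i = (\<integral>s. (if 0 < s \<and> s < t then of_real (exp (- (2 ^ Suc n * (t - s)))) * F s i else 0) \<partial>lborel)" for t
    unfolding causal_conv_def i set_lebesgue_integral_def by (auto intro!: Bochner_Integration.integral_cong)
  ultimately show ?thesis by simp
qed

abbreviation Au :: "(real \<Rightarrow> dseq) \<Rightarrow> real \<Rightarrow> dseq" where
  "Au F t \<equiv> diag_op (causal_conv F t)"

lemma diag_op_causal_conv_measurable:
  assumes F: "\<And>i. (\<lambda>s. F s i) \<in> borel_measurable borel"
  shows "(\<lambda>t. Au F t i) \<in> borel_measurable borel"
  unfolding diag_op_eq mult_op_apply using causal_conv_measurable[OF F] by measurable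

lemma norm_diag_op_causal_conv_le:
  "cmod (Au F t i) \<le> weighted_conv (\<lambda>s i. cmod (F s i)) t i"
proof -
  obtain m n where i: "i = (m, n)" by (cases i)
  have "cmod (causal_conv F t i) \<le> (\<integral>s. cmod (indicator {0<..<t} s *\<^sub>R (of_real (exp (- (2 ^ Suc n * (t - s)))) * F s (m, n))) \<partial>lborel)"
    unfolding causal_conv_def i set_lebesgue_integral_def prod.case by (rule integral_norm_bound)
  also have "\<dots> = (LBINT s:{0<..<t}. exp (- (2 ^ Suc n * (t - s))) * cmod (F s (m, n)))"
    unfolding set_lebesgue_integral_def by (auto intro!: Bochner_Integration.integral_cong simp: norm_mult)
  finally have "2 ^ Suc n * cmod (causal_conv F t i) \<le> weighted_conv (\<lambda>s i. cmod (F s i)) t i"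
    by (simp add: weighted_conv_def i)
  then show ?thesis by (simp add: diag_op_eq mult_op_apply i norm_mult norm_power)
qed

context lqr
begin

lemma nn_integral_lebesgue_on:
  assumes "I \<in> sets borel"
  shows "(\<integral>\<^sup>+t. f t \<partial>lebesgue_on I) = (\<integral>\<^sup>+t. f t * indicator I t \<partial>lborel)"
  using assms by (simp add: nn_integral_restrict_space nn_integral_completion)

lemma AE_lebesgue_on:
  assumes "I \<in> sets borel"
  shows "(AE t in lebesgue_on I. P t) \<longleftrightarrow> (AE t in lborel. t \<in> I \<longrightarrow> P t)"
  using assms by (simp add: AE_restrict_space_iff AE_completion_iff)

lemma mild_solution_eq_causal_conv:
  assumes I: "initial_interval I" and p: "1 \<le> p"
    and F: "\<And>i. (\<lambda>s. F s i) \<in> borel_measurable borel" "\<And>s. F s \<in> V"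
    and fin: "Lp_mass p I (\<lambda>s. nrm (F s)) < \<infinity>"
    and eq: "AE s in lebesgue_on I. f s = F s" and t: "t \<in> I"
  shows "mild f t = causal_conv F t"
  unfolding causal_conv_def
proof (rule mild_solution_coordinates[OF F])
  note ID = initial_intervalD[OF I]
  have [measurable]: "(\<lambda>s. nrm (F s)) \<in> borel_measurable borel" using F(1) by (rule nrm_measurable)
  have [measurable]: "I \<in> sets borel" by (rule ID)
  have "(\<integral>\<^sup>+s. ennreal (nrm (F s)) * indicator {0<..<t} s \<partial>lborel)
      \<le> (\<integral>\<^sup>+s. indicator {0<..<t} s + ennreal (nrm (F s) powr p) * indicator I s \<partial>lborel)"
  proof (rule nn_integral_mono)
    fix s
    have "ennreal (nrm (F s)) \<le> 1 + ennreal (nrm (F s) powr p)"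
      using le_1_plus_powr[of "nrm (F s)" p] p by (metis ennreal_1 ennreal_leI ennreal_plus nrm_nonneg powr_ge_zero zero_le_one)
    then show "ennreal (nrm (F s)) * indicator {0<..<t} s \<le> indicator {0<..<t} s + ennreal (nrm (F s) powr p) * indicator I s"
      using ID(3)[OF t] by (auto split: split_indicator)
  qed
  also have "\<dots> = emeasure lborel {0<..<t} + Lp_mass p I (\<lambda>s. nrm (F s))"
    by (subst nn_integral_add) auto
  also have "\<dots> < \<infinity>" using fin t ID(2) by (auto simp: less_top)
  finally show "(\<integral>\<^sup>+s. ennreal (nrm (F s)) * indicator {0<..<t} s \<partial>lborel) < \<infinity>" .
  have "AE s in lborel. s \<in> I \<longrightarrow> f s = F s" using eq ID(1) by (simp add: AE_lebesgue_on)
  then have "AE s in lborel. s \<in> {0<..<t} \<longrightarrow> f s = F s"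
    by eventually_elim (use ID(3)[OF t] in blast)
  then show "AE s in lebesgue_on {0<..<t}. f s = F s" by (simp add: AE_lebesgue_on)
qed

text \<open>
  The index \<open>N\<close> is both the size of the truncation and the exponent of the time horizon \<open>2 ^ N\<close>. The bound of
  \<open>weighted_conv_estimate\<close> does not depend on \<open>N\<close>, and monotone convergence removes both restrictions at
  once. Finiteness of the supremum almost everywhere is what puts \<open>Au F t\<close> into the space.
\<close>

lemma Lp_bound:
  assumes adm: "admissible p q r" and F: "\<And>i. (\<lambda>s. F s i) \<in> borel_measurable borel" "\<And>s. F s \<in> V"
    and fin: "Lp_mass p {0..} (\<lambda>s. nrm (F s)) < \<infinity>"
  defines "c \<equiv> exp p * 64 powr p * mixed_const p q r"
  shows "AE t in lborel. 0 \<le> t \<longrightarrow> Au F t \<in> V"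
    and "Lp_mass p {0..} (\<lambda>t. nrm (Au F t))
      \<le> ennreal c * Lp_mass p {0..} (\<lambda>s. nrm (F s))"
proof -
  have p: "1 \<le> p" using adm by (auto simp: admissible_def)
  define W where "W = (\<lambda>t. Au F t)"
  define G where "G = (\<lambda>s i. cmod (F s i))"
  define \<Phi> where "\<Phi> = Lp_mass p {0..} (\<lambda>s. nrm (F s))"
  define h where "h = (\<lambda>N t. ennreal (tn N (W t) powr p) * indicator {0..<2 ^ N} t)"
  have Wm: "(\<lambda>t. W t i) \<in> borel_measurable borel" for i
    unfolding W_def by (rule diag_op_causal_conv_measurable[OF F(1)])
  have hm [measurable]: "h N \<in> borel_measurable lborel" for N
    unfolding h_def using tn_measurable[OF Wm] by measurable
  have h_le: "(\<integral>\<^sup>+t. h N t \<partial>lborel) \<le> ennreal c * \<Phi>" for N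
  proof -
    have G: "mnorm q r N (G s) \<le> nrm (F s)" for s
      using tn_le_nrm[OF F(2)] by (simp add: trunc_norm_def G_def)
    have Gle: "Lp_mass p {0..<2 ^ N} (\<lambda>s. mnorm q r N (G s)) \<le> \<Phi>"
      unfolding \<Phi>_def using G p
      by (intro nn_integral_mono) (auto split: split_indicator intro!: ennreal_leI powr_mono2)
    have "(\<integral>\<^sup>+t. h N t \<partial>lborel) \<le> Lp_mass p {0..<2 ^ N} (\<lambda>t. mnorm q r N (weighted_conv G t))"
    proof (rule nn_integral_mono)
      fix t
      have "tn N (W t) \<le> mnorm q r N (weighted_conv G t)"
        unfolding trunc_norm_def using q1 r1 norm_diag_op_causal_conv_le[of F t] by (intro mnorm_mono) (auto simp: W_def G_def)
      then show "h N t \<le> ennreal (mnorm q r N (weighted_conv G t) powr p) * indicator {0..<2 ^ N} t"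
        unfolding h_def using p by (intro mult_right_mono ennreal_leI powr_mono2) auto
    qed
    also have "\<dots> \<le> ennreal c * Lp_mass p {0..<2 ^ N} (\<lambda>s. mnorm q r N (G s))"
      unfolding c_def
    proof (rule weighted_conv_estimate[OF adm])
      show "(\<lambda>s. G s i) \<in> borel_measurable borel" for i unfolding G_def using F(1) by measurable
      show "Lp_mass p {0..<2 ^ N} (\<lambda>s. mnorm q r N (G s)) < \<infinity>"
        using Gle fin unfolding \<Phi>_def by (rule order_le_less_trans)
    qed (simp add: G_def)
    also have "\<dots> \<le> ennreal c * \<Phi>" by (intro mult_left_mono Gle) auto
    finally show ?thesis .
  qed
  define \<Psi> where "\<Psi> = (\<lambda>t. SUP N. h N t)"
  have \<Psi>_le: "(\<integral>\<^sup>+t. \<Psi> t \<partial>lborel) \<le> ennreal c * \<Phi>"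
  proof -
    have "incseq h"
    proof (rule incseq_SucI, rule le_funI)
      fix N t
      have "tn N (W t) powr p \<le> tn (Suc N) (W t) powr p" using p by (intro powr_mono2 tn_mono_dim) auto
      moreover have "(indicator {0..<2 ^ N} t :: ennreal) \<le> indicator {0..<2 ^ Suc N} t"
      proof -
        have "(2::real) ^ N \<le> 2 ^ Suc N" by simp
        then have "{0..<(2::real) ^ N} \<subseteq> {0..<2 ^ Suc N}" by (intro ivl_subset[THEN iffD2]) auto
        then show ?thesis by (auto simp: indicator_def)
      qed
      ultimately show "h N t \<le> h (Suc N) t" unfolding h_def by (intro mult_mono ennreal_leI) auto
    qed
    then have "(\<integral>\<^sup>+t. \<Psi> t \<partial>lborel) = (SUP N. \<integral>\<^sup>+t. h N t \<partial>lborel)"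
      unfolding \<Psi>_def by (intro nn_integral_monotone_convergence_SUP) auto
    also have "\<dots> \<le> ennreal c * \<Phi>" using h_le by (intro SUP_least)
    finally show ?thesis .
  qed
  have "ennreal c * \<Phi> < \<infinity>" using fin by (simp add: \<Phi>_def ennreal_mult_less_top)
  then have "(\<integral>\<^sup>+t. \<Psi> t \<partial>lborel) \<noteq> \<infinity>" using \<Psi>_le by (auto simp: top_unique)
  then have \<Psi>_fin: "AE t in lborel. \<Psi> t \<noteq> \<infinity>"
    unfolding \<Psi>_def by (intro nn_integral_PInf_AE) auto
  have W: "W t \<in> V" "ennreal (nrm (W t) powr p) \<le> \<Psi> t" if "\<Psi> t \<noteq> \<infinity>" "0 \<le> t" for t
  proof -
    obtain N0 where N0: "t < 2 ^ N0" using real_arch_pow[of 2 t] by auto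
    have le: "ennreal (tn N (W t) powr p) \<le> \<Psi> t" if "N0 \<le> N" for N
    proof -
      have "t < 2 ^ N" using N0 power_increasing[OF that, of "2::real"] by linarith
      then have "ennreal (tn N (W t) powr p) = h N t" using \<open>0 \<le> t\<close> by (simp add: h_def)
      also have "\<dots> \<le> \<Psi> t" unfolding \<Psi>_def by (intro SUP_upper) auto
      finally show ?thesis .
    qed
    define B where "B = enn2real (\<Psi> t)"
    have B: "\<Psi> t = ennreal B" "0 \<le> B" using that(1) by (auto simp: B_def less_top)
    have le': "tn N (W t) powr p \<le> B" if "N0 \<le> N" for N using le[OF that] B by simp
    have "tn N (W t) \<le> B powr (1/p)" for N
    proof -
      have "tn N (W t) \<le> tn (max N N0) (W t)" by (intro tn_mono_dim) auto
      also have "\<dots> = (tn (max N N0) (W t) powr p) powr (1/p)" using p by (simp add: powr_powr)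
      also have "\<dots> \<le> B powr (1/p)" using le'[of "max N N0"] p by (intro powr_mono2) auto
      finally show ?thesis .
    qed
    then show "W t \<in> V" "ennreal (nrm (W t) powr p) \<le> \<Psi> t"
    proof -
      assume b: "\<And>N. tn N (W t) \<le> B powr (1/p)"
      show "W t \<in> V" using b by (rule lqrI)
      have "nrm (W t) powr p \<le> (B powr (1/p)) powr p" using nrm_leI[OF b] p by (intro powr_mono2) auto
      then show "ennreal (nrm (W t) powr p) \<le> \<Psi> t" using B p by (simp add: powr_powr)
    qed
  qed
  show "AE t in lborel. 0 \<le> t \<longrightarrow> Au F t \<in> V"
    using \<Psi>_fin by eventually_elim (use W(1) in \<open>auto simp: W_def\<close>)
  have "Lp_mass p {0..} (\<lambda>t. nrm (W t)) \<le> (\<integral>\<^sup>+t. \<Psi> t \<partial>lborel)"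
    by (rule nn_integral_mono_AE, use \<Psi>_fin in eventually_elim) (use W in \<open>auto split: split_indicator\<close>)
  also note \<Psi>_le
  finally show "Lp_mass p {0..} (\<lambda>t. nrm (Au F t))
      \<le> ennreal c * Lp_mass p {0..} (\<lambda>s. nrm (F s))"
    by (simp add: W_def \<Phi>_def)
qed

theorem maximal_regularity_of_admissible:
  assumes adm: "admissible p q r" and I: "initial_interval I"
  shows "max_regularity p I"
  unfolding maximal_Lp_regularity_def
proof (intro conjI complex_banach_lqr densely_defined_diag sectorial_diag neg_generates_diag analytic_semigroup_diag)
  note ID = initial_intervalD[OF I]
  have p: "1 \<le> p" using adm by (auto simp: admissible_def)
  define c where "c = exp p * 64 powr p * mixed_const p q r"
  have c: "0 \<le> c" by (simp add: c_def mixed_const_nonneg)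
  have "(AE t in lebesgue_on I. mild f t \<in> D) \<and>
      (\<lambda>t. diag_op (mild f t)) \<in> Lp_space V nrm p (lebesgue_on I) \<and>
      Lp_norm nrm p (lebesgue_on I) (\<lambda>t. diag_op (mild f t))
        \<le> c powr (1/p) * Lp_norm nrm p (lebesgue_on I) f"
    if f: "f \<in> Lp_space V nrm p (lebesgue_on I)" for f
  proof -
    obtain F where F: "\<And>i. (\<lambda>s. F s i) \<in> borel_measurable borel" "\<And>s. F s \<in> V" "\<And>s. s \<notin> I \<Longrightarrow> F s = 0"
      and eq: "AE s in lebesgue_on I. f s = F s"
      using regular_representative[of I f] f ID(1) unfolding Lp_space_def by blast
    define \<Phi> where "\<Phi> = (\<integral>\<^sup>+s. ennreal (nrm (f s) powr p) \<partial>lebesgue_on I)"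
    have \<Phi>_fin: "\<Phi> < \<infinity>" using f by (simp add: \<Phi>_def Lp_space_def)
    have "\<Phi> = (\<integral>\<^sup>+s. ennreal (nrm (F s) powr p) \<partial>lebesgue_on I)"
      unfolding \<Phi>_def by (rule nn_integral_cong_AE, use eq in eventually_elim) simp
    then have \<Phi>_I: "\<Phi> = Lp_mass p I (\<lambda>s. nrm (F s))"
      using ID(1) by (simp add: nn_integral_lebesgue_on)
    also have "\<dots> = Lp_mass p {0..} (\<lambda>s. nrm (F s))"
      using F(3) ID(2) p by (intro nn_integral_cong) (auto split: split_indicator simp: nrm_zero)
    finally have \<Phi>_0: "\<Phi> = Lp_mass p {0..} (\<lambda>s. nrm (F s))" .
    note bound = Lp_bound[OF adm F(1,2) \<Phi>_fin[unfolded \<Phi>_0], folded c_def \<Phi>_0]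
    let ?u = "mild f"
    have u: "?u t = causal_conv F t" if "t \<in> I" for t
      using mild_solution_eq_causal_conv[OF I p F(1,2) \<Phi>_fin[unfolded \<Phi>_I] eq that] .
    have WV: "AE t in lebesgue_on I. diag_op (?u t) \<in> V"
      unfolding AE_lebesgue_on[OF ID(1)] using bound(1) by eventually_elim (use u ID(2) in auto)
    have le: "(\<integral>\<^sup>+t. ennreal (nrm (diag_op (?u t)) powr p) \<partial>lebesgue_on I) \<le> ennreal c * \<Phi>"
    proof -
      have "(\<integral>\<^sup>+t. ennreal (nrm (diag_op (?u t)) powr p) \<partial>lebesgue_on I)
          \<le> Lp_mass p {0..} (\<lambda>t. nrm (Au F t))"
        unfolding nn_integral_lebesgue_on[OF ID(1)] using u ID(2)
        by (intro nn_integral_mono) (auto split: split_indicator)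
      with bound(2) show ?thesis by simp
    qed
    show ?thesis
    proof (intro conjI)
      show "AE t in lebesgue_on I. ?u t \<in> D"
        using WV
      proof eventually_elim
        case (elim t)
        have "?u t \<in> V"
        proof (rule lqr_dominated(1)[OF elim, of _ 1])
          fix i :: "nat \<times> nat"
          have "(1::real) \<le> 2 ^ Suc (snd i)" by (rule one_le_power) simp
          then have "1 * cmod (?u t i) \<le> 2 ^ Suc (snd i) * cmod (?u t i)" by (rule mult_right_mono) simp
          then show "cmod (?u t i) \<le> 1 * cmod (diag_op (?u t) i)"
            by (simp add: diag_op_eq mult_op_apply norm_mult norm_power)
        qed simp
        then show ?case using elim by (simp add: diag_dom_def)
      qed
      have "strongly_measurable V nrm (lebesgue_on I) (\<lambda>t. diag_op (?u t))"
      proof (rule strongly_measurableI[OF _ WV])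
        fix i
        have "(\<lambda>t. Au F t i) \<in> borel_measurable (lebesgue_on I)"
          using diag_op_causal_conv_measurable[OF F(1)] by (intro measurable_restrict_space1 measurable_completion) auto
        then show "(\<lambda>t. diag_op (?u t) i) \<in> borel_measurable (lebesgue_on I)"
          by (rule measurable_cong[THEN iffD1, rotated]) (simp add: u)
      qed
      moreover have "(\<integral>\<^sup>+t. ennreal (nrm (diag_op (?u t)) powr p) \<partial>lebesgue_on I) < \<infinity>"
        using le \<Phi>_fin by (auto simp: ennreal_mult_less_top intro: order_le_less_trans)
      ultimately show "(\<lambda>t. diag_op (?u t)) \<in> Lp_space V nrm p (lebesgue_on I)" by (simp add: Lp_space_def)
      have "enn2real (\<integral>\<^sup>+t. ennreal (nrm (diag_op (?u t)) powr p) \<partial>lebesgue_on I) \<le> enn2real (ennreal c * \<Phi>)"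
        using le \<Phi>_fin by (intro enn2real_mono) (auto simp: ennreal_mult_less_top)
      also have "\<dots> = c * enn2real \<Phi>" using c by (simp add: enn2real_mult)
      finally have "Lp_norm nrm p (lebesgue_on I) (\<lambda>t. diag_op (?u t)) \<le> (c * enn2real \<Phi>) powr (1/p)"
        unfolding Lp_norm_def using p by (intro powr_mono2) auto
      also have "\<dots> = c powr (1/p) * Lp_norm nrm p (lebesgue_on I) f"
        using c by (simp add: Lp_norm_def \<Phi>_def powr_mult)
      finally show "Lp_norm nrm p (lebesgue_on I) (\<lambda>t. diag_op (?u t)) \<le> c powr (1/p) * Lp_norm nrm p (lebesgue_on I) f" .
    qed
  qed
  then show "\<exists>C. \<forall>f\<in>Lp_space V nrm p (lebesgue_on I).
      (AE t in lebesgue_on I. mild f t \<in> D) \<and>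
      (\<lambda>t. diag_op (mild f t)) \<in> Lp_space V nrm p (lebesgue_on I) \<and>
      Lp_norm nrm p (lebesgue_on I) (\<lambda>t. diag_op (mild f t))
        \<le> C * Lp_norm nrm p (lebesgue_on I) f" by blast
qed

end

section \<open>Failure of maximal regularity\<close>

text \<open>
  On the pulse the kernel is at least its value at the beginning \<open>a\<close> of the pulse.
\<close>

lemma causal_conv_indicator_ge:
  assumes F: "\<And>s. F s (m, n) = of_real (indicator {a..<b} s)" and ab: "0 \<le> a" "a < b" "b \<le> t"
  shows "2 ^ Suc n * (b - a) * exp (- (2 ^ Suc n * (t - a))) \<le> cmod (Au F t (m, n))"
proof -
  define L where "L = (2::real) ^ Suc n"
  have L: "0 < L" by (simp add: L_def)
  define h where "h = (\<lambda>s. indicator {0<..<t} s * (exp (- (L * (t - s))) * indicator {a..<b} s))"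
  have h0: "0 \<le> h s" for s by (simp add: h_def)
  have int: "integrable lborel h"
  proof (rule Bochner_Integration.integrable_bound)
    show "integrable lborel (indicator {a..<b} :: real \<Rightarrow> real)" using ab by simp
    show "h \<in> borel_measurable lborel" unfolding h_def by measurable
    show "AE s in lborel. norm (h s) \<le> norm (indicator {a..<b} s :: real)"
      using L by (intro AE_I2) (auto simp: h_def split: split_indicator)
  qed
  have "(b - a) * exp (- (L * (t - a))) = (\<integral>s. indicator {a<..<b} s * exp (- (L * (t - a))) \<partial>lborel)"
    using ab by simp
  also have "\<dots> \<le> (\<integral>s. h s \<partial>lborel)"
    using int ab L by (intro integral_mono) (auto simp: h_def split: split_indicator)
  finally have "(b - a) * exp (- (L * (t - a))) \<le> (\<integral>s. h s \<partial>lborel)" .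
  moreover have "causal_conv F t (m, n) = of_real (\<integral>s. h s \<partial>lborel)"
  proof -
    have "causal_conv F t (m, n) = (\<integral>s. of_real (h s) \<partial>lborel)"
      unfolding causal_conv_def set_lebesgue_integral_def prod.case
      by (intro Bochner_Integration.integral_cong refl) (simp add: F h_def L_def split: split_indicator)
    then show ?thesis by (simp only: integral_complex_of_real)
  qed
  ultimately have "(b - a) * exp (- (L * (t - a))) \<le> cmod (causal_conv F t (m, n))" by simp
  then have "L * ((b - a) * exp (- (L * (t - a)))) \<le> L * cmod (causal_conv F t (m, n))"
    using L by (intro mult_left_mono) auto
  then show ?thesis by (simp add: diag_op_def norm_mult norm_power L_def mult.assoc)
qed

lemma sublinear_growth_absurd:
  fixes a B \<theta> :: real
  assumes \<theta>: "\<theta> < 1" and le: "\<And>k::nat. real k \<le> a + B * real k powr \<theta>"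
  shows False
proof -
  have "(\<lambda>k. a * inverse (real k) + B * real k powr (\<theta> - 1)) \<longlonglongrightarrow> a * 0 + B * 0"
    using \<theta> by (intro tendsto_add tendsto_mult tendsto_const lim_inverse_n tendsto_neg_powr filterlim_real_sequentially) auto
  then have "\<forall>\<^sub>F k in sequentially. a * inverse (real k) + B * real k powr (\<theta> - 1) < 1"
    by (intro order_tendstoD(2)[of _ 0]) auto
  then obtain K where K: "\<And>k. K \<le> k \<Longrightarrow> a * inverse (real k) + B * real k powr (\<theta> - 1) < 1"
    by (auto simp: eventually_sequentially)
  define k where "k = Suc K"
  have "real k * (a * inverse (real k) + B * real k powr (\<theta> - 1)) < real k * 1"
    using K[of k] by (intro mult_strict_left_mono) (auto simp: k_def)
  moreover have "real k * (a * inverse (real k) + B * real k powr (\<theta> - 1)) = a + B * real k powr \<theta>"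
  proof -
    have "real k * inverse (real k) = 1" by (simp add: k_def)
    moreover have "real k * real k powr (\<theta> - 1) = real k powr \<theta>" by (simp add: k_def powr_diff)
    ultimately show ?thesis by (metis distrib_left mult.left_commute mult.right_neutral)
  qed
  ultimately show False using le[of k] by simp
qed

lemma dyadic_block_unique:
  fixes d a b :: nat
  assumes "2 ^ a \<le> d" "d < 2 ^ Suc a" "2 ^ b \<le> d" "d < 2 ^ Suc b"
  shows "a = b"
proof -
  have "False" if "d < 2 ^ Suc a" "2 ^ b \<le> d" "a < b" for a b
  proof -
    have "(2::nat) ^ Suc a \<le> 2 ^ b" using that by (intro power_increasing) auto
    with that show False by linarith
  qed
  then show ?thesis using assms by (metis linorder_neqE_nat)
qed

context lqr
begin

text \<open>
  What maximal regularity says about Borel representatives, with the norms replaced by their \<open>p\<close>-th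
  powers.
\<close>

definition convolution_bound :: "real \<Rightarrow> real set \<Rightarrow> real \<Rightarrow> bool" where
  "convolution_bound p I C \<longleftrightarrow> 0 \<le> C \<and>
     (\<forall>F. (\<forall>i. (\<lambda>s. F s i) \<in> borel_measurable borel) \<longrightarrow> (\<forall>s. F s \<in> V) \<longrightarrow>
       Lp_mass p I (\<lambda>s. nrm (F s)) < \<infinity> \<longrightarrow>
       (AE t in lborel. t \<in> I \<longrightarrow> Au F t \<in> V) \<and>
       Lp_mass p I (\<lambda>t. nrm (Au F t))
         \<le> ennreal C * Lp_mass p I (\<lambda>s. nrm (F s)))"

lemma convolution_boundD:
  assumes "convolution_bound p I C" "\<And>i. (\<lambda>s. F s i) \<in> borel_measurable borel" "\<And>s. F s \<in> V"
    "Lp_mass p I (\<lambda>s. nrm (F s)) < \<infinity>"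
  shows "AE t in lborel. t \<in> I \<longrightarrow> Au F t \<in> V"
    "Lp_mass p I (\<lambda>t. nrm (Au F t))
      \<le> ennreal C * Lp_mass p I (\<lambda>s. nrm (F s))"
  using assms unfolding convolution_bound_def by blast+

text \<open>
  Data of norm at most \<open>a\<close> on a time interval of length \<open>\<tau>\<close>, and zero elsewhere: the form in which both
  counterexamples violate the bound.
\<close>

lemma convolution_bound_pulse:
  assumes bound: "convolution_bound p I C" and p: "1 \<le> p"
    and F: "\<And>i. (\<lambda>s. F s i) \<in> borel_measurable borel" "\<And>s. F s \<in> V"
    and pulse: "\<And>s. nrm (F s) \<le> a * indicator {0..<\<tau>} s" and a: "0 \<le> a" "0 \<le> \<tau>"
  shows "AE t in lborel. t \<in> I \<longrightarrow> Au F t \<in> V"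
    "Lp_mass p I (\<lambda>t. nrm (Au F t)) \<le> ennreal (C * (a powr p * \<tau>))"
proof -
  have "Lp_mass p I (\<lambda>s. nrm (F s)) \<le> (\<integral>\<^sup>+s. ennreal (a powr p) * indicator {0..<\<tau>} s \<partial>lborel)"
  proof (rule nn_integral_mono)
    fix s
    have "nrm (F s) powr p \<le> (a * indicator {0..<\<tau>} s) powr p" using p by (intro powr_mono2 pulse) auto
    also have "\<dots> = a powr p * indicator {0..<\<tau>} s" using p by (auto split: split_indicator)
    finally have "ennreal (nrm (F s) powr p) \<le> ennreal (a powr p * indicator {0..<\<tau>} s)" by (rule ennreal_leI)
    then show "ennreal (nrm (F s) powr p) * indicator I s \<le> ennreal (a powr p) * indicator {0..<\<tau>} s"
      by (auto split: split_indicator split_indicator_asm)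
  qed
  also have "\<dots> = ennreal (a powr p * \<tau>)" using a by (simp add: nn_integral_cmult_indicator ennreal_mult)
  finally have mass: "Lp_mass p I (\<lambda>s. nrm (F s)) \<le> ennreal (a powr p * \<tau>)" .
  then have "Lp_mass p I (\<lambda>s. nrm (F s)) < \<infinity>" by (auto intro: order_le_less_trans)
  note b = convolution_boundD[OF bound F this]
  show "AE t in lborel. t \<in> I \<longrightarrow> Au F t \<in> V" by (rule b(1))
  have "ennreal C * Lp_mass p I (\<lambda>s. nrm (F s)) \<le> ennreal C * ennreal (a powr p * \<tau>)" by (intro mult_left_mono mass) auto
  also have "\<dots> = ennreal (C * (a powr p * \<tau>))" using bound a by (simp add: ennreal_mult convolution_bound_def)
  finally show "Lp_mass p I (\<lambda>t. nrm (Au F t)) \<le> ennreal (C * (a powr p * \<tau>))" using b(2) by (rule order_trans[rotated])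
qed

lemma convolution_bound_of_regularity:
  assumes max: "max_regularity p I" and p: "1 \<le> p" and I: "initial_interval I"
  obtains C where "convolution_bound p I C"
proof -
  note ID = initial_intervalD[OF I]
  obtain C where C: "\<And>f. f \<in> Lp_space V nrm p (lebesgue_on I) \<Longrightarrow>
      (\<lambda>t. diag_op (mild f t)) \<in> Lp_space V nrm p (lebesgue_on I) \<and>
      Lp_norm nrm p (lebesgue_on I) (\<lambda>t. diag_op (mild f t))
        \<le> C * Lp_norm nrm p (lebesgue_on I) f"
    using max unfolding maximal_Lp_regularity_def by blast
  show thesis
  proof (rule that[of "\<bar>C\<bar> powr p"], unfold convolution_bound_def, intro conjI[OF powr_ge_zero] allI impI)
    fix F :: "real \<Rightarrow> dseq"
    assume "\<forall>i. (\<lambda>s. F s i) \<in> borel_measurable borel" "\<forall>s. F s \<in> V"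
      and fin: "Lp_mass p I (\<lambda>s. nrm (F s)) < \<infinity>"
    then have F: "\<And>i. (\<lambda>s. F s i) \<in> borel_measurable borel" "\<And>s. F s \<in> V" by auto
    define Y where "Y = Lp_mass p I (\<lambda>s. nrm (F s))"
    define X where "X = Lp_mass p I (\<lambda>t. nrm (Au F t))"
    have Y: "(\<integral>\<^sup>+s. ennreal (nrm (F s) powr p) \<partial>lebesgue_on I) = Y"
      unfolding Y_def by (rule nn_integral_lebesgue_on[OF ID(1)])
    have "strongly_measurable V nrm (lebesgue_on I) F"
      using F by (intro strongly_measurableI measurable_restrict_space1 measurable_completion) auto
    then have "F \<in> Lp_space V nrm p (lebesgue_on I)" using fin by (simp add: Lp_space_def Y Y_def)
    note CF = C[OF this]
    have u: "mild F t = causal_conv F t" if "t \<in> I" for t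
      using mild_solution_eq_causal_conv[OF I p F fin _ that] by simp
    have WV: "AE t in lebesgue_on I. diag_op (mild F t) \<in> V"
      using CF unfolding Lp_space_def strongly_measurable_def by blast
    have X: "(\<integral>\<^sup>+t. ennreal (nrm (diag_op (mild F t)) powr p) \<partial>lebesgue_on I) = X"
      unfolding X_def nn_integral_lebesgue_on[OF ID(1)] using u by (intro nn_integral_cong) (auto split: split_indicator)
    have X_fin: "X < \<infinity>" using CF by (simp add: Lp_space_def X)
    have "enn2real X powr (1/p) \<le> C * enn2real Y powr (1/p)" using CF unfolding Lp_norm_def X Y by blast
    also have "\<dots> \<le> \<bar>C\<bar> * enn2real Y powr (1/p)" by (intro mult_right_mono) auto
    finally have "(enn2real X powr (1/p)) powr p \<le> (\<bar>C\<bar> * enn2real Y powr (1/p)) powr p"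
      using p by (intro powr_mono2) auto
    then have "enn2real X \<le> \<bar>C\<bar> powr p * enn2real Y" using p by (simp add: powr_mult powr_powr)
    then have "ennreal (enn2real X) \<le> ennreal (\<bar>C\<bar> powr p * enn2real Y)" by (rule ennreal_leI)
    then have "X \<le> ennreal (\<bar>C\<bar> powr p) * Y"
      using X_fin fin unfolding Y_def[symmetric] by (simp add: ennreal_mult infinity_ennreal_def)
    moreover have "AE t in lborel. t \<in> I \<longrightarrow> Au F t \<in> V"
      using WV unfolding AE_lebesgue_on[OF ID(1)] by eventually_elim (use u in auto)
    ultimately show "(AE t in lborel. t \<in> I \<longrightarrow> Au F t \<in> V)
      \<and> Lp_mass p I (\<lambda>t. nrm (Au F t))
          \<le> ennreal (\<bar>C\<bar> powr p) * Lp_mass p I (\<lambda>s. nrm (F s))"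
      by (simp add: X_def Y_def)
  qed
qed

lemma dyadic_initial_interval:
  assumes "initial_interval I"
  obtains k0 :: nat where "{0<..<1 / 2 ^ k0} \<subseteq> I"
proof (cases "I = {0<..}")
  case True
  then show ?thesis by (intro that[of 0]) auto
next
  case False
  then obtain T where T: "0 < T" "I = {0<..<T}" using assms by (auto simp: initial_interval_def)
  then obtain k0 where "(1/2) ^ k0 < T" using real_arch_pow_inv[of T "1/2"] by auto
  then show ?thesis using T by (intro that[of k0]) (auto simp: power_one_over)
qed

text \<open>
  The pulse has length \<open>\<epsilon> = 1 / 2 ^ k\<close> and sits in the entries \<open>(n, n)\<close> with \<open>n < k\<close>. On the time scale
  \<open>J n = {1 / 2 ^ Suc n..<1 / 2 ^ n}\<close> the entry \<open>(n, n)\<close> of \<open>Au F t\<close> alone is at least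
  \<open>c n = 2 ^ Suc n * \<epsilon> * exp (- 2)\<close>, so every scale contributes \<open>\<epsilon> * exp (- 2)\<close> to the integral of the norm.
  The scales \<open>n < k0\<close> are left out because they may reach beyond \<open>I\<close>.
\<close>

lemma not_maximal_L1_regularity:
  assumes q: "1 < q" and I: "initial_interval I"
  shows "\<not> max_regularity 1 I"
proof
  assume max: "max_regularity 1 I"
  obtain C where bound: "convolution_bound 1 I C" by (rule convolution_bound_of_regularity[OF max order_refl I])
  then have C: "0 \<le> C" by (simp add: convolution_bound_def)
  obtain k0 :: nat where k0: "{0<..<1 / 2 ^ k0} \<subseteq> I" using dyadic_initial_interval[OF I] .
  have "real k \<le> real k0 + exp 2 * C * real k powr (1/q)" for k
  proof (cases "k \<le> k0")
    case True
    then show ?thesis using C by (auto intro: add_increasing2)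
  next
    case False
    define \<epsilon> where "\<epsilon> = 1 / (2::real) ^ k"
    have \<epsilon>: "0 < \<epsilon>" by (simp add: \<epsilon>_def)
    define F :: "real \<Rightarrow> dseq" where "F = (\<lambda>s (m, n). if m = n \<and> n < k then of_real (indicator {0..<\<epsilon>} s) else 0)"
    have Fm: "(\<lambda>s. F s i) \<in> borel_measurable borel" for i by (cases i) (simp add: F_def)
    have FV: "F s \<in> V" for s by (rule finite_support_in_lqr[of k]) (auto simp: F_def)
    have F_norm: "nrm (F s) \<le> real k powr (1/q) * indicator {0..<\<epsilon>} s" for s
    proof (rule nrm_leI)
      fix N
      have row: "(\<Sum>n<N. cmod (F s (m, n)) powr r) powr (q / r) \<le> (if m < k then indicator {0..<\<epsilon>} s else 0)" for m
      proof -
        have "(\<Sum>n<N. cmod (F s (m, n)) powr r) \<le> (\<Sum>n<N. if n = m then (if m < k then indicator {0..<\<epsilon>} s else 0) else 0)"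
          using r1 by (intro sum_mono) (auto simp: F_def split: split_indicator)
        also have "\<dots> \<le> (if m < k then indicator {0..<\<epsilon>} s else 0)" by (simp add: sum.delta)
        finally have "(\<Sum>n<N. cmod (F s (m, n)) powr r) powr (q / r) \<le> (if m < k then indicator {0..<\<epsilon>} s else 0) powr (q / r)"
          using q r1 by (intro powr_mono2 sum_nonneg) auto
        then show ?thesis by (auto split: split_indicator_asm)
      qed
      have "(\<Sum>m<N. (\<Sum>n<N. cmod (F s (m, n)) powr r) powr (q / r)) \<le> (\<Sum>m<N. if m < k then indicator {0..<\<epsilon>} s else 0)"
        using row by (intro sum_mono)
      also have "\<dots> = (\<Sum>m\<in>{m \<in> {..<N}. m < k}. indicator {0..<\<epsilon>} s)" by (rule sum.inter_filter[symmetric]) simp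
      also have "\<dots> \<le> (\<Sum>m<k. indicator {0..<\<epsilon>} s)" by (intro sum_mono2) auto
      finally have "tn N (F s) \<le> (real k * indicator {0..<\<epsilon>} s) powr (1/q)"
        unfolding trunc_norm_def mnorm_altdef[OF r1] using q by (intro powr_mono2 sum_nonneg) auto
      then show "tn N (F s) \<le> real k powr (1/q) * indicator {0..<\<epsilon>} s" by (auto split: split_indicator_asm)
    qed
    note b = convolution_bound_pulse[OF bound order_refl Fm FV F_norm powr_ge_zero less_imp_le[OF \<epsilon>]]
    define J where "J = (\<lambda>n::nat. {1 / (2::real) ^ Suc n..<1 / 2 ^ n})"
    define c where "c = (\<lambda>n. 2 ^ Suc n * \<epsilon> * exp (- 2))"
    have J_disj: "n = n'" if "t \<in> J n" "t \<in> J n'" for t n n'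
    proof -
      have False if "t \<in> J n" "t \<in> J n'" "n < n'" for n n'
      proof -
        have "1 / (2::real) ^ n' \<le> 1 / 2 ^ Suc n" using that by (intro divide_left_mono power_increasing) auto
        then show False using that unfolding J_def atLeastLessThan_iff by linarith
      qed
      then show ?thesis using that by (metis linorder_neqE_nat)
    qed
    have "(\<Sum>n\<in>{k0..<k}. ennreal (\<epsilon> * exp (- 2))) = (\<Sum>n\<in>{k0..<k}. \<integral>\<^sup>+t. ennreal (c n) * indicator (J n) t \<partial>lborel)"
    proof (rule sum.cong[OF refl])
      fix n
      have "emeasure lborel (J n) = ennreal (1 / 2 ^ Suc n)" by (simp add: J_def field_simps)
      then have "(\<integral>\<^sup>+t. ennreal (c n) * indicator (J n) t \<partial>lborel) = ennreal (c n) * ennreal (1 / 2 ^ Suc n)"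
        by (subst nn_integral_cmult_indicator) (simp_all add: J_def del: power_Suc)
      also have "\<dots> = ennreal (c n * (1 / 2 ^ Suc n))"
        using \<epsilon> by (intro ennreal_mult[symmetric]) (auto simp: c_def)
      finally show "ennreal (\<epsilon> * exp (- 2)) = (\<integral>\<^sup>+t. ennreal (c n) * indicator (J n) t \<partial>lborel)" by (simp add: c_def)
    qed
    also have "\<dots> = (\<integral>\<^sup>+t. (\<Sum>n\<in>{k0..<k}. ennreal (c n) * indicator (J n) t) \<partial>lborel)"
      by (subst nn_integral_sum) (auto simp: J_def)
    also have "\<dots> \<le> Lp_mass 1 I (\<lambda>t. nrm (Au F t))"
    proof (rule nn_integral_mono_AE, use b(1) in eventually_elim)
      fix t assume V: "t \<in> I \<longrightarrow> Au F t \<in> V"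
      show "(\<Sum>n\<in>{k0..<k}. ennreal (c n) * indicator (J n) t) \<le> ennreal (nrm (Au F t) powr 1) * indicator I t"
      proof (cases "\<exists>n\<in>{k0..<k}. t \<in> J n")
        case True
        then obtain n where n: "k0 \<le> n" "n < k" and t: "1 / 2 ^ Suc n \<le> t" "t < 1 / 2 ^ n" by (auto simp: J_def)
        have "(0::real) < 1 / 2 ^ Suc n" by simp
        then have t0: "0 < t" using t by linarith
        have "1 / (2::real) ^ n \<le> 1 / 2 ^ k0" using n by (intro divide_left_mono power_increasing) auto
        then have tI: "t \<in> I" using k0 t t0 by auto
        have "\<epsilon> \<le> 1 / 2 ^ Suc n" unfolding \<epsilon>_def using n by (intro divide_left_mono power_increasing) auto
        then have "2 ^ Suc n * (\<epsilon> - 0) * exp (- (2 ^ Suc n * (t - 0))) \<le> cmod (Au F t (n, n))"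
          using n t \<epsilon> by (intro causal_conv_indicator_ge) (auto simp: F_def)
        moreover have "c n \<le> 2 ^ Suc n * (\<epsilon> - 0) * exp (- (2 ^ Suc n * (t - 0)))"
        proof -
          have "2 ^ Suc n * t \<le> 2" using t by (simp add: field_simps)
          then show ?thesis unfolding c_def using \<epsilon> by (intro mult_mono) auto
        qed
        moreover have "cmod (Au F t (n, n)) \<le> nrm (Au F t)"
          using V tI by (intro component_le_nrm) auto
        ultimately have "c n \<le> nrm (Au F t) powr 1" by simp
        moreover have "(\<Sum>n'\<in>{k0..<k}. ennreal (c n') * indicator (J n') t) = (\<Sum>n'\<in>{k0..<k}. if n' = n then ennreal (c n) else 0)"
        proof (rule sum.cong[OF refl])
          fix n'
          have "t \<in> J n" using t by (simp add: J_def)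
          then show "ennreal (c n') * indicator (J n') t = (if n' = n then ennreal (c n) else 0)"
            using J_disj[of t n n'] by (cases "t \<in> J n'") (simp_all, metis)
        qed
        ultimately show ?thesis using n tI by (simp add: ennreal_leI)
      next
        case False
        then have "(\<Sum>n\<in>{k0..<k}. ennreal (c n) * indicator (J n) t) = 0" by (intro sum.neutral) auto
        then show ?thesis by simp
      qed
    qed
    also have "\<dots> \<le> ennreal (C * (real k powr (1/q) * \<epsilon>))" using b(2) by simp
    also have "(\<Sum>n\<in>{k0..<k}. ennreal (\<epsilon> * exp (- 2))) = ennreal (real (k - k0) * (\<epsilon> * exp (- 2)))"
      using \<epsilon> by (simp add: ennreal_mult ennreal_of_nat_eq_real_of_nat)
    finally have "real (k - k0) * (\<epsilon> * exp (- 2)) \<le> C * (real k powr (1/q) * \<epsilon>)" using C \<epsilon> by simp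
    then have "\<epsilon> * (real (k - k0) * exp (- 2)) \<le> \<epsilon> * (C * real k powr (1/q))" by (simp add: mult_ac)
    then have "real (k - k0) * exp (- 2) \<le> C * real k powr (1/q)" using \<epsilon> by simp
    then have "exp 2 * (real (k - k0) * exp (- 2)) \<le> exp 2 * (C * real k powr (1/q))" by (intro mult_left_mono) auto
    moreover have "exp 2 * (real (k - k0) * exp (- 2)) = real (k - k0)" by (simp add: exp_minus)
    ultimately have "real (k - k0) \<le> exp 2 * C * real k powr (1/q)" by (simp add: mult.assoc)
    then show ?thesis using False by (simp add: of_nat_diff)
  qed
  then show False by (rule sublinear_growth_absurd[rotated]) (use q in simp)
qed

text \<open>
  The dyadic blocks of the scales \<open>k - Suc n\<close> are disjoint, and each of them contributes its cardinality
  times the lower bound, that is \<open>c\<close>.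
\<close>

lemma sum_over_dyadic_blocks_ge:
  fixes g :: "nat \<Rightarrow> real" and j k k0 :: nat
  assumes g0: "\<And>d. 0 \<le> g d" and c: "\<And>n d. k0 < n \<Longrightarrow> n < k \<Longrightarrow> 2 ^ (k - Suc n) \<le> d \<Longrightarrow> d < 2 ^ (k - n) \<Longrightarrow> c / 2 ^ (k - Suc n) \<le> g d"
    and j: "2 ^ (k - Suc k0) \<le> j"
  shows "real (k - Suc k0) * c \<le> (\<Sum>d\<in>{1..j}. g d)"
proof -
  define B where "B = (\<lambda>n. {2 ^ (k - Suc n)..<2 ^ (k - n) :: nat})"
  have k_n: "k - n = Suc (k - Suc n)" if "n < k" for n using that by simp
  have disj: "B n \<inter> B n' = {}" if "n \<in> {k0<..<k}" "n' \<in> {k0<..<k}" "n \<noteq> n'" for n n'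
  proof (rule ccontr)
    assume "B n \<inter> B n' \<noteq> {}"
    then obtain d where d: "d \<in> B n" "d \<in> B n'" by blast
    have "k - Suc n = k - Suc n'"
      using d that k_n[of n] k_n[of n'] by (intro dyadic_block_unique[of _ d]) (auto simp: B_def)
    then show False using that by auto
  qed
  have sub: "(\<Union>n\<in>{k0<..<k}. B n) \<subseteq> {1..j}"
  proof safe
    fix n d assume n: "n \<in> {k0<..<k}" and d: "d \<in> B n"
    have "(1::nat) \<le> 2 ^ (k - Suc n)" by simp
    then have "1 \<le> d" using d unfolding B_def atLeastLessThan_iff by linarith
    have "(2::nat) ^ (k - n) \<le> 2 ^ (k - Suc k0)" using n by (intro power_increasing) auto
    then have "d \<le> j" using d j unfolding B_def atLeastLessThan_iff by linarith
    with \<open>1 \<le> d\<close> show "d \<in> {1..j}" by simp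
  qed
  have "real (k - Suc k0) * c = (\<Sum>n\<in>{k0<..<k}. c)" by simp
  also have "\<dots> \<le> (\<Sum>n\<in>{k0<..<k}. \<Sum>d\<in>B n. g d)"
  proof (rule sum_mono)
    fix n assume n: "n \<in> {k0<..<k}"
    then have "card (B n) = 2 ^ (k - Suc n)" using k_n[of n] by (simp add: B_def)
    then have "c = (\<Sum>d\<in>B n. c / 2 ^ (k - Suc n))" by simp
    also have "\<dots> \<le> (\<Sum>d\<in>B n. g d)" using n by (intro sum_mono c) (auto simp: B_def)
    finally show "c \<le> (\<Sum>d\<in>B n. g d)" .
  qed
  also have "\<dots> = (\<Sum>d\<in>(\<Union>n\<in>{k0<..<k}. B n). g d)"
    using disj by (intro sum.UNION_disjoint[symmetric]) (auto simp: B_def)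
  also have "\<dots> \<le> (\<Sum>d\<in>{1..j}. g d)" using sub g0 by (intro sum_mono2) auto
  finally show ?thesis .
qed

text \<open>
  In row \<open>m\<close> the pulse occupies the \<open>m\<close>-th cell of length \<open>\<epsilon> = 1 / 2 ^ k\<close>, so at every time exactly one row is
  active. At a time \<open>t\<close> in cell \<open>j\<close>, row \<open>j - d\<close> was active \<open>d\<close> cells ago; if \<open>d\<close> lies in the dyadic block of
  scale \<open>k - Suc n\<close>, its entry \<open>n\<close> is still at least \<open>exp (- 2) / 2 ^ (k - Suc n)\<close>. The sum over the rows
  is a sum over \<open>d\<close>, and \<open>sum_over_dyadic_blocks_ge\<close> counts about \<open>k\<close> blocks. Times \<open>t \<ge> T / 2\<close> leave room
  for all blocks with \<open>n > k0\<close>.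
\<close>

lemma not_maximal_regularity_l1:
  assumes q: "q = 1" and r: "1 < r" and p: "1 \<le> p" and I: "initial_interval I"
  shows "\<not> max_regularity p I"
proof
  assume max: "max_regularity p I"
  obtain C where bound: "convolution_bound p I C" by (rule convolution_bound_of_regularity[OF max p I])
  then have C: "0 \<le> C" by (simp add: convolution_bound_def)
  obtain k0 :: nat where k0: "{0<..<1 / 2 ^ k0} \<subseteq> I" using dyadic_initial_interval[OF I] .
  define T where "T = 1 / (2::real) ^ k0"
  have T: "0 < T" by (simp add: T_def)
  have "real k \<le> real (Suc k0) + exp 2 * (2 * C) powr (1/p) * real k powr (1/r)" for k
  proof (cases "k \<le> Suc k0")
    case True
    then show ?thesis by (auto intro: add_increasing2)
  next
    case False
    define \<epsilon> where "\<epsilon> = 1 / (2::real) ^ k"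
    have \<epsilon>: "0 < \<epsilon>" by (simp add: \<epsilon>_def)
    define M where "M = (2::nat) ^ (k - k0)"
    have M\<epsilon>: "real M * \<epsilon> = T"
    proof -
      have "(2::real) ^ k = 2 ^ (k - k0) * 2 ^ k0" using False by (simp add: power_add[symmetric])
      then show ?thesis by (simp add: M_def \<epsilon>_def T_def)
    qed
    define F :: "real \<Rightarrow> dseq" where
      "F = (\<lambda>s (m, n). if m < M \<and> n < k then of_real (indicator {real m * \<epsilon>..<real (Suc m) * \<epsilon>} s) else 0)"
    have Fm: "(\<lambda>s. F s i) \<in> borel_measurable borel" for i by (cases i) (simp add: F_def)
    have FV: "F s \<in> V" for s by (rule finite_support_in_lqr[of "max M k"]) (auto simp: F_def)
    have F_nz: "m = nat \<lfloor>s / \<epsilon>\<rfloor> \<and> 0 \<le> s \<and> s < T" if "F s (m, n) \<noteq> 0" for s m n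
    proof -
      have s: "m < M" "real m * \<epsilon> \<le> s" "s < real (Suc m) * \<epsilon>" using that by (auto simp: F_def split: if_split_asm split_indicator_asm)
      then have "\<lfloor>s / \<epsilon>\<rfloor> = int m" using \<epsilon> by (simp add: floor_eq_iff field_simps)
      moreover have "real (Suc m) * \<epsilon> \<le> real M * \<epsilon>" using s(1) \<epsilon> by (intro mult_right_mono) auto
      moreover have "0 \<le> real m * \<epsilon>" using \<epsilon> by simp
      ultimately show ?thesis using s M\<epsilon> by auto
    qed
    have F_norm: "nrm (F s) \<le> real k powr (1/r) * indicator {0..<T} s" for s
    proof (rule nrm_leI)
      fix N
      have row: "(\<Sum>n<N. cmod (F s (m, n)) powr r) powr (q / r)
          \<le> (if m = nat \<lfloor>s / \<epsilon>\<rfloor> then real k powr (1 / r) * indicator {0..<T} s else 0)" for m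
      proof (cases "\<exists>n. F s (m, n) \<noteq> 0")
        case True
        then have m: "m = nat \<lfloor>s / \<epsilon>\<rfloor>" "s \<in> {0..<T}" using F_nz by auto
        have "(\<Sum>n<N. cmod (F s (m, n)) powr r) \<le> (\<Sum>n<N. if n < k then 1 else 0)"
          using r by (intro sum_mono) (auto simp: F_def split: split_indicator)
        also have "\<dots> = (\<Sum>n\<in>{n \<in> {..<N}. n < k}. 1)" by (rule sum.inter_filter[symmetric]) simp
        also have "\<dots> \<le> (\<Sum>n<k. 1)" by (intro sum_mono2) auto
        finally have "(\<Sum>n<N. cmod (F s (m, n)) powr r) powr (1 / r) \<le> real k powr (1 / r)"
          using r by (intro powr_mono2 sum_nonneg) auto
        then show ?thesis using m q by simp
      next
        case False
        then show ?thesis using r by (simp add: q)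
      qed
      have "(\<Sum>m<N. (\<Sum>n<N. cmod (F s (m, n)) powr r) powr (q / r))
          \<le> (\<Sum>m<N. if m = nat \<lfloor>s / \<epsilon>\<rfloor> then real k powr (1 / r) * indicator {0..<T} s else 0)"
        using row by (intro sum_mono)
      also have "\<dots> \<le> real k powr (1/r) * indicator {0..<T} s" by (simp add: sum.delta)
      finally show "tn N (F s) \<le> real k powr (1/r) * indicator {0..<T} s"
        unfolding trunc_norm_def mnorm_altdef[OF r1] by (simp add: q sum_nonneg)
    qed
    define y where "y = real k powr (p / r)"
    have T_nn: "0 \<le> T" using T by simp
    note b = convolution_bound_pulse[OF bound p Fm FV F_norm powr_ge_zero T_nn]
    define x where "x = real (k - Suc k0) * exp (- 2)"
    have x0: "0 \<le> x" by (simp add: x_def)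
    have lower: "x \<le> nrm (Au F t)"
      if WV: "Au F t \<in> V" and t: "T / 2 \<le> t" "t < T" for t
    proof -
      define W where "W = Au F t"
      define j where "j = nat \<lfloor>t / \<epsilon>\<rfloor>"
      have t0: "0 < t" using t T by linarith
      have j: "real j * \<epsilon> \<le> t" "t < real (Suc j) * \<epsilon>"
      proof -
        have "real j \<le> t / \<epsilon>" "t / \<epsilon> < real j + 1" using t0 \<epsilon> by (auto simp: j_def of_nat_nat)
        then show "real j * \<epsilon> \<le> t" "t < real (Suc j) * \<epsilon>" using \<epsilon> by (auto simp: field_simps)
      qed
      have jM: "j < M"
      proof -
        have "real j * \<epsilon> < real M * \<epsilon>" using j(1) t(2) M\<epsilon> by linarith
        then show ?thesis using \<epsilon> by simp
      qed
      have j_ge: "2 ^ (k - Suc k0) \<le> j"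
      proof -
        have "k - k0 = Suc (k - Suc k0)" using False by simp
        then have "T / 2 = real (2 ^ (k - Suc k0)) * \<epsilon>" using M\<epsilon> by (simp add: M_def)
        then have "real (2 ^ (k - Suc k0)) * \<epsilon> < real (Suc j) * \<epsilon>" using t j(2) by linarith
        then have "real (2 ^ (k - Suc k0)) < real (Suc j)" using \<epsilon> by (simp only: mult_less_cancel_right_pos)
        then show ?thesis unfolding of_nat_less_iff by simp
      qed
      define g where "g = (\<lambda>d. pnorm r {..<M + k} (\<lambda>n. cmod (W (j - d, n))))"
      have "x \<le> (\<Sum>d\<in>{1..j}. g d)"
        unfolding x_def
      proof (rule sum_over_dyadic_blocks_ge[OF _ _ j_ge])
        show "0 \<le> g d" for d by (simp add: g_def)
        fix n d assume n: "k0 < n" "n < k" and d: "2 ^ (k - Suc n) \<le> d" "d < (2::nat) ^ (k - n)"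
        have "(2::nat) ^ (k - n) \<le> 2 ^ (k - Suc k0)" using n by (intro power_increasing) auto
        then have dj: "d \<le> j" using d j_ge by linarith
        have "(1::nat) \<le> 2 ^ (k - Suc n)" by simp
        then have d1: "1 \<le> d" using d by linarith
        define m where "m = j - d"
        have m: "m < M" "real m = real j - real d" using jM dj d1 by (auto simp: m_def of_nat_diff)
        have L\<epsilon>: "2 ^ Suc n * \<epsilon> = 1 / 2 ^ (k - Suc n)"
        proof -
          have "(2::real) ^ k = 2 ^ Suc n * 2 ^ (k - Suc n)" using n by (simp add: power_add[symmetric] del: power_Suc)
          then show ?thesis by (simp add: \<epsilon>_def)
        qed
        have "1 / 2 ^ (k - Suc n) * exp (- 2) \<le> 2 ^ Suc n * (real (Suc m) * \<epsilon> - real m * \<epsilon>) * exp (- (2 ^ Suc n * (t - real m * \<epsilon>)))"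
        proof (rule mult_mono)
          show "1 / 2 ^ (k - Suc n) \<le> 2 ^ Suc n * (real (Suc m) * \<epsilon> - real m * \<epsilon>)"
            using L\<epsilon> by (simp add: algebra_simps)
          have "t - real m * \<epsilon> \<le> real (Suc d) * \<epsilon>" using j(2) by (simp add: m(2) algebra_simps)
          then have "2 ^ Suc n * (t - real m * \<epsilon>) \<le> 2 ^ Suc n * (real (Suc d) * \<epsilon>)" by (intro mult_left_mono) auto
          also have "\<dots> = real (Suc d) * (1 / 2 ^ (k - Suc n))" using L\<epsilon> by (simp only: mult.left_commute)
          also have "\<dots> \<le> real (2 ^ (k - n)) * (1 / 2 ^ (k - Suc n))"
            using d by (intro mult_right_mono) (auto simp only: of_nat_le_iff Suc_le_eq, simp)
          also have "\<dots> = 2"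
          proof -
            have "k - n = Suc (k - Suc n)" using n by simp
            then show ?thesis by simp
          qed
          finally show "exp (- 2) \<le> exp (- (2 ^ Suc n * (t - real m * \<epsilon>)))" by simp
        qed (use \<epsilon> in auto)
        also have "\<dots> \<le> cmod (W (m, n))"
          unfolding W_def
        proof (rule causal_conv_indicator_ge)
          show "F s (m, n) = of_real (indicator {real m * \<epsilon>..<real (Suc m) * \<epsilon>} s)" for s
            using m n by (simp add: F_def)
          have "real (Suc m) * \<epsilon> \<le> real j * \<epsilon>" using d1 m \<epsilon> by (intro mult_right_mono) auto
          then show "real (Suc m) * \<epsilon> \<le> t" using j by linarith
        qed (use \<epsilon> in auto)
        also have "\<dots> \<le> g d"
          unfolding g_def m_def using n r pnorm_component_le[of "{..<M + k}" n "\<lambda>n. cmod (W (j - d, n))" r] by auto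
        finally show "exp (- 2) / 2 ^ (k - Suc n) \<le> g d" by simp
      qed
      also have "\<dots> = (\<Sum>m\<in>(\<lambda>d. j - d) ` {1..j}. pnorm r {..<M + k} (\<lambda>n. cmod (W (m, n))))"
        unfolding g_def by (subst sum.reindex) (auto simp: inj_on_def)
      also have "\<dots> \<le> (\<Sum>m<M + k. pnorm r {..<M + k} (\<lambda>n. cmod (W (m, n))))"
        using jM by (intro sum_mono2) auto
      also have "\<dots> = tn (M + k) W" by (simp add: trunc_norm_def mnorm_def q pnorm_1)
      also have "\<dots> \<le> nrm W" using WV by (intro tn_le_nrm) (simp add: W_def)
      finally show ?thesis by (simp add: W_def)
    qed
    have "ennreal (x powr p * (T / 2)) = ennreal (x powr p) * ennreal (T / 2)"
      using T by (intro ennreal_mult) auto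
    also have "\<dots> = Lp_mass p {T / 2..<T} (\<lambda>t. x)"
      using T by (simp add: nn_integral_cmult_indicator)
    also have "\<dots> \<le> Lp_mass p I (\<lambda>t. nrm (Au F t))"
    proof (rule nn_integral_mono_AE, use b(1) in eventually_elim)
      fix t assume WV: "t \<in> I \<longrightarrow> Au F t \<in> V"
      show "ennreal (x powr p) * indicator {T / 2..<T} t \<le> ennreal (nrm (Au F t) powr p) * indicator I t"
      proof (cases "t \<in> {T / 2..<T}")
        case True
        then have "t \<in> I" using k0 T by (auto simp: T_def)
        then have "x powr p \<le> nrm (Au F t) powr p"
          using True WV x0 p by (intro powr_mono2 lower) auto
        then show ?thesis using True \<open>t \<in> I\<close> by (simp add: ennreal_leI)
      qed simp
    qed
    also have "\<dots> \<le> ennreal (C * (y * T))" using b(2) by (simp add: y_def powr_powr)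
    finally have "x powr p * (T / 2) \<le> C * (y * T)" using C T by (simp add: y_def)
    then have "T * (x powr p) \<le> T * (2 * C * y)" by (simp add: algebra_simps)
    then have "x powr p \<le> 2 * C * y" using T by simp
    then have "(x powr p) powr (1/p) \<le> (2 * C * y) powr (1/p)" using p by (intro powr_mono2) auto
    then have "x \<le> (2 * C) powr (1/p) * real k powr (1/r)"
      using x0 p C by (simp add: powr_powr powr_mult y_def)
    then have "exp 2 * x \<le> exp 2 * ((2 * C) powr (1/p) * real k powr (1/r))" by (intro mult_left_mono) auto
    moreover have "exp 2 * x = real (k - Suc k0)" by (simp add: x_def exp_minus)
    ultimately show ?thesis using False by (simp add: of_nat_diff mult.assoc)
  qed
  then show False by (rule sublinear_growth_absurd[rotated]) (use r in simp)
qed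

end

theorem corollary3p5:
  fixes p q r :: real and I :: "real set"
  assumes "1 \<le> p" and "1 \<le> q" and "1 \<le> r"
    and "(\<exists>T>0. I = {0<..<T}) \<or> I = {0<..}"
  shows "maximal_Lp_regularity (lqr_space q r) (lqr_norm q r) (diag_dom q r) diag_op diag_semigroup p I
    \<longleftrightarrow> (p > 1 \<and> (q > 1 \<or> r = 1)) \<or> (p = 1 \<and> q = 1 \<and> r = 1)"
proof -
  interpret lqr q r using assms by unfold_locales
  have I: "initial_interval I" using assms(4) by (simp add: initial_interval_def)
  show ?thesis
  proof
    assume "(p > 1 \<and> (q > 1 \<or> r = 1)) \<or> (p = 1 \<and> q = 1 \<and> r = 1)"
    then have "admissible p q r" using assms by (auto simp: admissible_def)
    then show "max_regularity p I"
      using I by (rule maximal_regularity_of_admissible)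
  next
    assume max: "max_regularity p I"
    have "\<not> (q = 1 \<and> 1 < r)" using not_maximal_regularity_l1[of p I] max assms(1) I by blast
    moreover have "\<not> (p = 1 \<and> 1 < q)" using not_maximal_L1_regularity[of I] max I by blast
    ultimately show "(p > 1 \<and> (q > 1 \<or> r = 1)) \<or> (p = 1 \<and> q = 1 \<and> r = 1)" using assms by linarith
  qed
qed

end
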